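(* Let $N$ be a finite supernatural number (a positive integer) and let $d:\mathcal A(N)\to A(N)$ be a derivation in the Bunce-Deddens-Toeplitz algebra $A(N)$. Then there exists a unique function $f\in C(S^1)$ such that $$d=d_f+\tilde d,$$ where $\tilde d$ is approximately inner and $d_f:\mathcal A(N)\to A(N)$ is the unique derivation in $A(N)$ such that $$d_f(a_{\mathrm{per}}(\mathbb K))=0,\qquad d_f(U)=\tfrac1N\,U\,T(f(V^N)),\qquad d_f(U^* )=-\tfrac1N\,T(f(V^N))\,U^*$$ for every $a_{\mathrm{per}}(\mathbb K)\in\mathcal A_{\mathrm{diag,per}}(N)$.
   Context: Let $N$ be a positive integer. On $\ell^2(\mathbb Z_{\ge0})$ with canonical basis $\{E_k\}_{k\ge 0}$ let $UE_k=E_{k+1}$ be the unilateral shift, and for a bounded sequence $a(k)$ let $a(\mathbb K)E_k=a(k)E_k$. Let $\mathcal A_{\mathrm{diag,per}}(N)=\{a(\mathbb K): a \text{ is } j\text{-periodic for some } j\mid N\}$. $A(N)$ is the C$^*$-algebra on $\ell^2(\mathbb Z_{\ge0})$ generated by $U$ and $\mathcal A_{\mathrm{diag,per}}(N)$; $\mathcal A(N)$ is the dense $^*$-subalgebra generated algebraically by $U,U^*$ and $\mathcal A_{\mathrm{diag,per}}(N)$. On $\ell^2(\mathbb Z)$ with canonical basis $\{E_l\}_{l\in\mathbb Z}$ let $VE_l=E_{l+1}$ be the bilateral shift. $P$ is the orthogonal projection of $\ell^2(\mathbb Z)$ onto the closed span of $\{E_l:l\ge0\}\cong\ell^2(\mathbb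 Z_{\ge0})$, and for a bounded operator $b$ on $\ell^2(\mathbb Z)$, $T(b)$ is the bounded operator on $\ell^2(\mathbb Z_{\ge0})$ given by $T(b)g=Pbg$. For $f\in C(S^1)$, $f(V^N)$ is defined by continuous functional calculus for the unitary $V^N$ (so $f(t)=e^{ijt}$ gives $V^{jN}$). For every $f\in C(S^1)$ a derivation $d_f$ with the values prescribed in the claim exists. A derivation in $A(N)$ is a linear map $d:\mathcal A(N)\to A(N)$ with $d(ab)=d(a)b+a\,d(b)$ for all $a,b\in\mathcal A(N)$. It is approximately inner if there are $a_n\in A(N)$ with $d(a)=\lim_{n\to\infty}[a_n,a]$ (in norm) for every $a\in\mathcal A(N)$. *)

theory Defs
  imports
    "HOL-Analysis.Bounded_Linear_Function"
    "HOL-Analysis.Infinite_Sum"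
begin

section \<open>The Hilbert space of square-summable complex families\<close>

typedef 'a ell2 = "{x :: 'a \<Rightarrow> complex. (\<lambda>i. (cmod (x i))\<^sup>2) summable_on UNIV}"
  morphisms coord Ell2
  by (rule exI[of _ "\<lambda>_. 0"]) simp

setup_lifting type_definition_ell2

lemma coord_summable: "(\<lambda>i. (cmod (coord x i))\<^sup>2) summable_on UNIV"
  using coord[of x] by simp

lemma ell2_eqI: "(\<And>i. coord x i = coord y i) \<Longrightarrow> x = y"
  by (metis coord_inject ext)

lemma ell2_add_closed:
  fixes x y :: "'a \<Rightarrow> complex"
  assumes "(\<lambda>i. (cmod (x i))\<^sup>2) summable_on UNIV" "(\<lambda>i. (cmod (y i))\<^sup>2) summable_on UNIV"
  shows "(\<lambda>i. (cmod (x i + y i))\<^sup>2) summable_on UNIV"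
proof (rule summable_on_comparison_test)
  show "(\<lambda>i. 2 * (cmod (x i))\<^sup>2 + 2 * (cmod (y i))\<^sup>2) summable_on UNIV"
    using assms by (intro summable_on_add summable_on_cmult_right)
  fix i
  have "cmod (x i + y i) \<le> cmod (x i) + cmod (y i)"
    by (rule norm_triangle_ineq)
  then have "(cmod (x i + y i))\<^sup>2 \<le> (cmod (x i) + cmod (y i))\<^sup>2"
    by (intro power_mono) auto
  also have "\<dots> \<le> 2 * (cmod (x i))\<^sup>2 + 2 * (cmod (y i))\<^sup>2"
    using sum_squares_bound[of "cmod (x i)" "cmod (y i)"] by (simp add: power2_sum)
  finally show "(cmod (x i + y i))\<^sup>2 \<le> 2 * (cmod (x i))\<^sup>2 + 2 * (cmod (y i))\<^sup>2" .
qed auto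

lemma ell2_scale_closed:
  fixes x :: "'a \<Rightarrow> complex"
  assumes "(\<lambda>i. (cmod (x i))\<^sup>2) summable_on UNIV"
  shows "(\<lambda>i. (cmod (c * x i))\<^sup>2) summable_on UNIV"
  using assms by (simp add: norm_mult power_mult_distrib summable_on_cmult_right)

lift_definition cscale :: "complex \<Rightarrow> 'a ell2 \<Rightarrow> 'a ell2" is "\<lambda>c x i. c * x i"
  by (rule ell2_scale_closed)

text \<open>The inner product is linear in the first argument.\<close>

definition cinner :: "'a ell2 \<Rightarrow> 'a ell2 \<Rightarrow> complex"
  where "cinner x y = (\<Sum>\<^sub>\<infinity>i. coord x i * cnj (coord y i))"

lemma cinner_summable: "(\<lambda>i. coord x i * cnj (coord y i)) summable_on UNIV"
proof (rule abs_summable_summable, rule summable_on_comparison_test)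
  show "(\<lambda>i. (cmod (coord x i))\<^sup>2 + (cmod (coord y i))\<^sup>2) summable_on UNIV"
    by (intro summable_on_add coord_summable)
  fix i
  show "cmod (coord x i * cnj (coord y i)) \<le> (cmod (coord x i))\<^sup>2 + (cmod (coord y i))\<^sup>2"
    using sum_squares_bound[of "cmod (coord x i)" "cmod (coord y i)"]
      mult_nonneg_nonneg[OF norm_ge_zero norm_ge_zero, of "coord x i" "coord y i"]
    unfolding norm_mult complex_mod_cnj by linarith
qed auto

instantiation ell2 :: (type) real_vector
begin

lift_definition zero_ell2 :: "'a ell2" is "\<lambda>_. 0" by simp
lift_definition plus_ell2 :: "'a ell2 \<Rightarrow> 'a ell2 \<Rightarrow> 'a ell2" is "\<lambda>x y i. x i + y i"
  by (rule ell2_add_closed)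
lift_definition uminus_ell2 :: "'a ell2 \<Rightarrow> 'a ell2" is "\<lambda>x i. - x i" by simp
lift_definition minus_ell2 :: "'a ell2 \<Rightarrow> 'a ell2 \<Rightarrow> 'a ell2" is "\<lambda>x y i. x i - y i"
proof -
  fix x y :: "'a \<Rightarrow> complex"
  assume "(\<lambda>i. (cmod (x i))\<^sup>2) summable_on UNIV" "(\<lambda>i. (cmod (y i))\<^sup>2) summable_on UNIV"
  then show "(\<lambda>i. (cmod (x i - y i))\<^sup>2) summable_on UNIV"
    using ell2_add_closed[of x "\<lambda>i. - y i"] by simp
qed
lift_definition scaleR_ell2 :: "real \<Rightarrow> 'a ell2 \<Rightarrow> 'a ell2" is "\<lambda>r x i. complex_of_real r * x i"
  by (rule ell2_scale_closed)

instance
  by (standard; transfer; simp add: algebra_simps)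

end

instantiation ell2 :: (type) real_inner
begin

definition inner_ell2 :: "'a ell2 \<Rightarrow> 'a ell2 \<Rightarrow> real" where "inner_ell2 x y = Re (cinner x y)"
definition norm_ell2 :: "'a ell2 \<Rightarrow> real" where "norm_ell2 x = sqrt (\<Sum>\<^sub>\<infinity>i. (cmod (coord x i))\<^sup>2)"
definition dist_ell2 :: "'a ell2 \<Rightarrow> 'a ell2 \<Rightarrow> real" where "dist_ell2 x y = norm (x - y)"
definition sgn_ell2 :: "'a ell2 \<Rightarrow> 'a ell2" where "sgn_ell2 x = inverse (norm x) *\<^sub>R x"
definition uniformity_ell2 :: "('a ell2 \<times> 'a ell2) filter"
  where "uniformity_ell2 = (INF e\<in>{0<..}. principal {(x, y). dist x y < e})"
definition open_ell2 :: "'a ell2 set \<Rightarrow> bool"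
  where "open_ell2 S = (\<forall>x\<in>S. \<forall>\<^sub>F (x', y) in uniformity. x' = x \<longrightarrow> y \<in> S)"

lemma Re_cinner: "Re (cinner x y) = (\<Sum>\<^sub>\<infinity>i. Re (coord x i * cnj (coord y i)))"
  unfolding cinner_def by (rule infsum_Re[OF cinner_summable, symmetric])

lemma Re_cinner_self: "Re (cinner x x) = (\<Sum>\<^sub>\<infinity>i. (cmod (coord x i))\<^sup>2)"
  unfolding Re_cinner by (rule infsum_cong) (simp add: cmod_power2 flip: power2_eq_square)

lemma cinner_add_left: "cinner (x + y) z = cinner x z + cinner y z"
  unfolding cinner_def
  by (simp add: plus_ell2.rep_eq distrib_right infsum_add cinner_summable)

lemma cinner_commute: "cinner y x = cnj (cinner x y)"
  unfolding cinner_def by (simp flip: infsum_cnj add: mult.commute)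

instance
proof
  fix x y z :: "'a ell2" and r :: real
  show "dist x y = norm (x - y)" "sgn x = x /\<^sub>R norm x"
    by (simp_all add: dist_ell2_def sgn_ell2_def)
  show "uniformity = (INF e\<in>{0<..}. principal {(x :: 'a ell2, y). dist x y < e})"
    by (rule uniformity_ell2_def)
  show "open U = (\<forall>x\<in>U. \<forall>\<^sub>F (x', y) in uniformity. x' = x \<longrightarrow> y \<in> U)" for U :: "'a ell2 set"
    by (rule open_ell2_def)
  show "inner x y = inner y x"
    unfolding inner_ell2_def by (subst cinner_commute) simp
  show "inner (x + y) z = inner x z + inner y z"
    unfolding inner_ell2_def by (simp add: cinner_add_left)
  show "inner (r *\<^sub>R x) y = r * inner x y"
    unfolding inner_ell2_def Re_cinner
    by (simp add: scaleR_ell2.rep_eq infsum_cmult_right' mult.assoc Re_complex_of_real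
        flip: right_diff_distrib distrib_left)
  show "0 \<le> inner x x"
    unfolding inner_ell2_def Re_cinner_self by (rule infsum_nonneg) simp
  show "inner x x = 0 \<longleftrightarrow> x = 0"
  proof
    assume "inner x x = 0"
    then have "(\<Sum>\<^sub>\<infinity>i. (cmod (coord x i))\<^sup>2) \<le> 0"
      unfolding inner_ell2_def Re_cinner_self by simp
    then have "(cmod (coord x i))\<^sup>2 = 0" for i
      by (rule nonneg_infsum_le_0D) (auto simp: coord_summable)
    then show "x = 0" by (intro ell2_eqI) (simp add: zero_ell2.rep_eq)
  qed (simp add: inner_ell2_def Re_cinner_self zero_ell2.rep_eq)
  show "norm x = sqrt (inner x x)"
    by (simp add: inner_ell2_def Re_cinner_self norm_ell2_def)
qed

end

section \<open>Bounded operators\<close>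

text \<open>
  The library's bounded linear functions are only real linear, so complex linearity is a separate
  predicate.
\<close>

definition clinear_op :: "('a ell2 \<Rightarrow>\<^sub>L 'b ell2) \<Rightarrow> bool"
  where "clinear_op a \<longleftrightarrow> (\<forall>c x. blinfun_apply a (cscale c x) = cscale c (blinfun_apply a x))"

lemma norm_cscale: "norm (cscale c x) = cmod c * norm x"
  unfolding norm_ell2_def
  by (simp add: cscale.rep_eq norm_mult power_mult_distrib infsum_cmult_right' real_sqrt_mult)

lemma bounded_linear_cscale: "bounded_linear (cscale c)"
proof (rule bounded_linear_intro)
  show "cscale c (x + y) = cscale c x + cscale c y" for x y :: "'a ell2"
    by transfer (simp add: distrib_left)
  show "cscale c (r *\<^sub>R x) = r *\<^sub>R cscale c x" for r and x :: "'a ell2"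
    by transfer (simp add: mult.left_commute)
  show "norm (cscale c x) \<le> norm x * cmod c" for x :: "'a ell2"
    by (simp add: norm_cscale)
qed

definition cscale_op :: "complex \<Rightarrow> ('a ell2 \<Rightarrow>\<^sub>L 'b ell2) \<Rightarrow> ('a ell2 \<Rightarrow>\<^sub>L 'b ell2)"
  where "cscale_op c a = Blinfun (\<lambda>x. cscale c (blinfun_apply a x))"

lemma cscale_op_apply: "blinfun_apply (cscale_op c a) x = cscale c (blinfun_apply a x)"
  unfolding cscale_op_def
  by (subst bounded_linear_Blinfun_apply)
    (rule bounded_linear_compose[OF bounded_linear_cscale blinfun.bounded_linear_right], rule refl)

definition adj :: "('a ell2 \<Rightarrow>\<^sub>L 'b ell2) \<Rightarrow> ('b ell2 \<Rightarrow>\<^sub>L 'a ell2)"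
  where "adj a = (THE b. \<forall>x y. cinner (blinfun_apply a x) y = cinner x (blinfun_apply b y))"

lemma adj_eqI:
  assumes "\<And>x y. cinner (blinfun_apply a x) y = cinner x (blinfun_apply b y)"
  shows "adj a = b"
  unfolding adj_def
proof (rule the_equality)
  fix b' assume *: "\<forall>x y. cinner (blinfun_apply a x) y = cinner x (blinfun_apply b' y)"
  show "b' = b"
  proof (rule blinfun_eqI)
    fix y
    have "inner x (blinfun_apply b' y) = inner x (blinfun_apply b y)" for x
      using * assms by (simp add: inner_ell2_def)
    then have "inner x (blinfun_apply b' y - blinfun_apply b y) = 0" for x
      by (simp add: inner_diff_right)
    from this[of "blinfun_apply b' y - blinfun_apply b y"]
    show "blinfun_apply b' y = blinfun_apply b y" by simp
  qed
qed (use assms in blast)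

definition op_pow :: "('a ell2 \<Rightarrow>\<^sub>L 'a ell2) \<Rightarrow> nat \<Rightarrow> ('a ell2 \<Rightarrow>\<^sub>L 'a ell2)"
  where "op_pow a n = ((o\<^sub>L) a ^^ n) id_blinfun"

lemma
  fixes x :: "'a \<Rightarrow> complex" and g :: "'b \<Rightarrow> 'a"
  assumes x: "(\<lambda>i. (cmod (x i))\<^sup>2) summable_on UNIV" and g: "inj_on g {j. P j}"
  shows ell2_reindex_closed: "(\<lambda>j. (cmod (if P j then x (g j) else 0))\<^sup>2) summable_on UNIV"
    and ell2_reindex_le:
      "(\<Sum>\<^sub>\<infinity>j. (cmod (if P j then x (g j) else 0))\<^sup>2) \<le> (\<Sum>\<^sub>\<infinity>i. (cmod (x i))\<^sup>2)"
proof -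
  let ?h = "\<lambda>i. (cmod (x i))\<^sup>2"
  have img: "?h summable_on g ` {j. P j}"
    by (rule summable_on_subset_banach[OF x]) simp
  then have "(?h \<circ> g) summable_on {j. P j}"
    using summable_on_reindex[OF g] by blast
  then show "(\<lambda>j. (cmod (if P j then x (g j) else 0))\<^sup>2) summable_on UNIV"
    by (rule summable_on_cong_neutral[THEN iffD1, rotated 3]) auto
  have "(\<Sum>\<^sub>\<infinity>j. (cmod (if P j then x (g j) else 0))\<^sup>2) = infsum (?h \<circ> g) {j. P j}"
    by (rule infsum_cong_neutral) auto
  also have "\<dots> = infsum ?h (g ` {j. P j})"
    by (rule infsum_reindex[OF g, symmetric])
  also have "\<dots> \<le> infsum ?h UNIV"
    by (rule infsum_mono_neutral[OF img x]) auto
  finally show "(\<Sum>\<^sub>\<infinity>j. (cmod (if P j then x (g j) else 0))\<^sup>2) \<le> (\<Sum>\<^sub>\<infinity>i. (cmod (x i))\<^sup>2)" .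
qed

lemma coord_reindex:
  assumes "inj_on g {j. P j}"
  shows "coord (Ell2 (\<lambda>j. if P j then coord x (g j) else 0)) j = (if P j then coord x (g j) else 0)"
  using ell2_reindex_closed[OF coord_summable assms] by (subst Ell2_inverse) auto

lemma bounded_linear_reindex:
  assumes g: "inj_on g {j. P j}"
  shows "bounded_linear (\<lambda>x. Ell2 (\<lambda>j. if P j then coord x (g j) else 0))"
proof (rule bounded_linear_intro[where K = 1])
  show "norm (Ell2 (\<lambda>j. if P j then coord x (g j) else 0)) \<le> norm x * 1" for x
    unfolding norm_ell2_def coord_reindex[OF g]
    using ell2_reindex_le[OF coord_summable g] by simp
qed (auto intro!: ell2_eqI simp: coord_reindex[OF g] plus_ell2.rep_eq scaleR_ell2.rep_eq)

lift_definition unilateral_shift :: "nat ell2 \<Rightarrow>\<^sub>L nat ell2"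
  is "\<lambda>x. Ell2 (\<lambda>k. if 0 < k then coord x (k - 1) else 0)"
  by (rule bounded_linear_reindex) (auto simp: inj_on_def)

lift_definition bilateral_shift :: "int ell2 \<Rightarrow>\<^sub>L int ell2"
  is "\<lambda>x. Ell2 (\<lambda>l. coord x (l - 1))"
  by (rule bounded_linear_reindex[where P = "\<lambda>_. True", simplified]) (auto simp: inj_on_def)

text \<open>
  Under the identification of \<open>\<ell>\<^sup>2(\<int>\<^sub>\<ge>\<^sub>0)\<close> with a closed subspace of \<open>\<ell>\<^sup>2(\<int>)\<close>, \<open>nat_embed\<close> is the
  inclusion and \<open>nat_proj\<close> the orthogonal projection, so that \<open>toeplitz b g = P b g\<close>.
\<close>

lift_definition nat_embed :: "nat ell2 \<Rightarrow>\<^sub>L int ell2"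
  is "\<lambda>x. Ell2 (\<lambda>l. if 0 \<le> l then coord x (nat l) else 0)"
  by (rule bounded_linear_reindex) (auto simp: inj_on_def)

lift_definition nat_proj :: "int ell2 \<Rightarrow>\<^sub>L nat ell2"
  is "\<lambda>x. Ell2 (\<lambda>k. coord x (int k))"
  by (rule bounded_linear_reindex[where P = "\<lambda>_. True", simplified]) (auto simp: inj_on_def)

definition toeplitz :: "(int ell2 \<Rightarrow>\<^sub>L int ell2) \<Rightarrow> (nat ell2 \<Rightarrow>\<^sub>L nat ell2)"
  where "toeplitz b = nat_proj o\<^sub>L b o\<^sub>L nat_embed"

lemma
  fixes x :: "'a ell2"
  assumes B: "\<And>k. cmod (a k) \<le> B"
  shows coord_diag: "coord (Ell2 (\<lambda>k. a k * coord x k)) k = a k * coord x k"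
    and norm_diag_le: "norm (Ell2 (\<lambda>k. a k * coord x k)) \<le> norm x * B"
proof -
  have B0: "0 \<le> B"
    using order_trans[OF norm_ge_zero B] by blast
  have le: "(cmod (a k * coord x k))\<^sup>2 \<le> B\<^sup>2 * (cmod (coord x k))\<^sup>2" for k
    unfolding norm_mult power_mult_distrib
    by (intro mult_right_mono power_mono B) auto
  have s: "(\<lambda>k. B\<^sup>2 * (cmod (coord x k))\<^sup>2) summable_on UNIV"
    by (intro summable_on_cmult_right coord_summable)
  have s': "(\<lambda>k. (cmod (a k * coord x k))\<^sup>2) summable_on UNIV"
    by (rule summable_on_comparison_test[OF s le]) simp
  then show c: "coord (Ell2 (\<lambda>k. a k * coord x k)) k = a k * coord x k" for k
    by (subst Ell2_inverse) auto
  have "(\<Sum>\<^sub>\<infinity>k. (cmod (a k * coord x k))\<^sup>2) \<le> B\<^sup>2 * (\<Sum>\<^sub>\<infinity>k. (cmod (coord x k))\<^sup>2)"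
    using infsum_mono[OF s' s le] by (simp add: infsum_cmult_right')
  then have "sqrt (\<Sum>\<^sub>\<infinity>k. (cmod (a k * coord x k))\<^sup>2) \<le> sqrt (B\<^sup>2 * (\<Sum>\<^sub>\<infinity>k. (cmod (coord x k))\<^sup>2))"
    by (rule real_sqrt_le_mono)
  then show "norm (Ell2 (\<lambda>k. a k * coord x k)) \<le> norm x * B"
    unfolding norm_ell2_def c using B0 by (simp add: real_sqrt_mult mult.commute)
qed

text \<open>The operator \<open>a(\<bbbK>)\<close>; unbounded sequences are sent to \<open>0\<close>.\<close>

lift_definition diag_op :: "(nat \<Rightarrow> complex) \<Rightarrow> (nat ell2 \<Rightarrow>\<^sub>L nat ell2)"
  is "\<lambda>a x. if bounded (range a) then Ell2 (\<lambda>k. a k * coord x k) else 0"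
proof -
  fix a :: "nat \<Rightarrow> complex"
  show "bounded_linear (\<lambda>x. if bounded (range a) then Ell2 (\<lambda>k. a k * coord x k) else 0)"
  proof (cases "bounded (range a)")
    case True
    then obtain B where B: "\<And>k. cmod (a k) \<le> B" by (auto simp: bounded_iff)
    have "bounded_linear (\<lambda>x. Ell2 (\<lambda>k. a k * coord x k))"
    proof (rule bounded_linear_intro)
      show "norm (Ell2 (\<lambda>k. a k * coord x k)) \<le> norm x * B" for x
        by (rule norm_diag_le[OF B])
    next
      show "Ell2 (\<lambda>k. a k * coord (x + y) k) =
          Ell2 (\<lambda>k. a k * coord x k) + Ell2 (\<lambda>k. a k * coord y k)" for x y
        by (rule ell2_eqI) (simp only: coord_diag[OF B], simp only: coord_diag[OF B] plus_ell2.rep_eq distrib_left)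
      show "Ell2 (\<lambda>k. a k * coord (r *\<^sub>R x) k) = r *\<^sub>R Ell2 (\<lambda>k. a k * coord x k)" for r x
        by (rule ell2_eqI) (simp only: coord_diag[OF B], simp only: coord_diag[OF B] scaleR_ell2.rep_eq mult.left_commute)
    qed
    with True show ?thesis by simp
  qed (simp add: bounded_linear_zero)
qed

section \<open>Bunce-Deddens-Toeplitz algebras\<close>

definition diag_per :: "nat \<Rightarrow> (nat ell2 \<Rightarrow>\<^sub>L nat ell2) set"
  where "diag_per N = {diag_op a | a. \<exists>j. j dvd N \<and> (\<forall>k. a (k + j) = a k)}"

inductive_set generated_algebra :: "('a ell2 \<Rightarrow>\<^sub>L 'a ell2) set \<Rightarrow> ('a ell2 \<Rightarrow>\<^sub>L 'a ell2) set"
  for G where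
  gen: "a \<in> G \<Longrightarrow> a \<in> generated_algebra G"
| zero: "0 \<in> generated_algebra G"
| add: "a \<in> generated_algebra G \<Longrightarrow> b \<in> generated_algebra G \<Longrightarrow> a + b \<in> generated_algebra G"
| scale: "a \<in> generated_algebra G \<Longrightarrow> cscale_op c a \<in> generated_algebra G"
| mult: "a \<in> generated_algebra G \<Longrightarrow> b \<in> generated_algebra G \<Longrightarrow> a o\<^sub>L b \<in> generated_algebra G"

definition cstar_subalgebra :: "('a ell2 \<Rightarrow>\<^sub>L 'a ell2) set \<Rightarrow> bool"
  where "cstar_subalgebra S \<longleftrightarrow>
    (\<forall>a\<in>S. clinear_op a) \<and> 0 \<in> S \<and> (\<forall>a\<in>S. \<forall>b\<in>S. a + b \<in> S) \<and> (\<forall>c. \<forall>a\<in>S. cscale_op c a \<in> S) \<and>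
    (\<forall>a\<in>S. \<forall>b\<in>S. a o\<^sub>L b \<in> S) \<and> (\<forall>a\<in>S. adj a \<in> S) \<and> closed S"

definition generated_cstar :: "('a ell2 \<Rightarrow>\<^sub>L 'a ell2) set \<Rightarrow> ('a ell2 \<Rightarrow>\<^sub>L 'a ell2) set"
  where "generated_cstar G = \<Inter>{S. cstar_subalgebra S \<and> G \<subseteq> S}"

definition BDT_alg :: "nat \<Rightarrow> (nat ell2 \<Rightarrow>\<^sub>L nat ell2) set"
  where "BDT_alg N = generated_cstar (insert unilateral_shift (diag_per N))"

text \<open>
  The generating set is invariant under \<^const>\<open>adj\<close>, so the algebra it generates is already a
  \<open>*\<close>-algebra.
\<close>

definition BDT_poly :: "nat \<Rightarrow> (nat ell2 \<Rightarrow>\<^sub>L nat ell2) set"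
  where "BDT_poly N =
    generated_algebra ({unilateral_shift, adj unilateral_shift} \<union> diag_per N)"

section \<open>Continuous functional calculus for unitaries\<close>

text \<open>
  Functions on the circle \<open>S\<^sup>1 = \<real>/2\<pi>\<int>\<close>, in terms of the angle: the coordinate function of the
  circle as a subset of the plane is \<^const>\<open>cis\<close>, i.e. \<open>t \<mapsto> e\<^sup>i\<^sup>t\<close>.
\<close>

definition C_circle :: "(real \<Rightarrow> complex) set"
  where "C_circle = {f. continuous_on UNIV f \<and> (\<forall>t. f (t + 2 * pi) = f t)}"

text \<open>
  For unitary \<open>u\<close>, the continuous functional calculus is the unique unital \<open>*\<close>-homomorphism from
  the continuous functions on the circle to the bounded operators which takes the coordinate
  function to \<open>u\<close>.
\<close>

definition is_calculus ::
    "('a ell2 \<Rightarrow>\<^sub>L 'a ell2) \<Rightarrow> ((real \<Rightarrow> complex) \<Rightarrow> ('a ell2 \<Rightarrow>\<^sub>L 'a ell2)) \<Rightarrow> bool"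
  where "is_calculus u \<Phi> \<longleftrightarrow>
    (\<forall>f\<in>C_circle. clinear_op (\<Phi> f)) \<and>
    (\<forall>f\<in>C_circle. \<forall>g\<in>C_circle. \<Phi> (\<lambda>t. f t + g t) = \<Phi> f + \<Phi> g) \<and>
    (\<forall>c. \<forall>f\<in>C_circle. \<Phi> (\<lambda>t. c * f t) = cscale_op c (\<Phi> f)) \<and>
    (\<forall>f\<in>C_circle. \<forall>g\<in>C_circle. \<Phi> (\<lambda>t. f t * g t) = \<Phi> f o\<^sub>L \<Phi> g) \<and>
    (\<forall>f\<in>C_circle. \<Phi> (\<lambda>t. cnj (f t)) = adj (\<Phi> f)) \<and>
    \<Phi> (\<lambda>_. 1) = id_blinfun \<and> \<Phi> cis = u"

definition fun_calc :: "(real \<Rightarrow> complex) \<Rightarrow> ('a ell2 \<Rightarrow>\<^sub>L 'a ell2) \<Rightarrow> ('a ell2 \<Rightarrow>\<^sub>L 'a ell2)"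
  where "fun_calc f u = (THE b. \<exists>\<Phi>. is_calculus u \<Phi> \<and> b = \<Phi> f)"

section \<open>Derivations\<close>

text \<open>
  Maps on \<^term>\<open>BDT_poly N\<close> are represented by total functions; their values elsewhere are irrelevant.
\<close>

definition derivation_in :: "nat \<Rightarrow> ((nat ell2 \<Rightarrow>\<^sub>L nat ell2) \<Rightarrow> (nat ell2 \<Rightarrow>\<^sub>L nat ell2)) \<Rightarrow> bool"
  where "derivation_in N d \<longleftrightarrow>
    (\<forall>a\<in>BDT_poly N. d a \<in> BDT_alg N) \<and>
    (\<forall>a\<in>BDT_poly N. \<forall>b\<in>BDT_poly N. d (a + b) = d a + d b) \<and>
    (\<forall>c. \<forall>a\<in>BDT_poly N. d (cscale_op c a) = cscale_op c (d a)) \<and>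
    (\<forall>a\<in>BDT_poly N. \<forall>b\<in>BDT_poly N. d (a o\<^sub>L b) = (d a o\<^sub>L b) + (a o\<^sub>L d b))"

definition approximately_inner ::
    "nat \<Rightarrow> ((nat ell2 \<Rightarrow>\<^sub>L nat ell2) \<Rightarrow> (nat ell2 \<Rightarrow>\<^sub>L nat ell2)) \<Rightarrow> bool"
  where "approximately_inner N d \<longleftrightarrow> derivation_in N d \<and>
    (\<exists>s :: nat \<Rightarrow> (nat ell2 \<Rightarrow>\<^sub>L nat ell2). (\<forall>n. s n \<in> BDT_alg N) \<and>
      (\<forall>a\<in>BDT_poly N. (\<lambda>n. (s n o\<^sub>L a) - (a o\<^sub>L s n)) \<longlonglongrightarrow> d a))"

definition special_derivation ::
    "nat \<Rightarrow> (real \<Rightarrow> complex) \<Rightarrow> ((nat ell2 \<Rightarrow>\<^sub>L nat ell2) \<Rightarrow> (nat ell2 \<Rightarrow>\<^sub>L nat ell2)) \<Rightarrow> bool"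
  where "special_derivation N f d \<longleftrightarrow> derivation_in N d \<and>
    (\<forall>a\<in>diag_per N. d a = 0) \<and>
    d unilateral_shift =
      (1 / real N) *\<^sub>R (unilateral_shift o\<^sub>L toeplitz (fun_calc f (op_pow bilateral_shift N))) \<and>
    d (adj unilateral_shift) =
      - ((1 / real N) *\<^sub>R (toeplitz (fun_calc f (op_pow bilateral_shift N)) o\<^sub>L adj unilateral_shift))"

end

theory Submission
  imports Defs "HOL-Analysis.Analysis"
begin

text \<open>
  Subtracting an inner derivation, \<open>d\<close> may be assumed to vanish on the finite-dimensional periodic
  diagonal; a further inner perturbation gives \<open>d U = U y\<close> and \<open>d U\<^sup>* = - y U\<^sup>*\<close>, where \<open>y\<close> lies in
  \<open>A(N)\<close> and commutes with the periodic diagonal. For \<open>y = U\<^sup>n a(\<bbbK>)\<close> with \<open>N dvd n\<close> and \<open>a\<close> eventually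
  periodic of mean \<open>m\<close>, the partial sums of \<open>a - m\<close> are eventually periodic, and they exhibit the
  derivation attached to \<open>y - m U\<^sup>n\<close> as inner. These \<open>y\<close> span a dense set, and the Toeplitz part \<open>t\<close> split
  off from \<open>y\<close> satisfies \<open>\<parallel>t\<parallel> \<le> \<parallel>y\<parallel>\<close>: averaging \<open>U\<^sup>* s U - s \<approx> y - t\<close> over the iterates of
  \<open>z \<mapsto> U\<^sup>* z U\<close> makes the left-hand side disappear and fixes \<open>t\<close>. Hence the splitting extends to all \<open>y\<close>,
  and the case \<open>y = 0\<close> of the same estimate gives uniqueness, as \<open>f \<mapsto> T(f(V\<^sup>N))\<close> is isometric.
\<close>

section \<open>Square-summable families and adjoints\<close>

text \<open>The obstacle is that \<open>U\<close> is an isometry and not a unitary. For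
  \<open>X = d U\<close> the candidate \<open>y = U' X\<close> sees only the part of
  \<open>X\<close> in the range of \<open>U\<close>; the rest, \<open>(1 - U U') X\<close>, must
  come from a commutator, and \<open>d U'\<close> is a separate datum, tied to \<open>X\<close> only
  by differentiating \<open>U' U = 1\<close>. The same defect forces eventually periodic weights in
  place of periodic ones. The periodic diagonal is spanned by the N projections onto residue
  classes; compressing by them keeps exactly the weighted shifts whose step is a multiple of N,
  which is why the symbol is evaluated at V^N. The splitting of \<open>y\<close> is handled as a
  relation between \<open>y\<close> and \<open>t\<close>, not as a map. The norm estimate makes
  Toeplitz parts Cauchy along a limit; for the limit to have a continuous symbol again, f ->
  T(f(V^N)) needs closed range. Hence a two-sided norm bound: from above by the Fourier transform of
  finitely supported vectors, from below by truncated eigenvectors of V^N on nonnegative indices.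
  Since \<open>fun_calc\<close> is a definite description, existence and uniqueness of the calculus
  are both proved, with contractivity derived from the algebraic axioms.\<close>

lemmas coord_simps [simp] =
  zero_ell2.rep_eq plus_ell2.rep_eq minus_ell2.rep_eq uminus_ell2.rep_eq scaleR_ell2.rep_eq cscale.rep_eq

lemma coord_sum: "coord (sum f A) i = (\<Sum>j\<in>A. coord (f j) i)"
  by (induction A rule: infinite_finite_induct) auto

lemma norm_ell2_power2: "(norm x)\<^sup>2 = (\<Sum>\<^sub>\<infinity>i. (cmod (coord x i))\<^sup>2)"
  by (simp add: norm_ell2_def infsum_nonneg)

lemma sum_coord_le_norm: "finite F \<Longrightarrow> (\<Sum>i\<in>F. (cmod (coord x i))\<^sup>2) \<le> (norm x)\<^sup>2"
  unfolding norm_ell2_power2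
  by (rule finite_sum_le_infsum) (auto simp: coord_summable)

lemma coord_le_norm: "cmod (coord x i) \<le> norm x"
proof -
  have "(cmod (coord x i))\<^sup>2 \<le> (norm x)\<^sup>2"
    using sum_coord_le_norm[of "{i}" x] by simp
  then show ?thesis by (simp add: power2_le_iff_abs_le)
qed

lemma norm_ell2_finite:
  assumes "finite F" "\<And>i. i \<notin> F \<Longrightarrow> coord x i = 0"
  shows "(norm x)\<^sup>2 = (\<Sum>i\<in>F. (cmod (coord x i))\<^sup>2)"
proof -
  have "(\<Sum>\<^sub>\<infinity>i. (cmod (coord x i))\<^sup>2) = infsum (\<lambda>i. (cmod (coord x i))\<^sup>2) F"
    by (rule infsum_cong_neutral) (use assms in auto)
  then show ?thesis using assms by (simp add: norm_ell2_power2)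
qed

text \<open>A bound uniform over finite index sets yields membership in the space and the norm bound
  together. This is how vectors known only by coordinates are constructed, for completeness and for
  adjoints.\<close>

lemma
  assumes "\<And>F. finite F \<Longrightarrow> (\<Sum>i\<in>F. (cmod (c i))\<^sup>2) \<le> B\<^sup>2"
  shows coord_Ell2_bounded: "coord (Ell2 c) = c"
    and norm_Ell2_bounded: "0 \<le> B \<Longrightarrow> norm (Ell2 c) \<le> B"
proof -
  have s: "(\<lambda>i. (cmod (c i))\<^sup>2) summable_on UNIV"
    by (rule nonneg_bounded_partial_sums_imp_summable_on[where C = "B\<^sup>2"])
      (use assms in \<open>auto simp: eventually_finite_subsets_at_top\<close>)
  then show c: "coord (Ell2 c) = c"
    by (simp add: Ell2_inverse)
  have "(norm (Ell2 c))\<^sup>2 \<le> B\<^sup>2"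
    unfolding norm_ell2_power2 c
    by (rule infsum_le_finite_sums[OF s]) (use assms in auto)
  then show "0 \<le> B \<Longrightarrow> norm (Ell2 c) \<le> B"
    by (rule power2_le_imp_le)
qed

text \<open>Completeness of the vectors gives completeness of the bounded operators, from which the
  functional calculus and the limits of Toeplitz parts are obtained.\<close>

instance ell2 :: (type) banach
proof
  fix X :: "nat \<Rightarrow> 'a ell2"
  assume X: "Cauchy X"
  have "Cauchy (\<lambda>n. coord (X n) i)" for i
  proof (rule CauchyI)
    fix e :: real assume "0 < e"
    then obtain M where M: "\<And>m n. m \<ge> M \<Longrightarrow> n \<ge> M \<Longrightarrow> norm (X m - X n) < e"
      using CauchyD[OF X] by blast
    have "norm (coord (X m) i - coord (X n) i) < e" if "m \<ge> M" "n \<ge> M" for m n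
      using coord_le_norm[of "X m - X n" i] M[OF that] by simp
    then show "\<exists>M. \<forall>m\<ge>M. \<forall>n\<ge>M. norm (coord (X m) i - coord (X n) i) < e" by blast
  qed
  then obtain c where c: "\<And>i. (\<lambda>n. coord (X n) i) \<longlonglongrightarrow> c i"
    by (meson Cauchy_convergent convergent_def)
  have tail: "\<exists>M. \<forall>n\<ge>M. \<forall>F. finite F \<longrightarrow> (\<Sum>i\<in>F. (cmod (coord (X n) i - c i))\<^sup>2) \<le> e\<^sup>2"
    if e: "e > 0" for e
  proof -
    obtain M where M: "\<And>m n. m \<ge> M \<Longrightarrow> n \<ge> M \<Longrightarrow> norm (X m - X n) < e"
      using CauchyD[OF X e] by blast
    have "(\<Sum>i\<in>F. (cmod (coord (X n) i - c i))\<^sup>2) \<le> e\<^sup>2" if n: "n \<ge> M" and F: "finite F" for n F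
    proof (rule tendsto_upperbound)
      show "(\<lambda>m. \<Sum>i\<in>F. (cmod (coord (X n) i - coord (X m) i))\<^sup>2)
          \<longlonglongrightarrow> (\<Sum>i\<in>F. (cmod (coord (X n) i - c i))\<^sup>2)"
        by (intro tendsto_intros c)
      have "(\<Sum>i\<in>F. (cmod (coord (X n) i - coord (X m) i))\<^sup>2) \<le> e\<^sup>2" if "m \<ge> M" for m
        using sum_coord_le_norm[OF F, of "X n - X m"] M[OF n that]
          power_mono[of "norm (X n - X m)" e 2] by simp
      then show "\<forall>\<^sub>F m in sequentially. (\<Sum>i\<in>F. (cmod (coord (X n) i - coord (X m) i))\<^sup>2) \<le> e\<^sup>2"
        using eventually_sequentially by blast
    qed simp
    then show ?thesis by blast
  qed
  obtain M1 where M1: "\<And>F. finite F \<Longrightarrow> (\<Sum>i\<in>F. (cmod (coord (X M1) i - c i))\<^sup>2) \<le> 1\<^sup>2"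
    using tail[of 1] by force
  \<comment> \<open>Only the difference from \<open>X M1\<close> is known to be square summable so
    far, so the limit is reached from \<open>X M1\<close> by subtraction.\<close>
  define Y where "Y = X M1 - Ell2 (\<lambda>i. coord (X M1) i - c i)"
  have Y: "coord Y = c"
    unfolding Y_def using coord_Ell2_bounded[OF M1] by auto
  have "X \<longlonglongrightarrow> Y"
  proof (rule LIMSEQ_I)
    fix r :: real assume r: "0 < r"
    then obtain M where M: "\<And>n F. n \<ge> M \<Longrightarrow> finite F \<Longrightarrow>
        (\<Sum>i\<in>F. (cmod (coord (X n) i - c i))\<^sup>2) \<le> (r/2)\<^sup>2"
      using tail[of "r/2"] by auto
    have "norm (X n - Y) < r" if "n \<ge> M" for n
    proof -
      have "X n - Y = Ell2 (\<lambda>i. coord (X n) i - c i)"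
        by (rule ell2_eqI) (simp add: Y coord_Ell2_bounded[OF M[OF that]])
      then have "norm (X n - Y) \<le> r/2"
        using norm_Ell2_bounded[OF M[OF that]] r by simp
      then show ?thesis using r by simp
    qed
    then show "\<exists>no. \<forall>n\<ge>no. norm (X n - Y) < r" by blast
  qed
  then show "convergent X" by (rule convergentI)
qed

declare cscale_op_apply [simp]

lemma cscale_add_right: "cscale c (x + y) = cscale c x + cscale c y"
  by (rule ell2_eqI) (simp add: algebra_simps)

lemma cscale_diff_right: "cscale c (x - y) = cscale c x - cscale c y"
  by (rule ell2_eqI) (simp add: algebra_simps)

lemma cscale_cscale [simp]: "cscale c (cscale e x) = cscale (c * e) x"
  by (rule ell2_eqI) simp

lemma cscale_sum_right: "cscale c (sum f A) = (\<Sum>i\<in>A. cscale c (f i))"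
  by (rule linear_sum[OF bounded_linear.linear[OF bounded_linear_cscale]])

lemma cscale_of_real: "cscale (of_real r) x = r *\<^sub>R x"
  by (rule ell2_eqI) simp

lemma cscale_zero [simp]: "cscale c 0 = 0"
  by (rule ell2_eqI) simp

section \<open>Basis vectors and density of the finitely supported vectors\<close>

definition ell2_basis :: "'a \<Rightarrow> 'a ell2"
  where "ell2_basis i = Ell2 (\<lambda>j. if j = i then 1 else 0)"

lemma coord_ell2_basis [simp]: "coord (ell2_basis i) j = (if j = i then 1 else 0)"
proof -
  have "(\<lambda>j. (cmod (if j = i then 1 else 0))\<^sup>2) summable_on UNIV"
    by (rule finite_nonzero_values_imp_summable_on) simp
  then show ?thesis by (simp add: ell2_basis_def Ell2_inverse)
qed

definition finsupp :: "'a ell2 \<Rightarrow> bool"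
  where "finsupp x \<longleftrightarrow> finite {i. coord x i \<noteq> 0}"

lemma finsupp_expand:
  assumes "finite F" "\<And>i. i \<notin> F \<Longrightarrow> coord x i = 0"
  shows "x = (\<Sum>i\<in>F. cscale (coord x i) (ell2_basis i))"
proof (rule ell2_eqI)
  fix j
  have "coord (\<Sum>i\<in>F. cscale (coord x i) (ell2_basis i)) j = (\<Sum>i\<in>F. if i = j then coord x j else 0)"
    unfolding coord_sum by (rule sum.cong) auto
  then show "coord x j = coord (\<Sum>i\<in>F. cscale (coord x i) (ell2_basis i)) j"
    using assms by simp
qed

lemma closure_finsupp: "closure {x :: 'a ell2. finsupp x} = UNIV"
proof -
  have "\<exists>y. finsupp y \<and> dist y x < e" if e: "e > 0" for x :: "'a ell2" and e
  proof -
    let ?g = "\<lambda>i. (cmod (coord x i))\<^sup>2"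
    have "(sum ?g \<longlongrightarrow> infsum ?g UNIV) (finite_subsets_at_top UNIV)"
      by (rule infsum_tendsto[OF coord_summable])
    then have "\<forall>\<^sub>F F in finite_subsets_at_top UNIV. dist (sum ?g F) (infsum ?g UNIV) < e\<^sup>2"
      using e by (simp add: tendsto_iff)
    then obtain F where F: "finite F" "dist (sum ?g F) (infsum ?g UNIV) < e\<^sup>2"
      by (auto simp: eventually_finite_subsets_at_top)
    define y where "y = (\<Sum>i\<in>F. cscale (coord x i) (ell2_basis i))"
    have cy: "coord y j = (if j \<in> F then coord x j else 0)" for j
    proof -
      have "coord y j = (\<Sum>i\<in>F. if i = j then coord x j else 0)"
        unfolding y_def coord_sum by (rule sum.cong) auto
      then show ?thesis using F by simp
    qed
    have sF: "?g summable_on (-F)"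
      by (rule summable_on_subset_banach[OF coord_summable]) simp
    have "(norm (x - y))\<^sup>2 = infsum ?g (-F)"
      unfolding norm_ell2_power2 by (rule infsum_cong_neutral) (auto simp: cy)
    also have "\<dots> = infsum ?g UNIV - sum ?g F"
      using infsum_Un_disjoint[OF _ sF, of F] F by (simp add: Compl_partition)
    also have "\<dots> < e\<^sup>2"
      using F(2) by (simp add: dist_real_def)
    finally have "norm (x - y) < e"
      using e by (simp add: power2_less_imp_less)
    moreover have "finsupp y"
      unfolding finsupp_def by (rule finite_subset[OF _ F(1)]) (auto simp: cy)
    ultimately show ?thesis by (auto simp: dist_norm norm_minus_commute)
  qed
  then show ?thesis by (auto simp: closure_approachable)
qed

lemma continuous_on_finsupp_eq:
  fixes f g :: "'a ell2 \<Rightarrow> 'b :: t2_space"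
  assumes "continuous_on UNIV f" "continuous_on UNIV g" "\<And>x. finsupp x \<Longrightarrow> f x = g x"
  shows "f x = g x"
proof -
  have "closed {x. f x = g x}"
    using assms(1,2) by (intro closed_Collect_eq)
  then have "closure {x :: 'a ell2. finsupp x} \<subseteq> {x. f x = g x}"
    using assms(3) by (intro closure_minimal) auto
  then show ?thesis by (auto simp: closure_finsupp)
qed

lemma norm_blinfun_finsupp_bound:
  fixes a :: "'a ell2 \<Rightarrow>\<^sub>L 'b ell2"
  assumes "0 \<le> B" "\<And>x. finsupp x \<Longrightarrow> norm (blinfun_apply a x) \<le> B * norm x"
  shows "norm a \<le> B"
proof (rule norm_blinfun_bound[OF assms(1)])
  fix x
  have "closed {x. norm (blinfun_apply a x) \<le> B * norm x}"
    by (intro closed_Collect_le continuous_intros)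
  then have "closure {x :: 'a ell2. finsupp x} \<subseteq> {x. norm (blinfun_apply a x) \<le> B * norm x}"
    using assms(2) by (intro closure_minimal) auto
  then show "norm (blinfun_apply a x) \<le> B * norm x" by (auto simp: closure_finsupp)
qed

section \<open>Complex inner product and adjoints\<close>

lemma cinner_add_right: "cinner z (x + y) = cinner z x + cinner z y"
  by (subst (1 2 3) cinner_commute) (simp add: cinner_add_left)

lemma cinner_cscale_left: "cinner (cscale c x) y = c * cinner x y"
  by (simp add: cinner_def mult.assoc infsum_cmult_right')

lemma cinner_cscale_right: "cinner x (cscale c y) = cnj c * cinner x y"
  by (subst (1 2) cinner_commute) (simp add: cinner_cscale_left)

lemma cinner_self: "cinner x x = of_real ((norm x)\<^sup>2)"
proof (rule complex_eqI)
  show "Im (cinner x x) = Im (of_real ((norm x)\<^sup>2))"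
    using arg_cong[OF cinner_commute[of x x], of Im] by simp
qed (simp only: Re_cinner_self norm_ell2_power2 Re_complex_of_real)

lemma cinner_cauchy_schwarz: "cmod (cinner x y) \<le> norm x * norm y"
proof (cases "cinner x y = 0")
  case False
  \<comment> \<open>A scalar of modulus one that rotates the inner product to a nonnegative real,
    reducing the claim to the real Cauchy-Schwarz inequality.\<close>
  let ?c = "cnj (cinner x y) / cmod (cinner x y)"
  have "?c * cinner x y = of_real (cmod (cinner x y))"
    using False by (simp add: mult.commute complex_norm_square[symmetric] power2_eq_square)
  then have "inner (cscale ?c x) y = cmod (cinner x y)"
    by (simp add: inner_ell2_def cinner_cscale_left)
  then show ?thesis
    using norm_cauchy_schwarz[of "cscale ?c x" y] False by (simp add: norm_cscale norm_divide)
qed simp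

lemma bounded_linear_cinner_left: "bounded_linear (\<lambda>x. cinner x y)"
proof (rule bounded_linear_intro[where K = "norm y"])
  show "cinner (r *\<^sub>R x) y = r *\<^sub>R cinner x y" for r x
    using cinner_cscale_left[of "of_real r" x y] by (simp add: cscale_of_real scaleR_conv_of_real)
qed (simp_all add: cinner_add_left cinner_cauchy_schwarz)

lemma cinner_zero_left [simp]: "cinner 0 y = 0"
  by (simp add: cinner_def)

lemma cinner_sum_left: "cinner (sum f A) y = (\<Sum>i\<in>A. cinner (f i) y)"
  by (rule linear_sum[OF bounded_linear.linear[OF bounded_linear_cinner_left]])

lemma cinner_sum_right: "cinner y (sum f A) = (\<Sum>i\<in>A. cinner y (f i))"
  by (subst (1 2) cinner_commute) (simp add: cinner_sum_left)

lemma cinner_basis_left: "cinner (ell2_basis i) y = cnj (coord y i)"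
proof -
  have "cinner (ell2_basis i) y = infsum (\<lambda>j. cnj (coord y i)) {i}"
    unfolding cinner_def by (rule infsum_cong_neutral) auto
  then show ?thesis by simp
qed

text \<open>The coordinates \<open>c y i\<close> of the adjoint vector are forced; what needs proof
  is square summability. Testing \<open>y\<close> against the image of \<open>z\<close>, the vector
  with these very coordinates on \<open>F\<close>, gives \<open>S = (norm z)^2\<close> on one side
  and at most \<open>norm y * norm a * norm z\<close> on the other, so a factor
  \<open>norm z\<close> cancels.\<close>

lemma adjoint_exists:
  assumes a: "clinear_op a"
  obtains b where "\<And>x y. cinner (blinfun_apply a x) y = cinner x (blinfun_apply b y)"
proof -
  define c where "c y i = cinner y (blinfun_apply a (ell2_basis i))" for y i
  have bound: "(\<Sum>i\<in>F. (cmod (c y i))\<^sup>2) \<le> (norm a * norm y)\<^sup>2" if F: "finite F" for F y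
  proof -
    define z where "z = (\<Sum>i\<in>F. cscale (c y i) (ell2_basis i))"
    define S where "S = (\<Sum>i\<in>F. (cmod (c y i))\<^sup>2)"
    have cz: "coord z j = (if j \<in> F then c y j else 0)" for j
    proof -
      have "coord z j = (\<Sum>i\<in>F. if i = j then c y j else 0)"
        unfolding z_def coord_sum by (rule sum.cong) auto
      then show ?thesis using F by simp
    qed
    have nz: "(norm z)\<^sup>2 = S"
      unfolding S_def by (subst norm_ell2_finite[OF F]) (auto simp: cz)
    have az: "blinfun_apply a z = (\<Sum>i\<in>F. cscale (c y i) (blinfun_apply a (ell2_basis i)))"
      using a by (simp add: z_def blinfun.sum_right clinear_op_def)
    have "cinner y (blinfun_apply a z) = (\<Sum>i\<in>F. cnj (c y i) * c y i)"
      unfolding az cinner_sum_right cinner_cscale_right c_def ..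
    also have "\<dots> = of_real S"
      by (simp add: S_def complex_norm_square mult.commute del: of_real_power)
    finally have "S \<le> norm y * norm (blinfun_apply a z)"
      using cinner_cauchy_schwarz[of y "blinfun_apply a z"]
      by (metis abs_ge_self norm_of_real order_trans)
    also have "\<dots> \<le> norm y * (norm a * norm z)"
      by (intro mult_left_mono norm_blinfun) auto
    finally have le: "norm z * norm z \<le> (norm a * norm y) * norm z"
      using nz by (simp add: power2_eq_square mult_ac)
    have "norm z \<le> norm a * norm y"
      by (cases "norm z = 0") (use le in auto)
    then show ?thesis
      using nz S_def power_mono[of "norm z" "norm a * norm y" 2] by simp
  qed
  have cb: "coord (Ell2 (c y)) = c y" for y
    by (rule coord_Ell2_bounded[OF bound])
  have "bounded_linear (\<lambda>y. Ell2 (c y))"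
  proof (rule bounded_linear_intro[where K = "norm a"])
    show "norm (Ell2 (c y)) \<le> norm y * norm a" for y
      using norm_Ell2_bounded[OF bound, of y] by (simp add: mult.commute)
    show "Ell2 (c (x + y)) = Ell2 (c x) + Ell2 (c y)" for x y
      by (rule ell2_eqI) (simp add: cb, simp add: c_def cinner_add_left)
    show "Ell2 (c (r *\<^sub>R x)) = r *\<^sub>R Ell2 (c x)" for r x
      by (rule ell2_eqI) (simp add: cb, simp add: c_def cinner_cscale_left flip: cscale_of_real)
  qed
  then have b: "blinfun_apply (Blinfun (\<lambda>y. Ell2 (c y))) y = Ell2 (c y)" for y
    by (simp add: bounded_linear_Blinfun_apply)
  have "cinner (blinfun_apply a x) y = cinner x (Ell2 (c y))" for x y
  proof (rule continuous_on_finsupp_eq[of "\<lambda>x. cinner (blinfun_apply a x) y"])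
    show "continuous_on UNIV (\<lambda>x. cinner (blinfun_apply a x) y)"
      by (intro linear_continuous_on bounded_linear_compose[OF bounded_linear_cinner_left] blinfun.bounded_linear_right)
    show "continuous_on UNIV (\<lambda>x. cinner x (Ell2 (c y)))"
      by (intro linear_continuous_on bounded_linear_cinner_left)
    fix x :: "'a ell2" assume "finsupp x"
    then obtain F where F: "finite F" "\<And>i. i \<notin> F \<Longrightarrow> coord x i = 0"
      unfolding finsupp_def by blast
    have "cinner (blinfun_apply a (ell2_basis i)) y = cinner (ell2_basis i) (Ell2 (c y))" for i
      unfolding cinner_basis_left cb c_def by (rule cinner_commute)
    then show "cinner (blinfun_apply a x) y = cinner x (Ell2 (c y))"
      using a by (subst (1 2) finsupp_expand[OF F]) (auto simp add: clinear_op_def blinfun.sum_right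
          cinner_sum_left cinner_cscale_left intro!: sum.cong)
  qed
  then show ?thesis using that b by metis
qed

lemma cinner_adj:
  assumes "clinear_op a"
  shows "cinner (blinfun_apply a x) y = cinner x (blinfun_apply (adj a) y)"
  using adjoint_exists[OF assms] adj_eqI by metis

lemma cinner_eqI:
  assumes "\<And>x. cinner x y = cinner x z"
  shows "y = z"
proof (rule ell2_eqI)
  fix i show "coord y i = coord z i"
    using assms[of "ell2_basis i"] by (simp add: cinner_basis_left)
qed

lemma clinear_op_adj:
  assumes "clinear_op a" shows "clinear_op (adj a)"
  unfolding clinear_op_def
  by (intro allI cinner_eqI) (simp add: cinner_cscale_right flip: cinner_adj[OF assms])

lemma adj_adj:
  assumes "clinear_op a" shows "adj (adj a) = a"
proof (rule adj_eqI)
  fix x y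
  show "cinner (blinfun_apply (adj a) x) y = cinner x (blinfun_apply a y)"
    by (subst (1 2) cinner_commute) (simp add: cinner_adj[OF assms])
qed

lemma clinear_op_intros:
  "clinear_op 0" "clinear_op id_blinfun"
  "clinear_op a \<Longrightarrow> clinear_op b \<Longrightarrow> clinear_op (a + b)"
  "clinear_op a \<Longrightarrow> clinear_op (cscale_op c a)"
  "clinear_op a' \<Longrightarrow> clinear_op b \<Longrightarrow> clinear_op (a' o\<^sub>L b)"
  by (auto simp: clinear_op_def blinfun.add_left cscale_add_right mult.commute)

lemma adj_add: "clinear_op a \<Longrightarrow> clinear_op b \<Longrightarrow> adj (a + b) = adj a + adj b"
  by (rule adj_eqI) (simp add: blinfun.add_left cinner_add_left cinner_add_right cinner_adj)

lemma adj_cscale: "clinear_op a \<Longrightarrow> adj (cscale_op c a) = cscale_op (cnj c) (adj a)"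
  by (rule adj_eqI) (simp add: cinner_cscale_left cinner_cscale_right cinner_adj)

lemma adj_compose: "clinear_op a \<Longrightarrow> clinear_op b \<Longrightarrow> adj (a o\<^sub>L b) = adj b o\<^sub>L adj a"
  by (rule adj_eqI) (simp add: cinner_adj)

lemma adj_zero: "adj 0 = 0"
  by (rule adj_eqI) (simp, metis cinner_commute cinner_zero_left complex_cnj_zero)

lemma norm_adj_le:
  assumes "clinear_op a" shows "norm (adj a) \<le> norm a"
proof (rule norm_blinfun_bound)
  fix y
  let ?z = "blinfun_apply (adj a) y"
  have "(norm ?z)\<^sup>2 = cmod (cinner (blinfun_apply a ?z) y)"
    by (simp add: cinner_adj[OF assms] cinner_self norm_power)
  also have "\<dots> \<le> (norm a * norm ?z) * norm y"
    using cinner_cauchy_schwarz norm_blinfun[of a ?z] mult_right_mono norm_ge_zero order_trans by meson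
  finally have "norm ?z * norm ?z \<le> (norm a * norm y) * norm ?z"
    by (simp add: power2_eq_square mult_ac)
  then show "norm ?z \<le> norm a * norm y"
    by (cases "norm ?z = 0") auto
qed simp

lemma closed_clinear_op: "closed {a :: 'a ell2 \<Rightarrow>\<^sub>L 'b ell2. clinear_op a}"
  unfolding clinear_op_def
  by (intro closed_Collect_all closed_Collect_eq continuous_intros
      bounded_linear.continuous_on[OF bounded_linear_cscale])

lemma adj_minus_distrib:
  assumes "clinear_op a" "clinear_op b" shows "adj (a - b) = adj a - adj b"
proof (rule adj_eqI)
  fix x y
  have "cinner (blinfun_apply a x) y - cinner (blinfun_apply b x) y =
      cinner x (blinfun_apply (adj a) y) - cinner x (blinfun_apply (adj b) y)"
    by (simp add: cinner_adj assms)
  then show "cinner (blinfun_apply (a - b) x) y = cinner x (blinfun_apply (adj a - adj b) y)"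
    by (metis (no_types, lifting) add_diff_cancel_right' blinfun.diff_left cinner_add_left cinner_add_right diff_add_cancel)
qed

lemma clinear_op_diff: "clinear_op a \<Longrightarrow> clinear_op b \<Longrightarrow> clinear_op (a - b)"
  by (simp add: clinear_op_def blinfun.diff_left cscale_diff_right)

lemma tendsto_adj:
  assumes "s \<longlonglongrightarrow> a" "\<And>n. clinear_op (s n)"
  shows "(\<lambda>n. adj (s n)) \<longlonglongrightarrow> adj a"
proof -
  have a: "clinear_op a"
    using closed_sequentially[OF closed_clinear_op _ assms(1)] assms(2) by auto
  have "(\<lambda>n. norm (s n - a)) \<longlonglongrightarrow> 0"
    using assms(1) by (simp add: LIM_zero tendsto_norm_zero)
  moreover have "norm (adj (s n) - adj a) \<le> norm (s n - a)" for n
    using norm_adj_le[of "s n - a"] by (simp add: adj_minus_distrib clinear_op_diff assms a)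
  ultimately have "(\<lambda>n. adj (s n) - adj a) \<longlonglongrightarrow> 0"
    using Lim_null_comparison[of "\<lambda>n. adj (s n) - adj a" "\<lambda>n. norm (s n - a)"] by simp
  then show ?thesis by (rule LIM_zero_cancel)
qed

section \<open>Weighted shifts and the algebras\<close>

lemmas blinfun_compose_bilinear =
  bounded_bilinear.add_left[OF bounded_bilinear_blinfun_compose]
  bounded_bilinear.add_right[OF bounded_bilinear_blinfun_compose]
  bounded_bilinear.diff_left[OF bounded_bilinear_blinfun_compose]
  bounded_bilinear.diff_right[OF bounded_bilinear_blinfun_compose]
  bounded_bilinear.minus_left[OF bounded_bilinear_blinfun_compose]
  bounded_bilinear.minus_right[OF bounded_bilinear_blinfun_compose]
  bounded_bilinear.scaleR_left[OF bounded_bilinear_blinfun_compose]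
  bounded_bilinear.scaleR_right[OF bounded_bilinear_blinfun_compose]
  bounded_bilinear.sum_left[OF bounded_bilinear_blinfun_compose]
  bounded_bilinear.sum_right[OF bounded_bilinear_blinfun_compose]

lift_definition shift_op :: "int \<Rightarrow> nat ell2 \<Rightarrow>\<^sub>L nat ell2"
  is "\<lambda>n x. Ell2 (\<lambda>i. if n \<le> int i then coord x (nat (int i - n)) else 0)"
  by (rule bounded_linear_reindex) (auto simp: inj_on_def)

text \<open>\<open>shift_op n\<close> is U^n for n >= 0 and the (-n)-th power of U* for n < 0. The
  weight acts first, so \<open>a k\<close> is indexed by the input coordinate; for negative n the
  values at k < -n have no effect.\<close>

definition wshift :: "int \<Rightarrow> (nat \<Rightarrow> complex) \<Rightarrow> nat ell2 \<Rightarrow>\<^sub>L nat ell2"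
  where "wshift n a = shift_op n o\<^sub>L diag_op a"

lemma coord_shift_op:
  "coord (blinfun_apply (shift_op n) x) i = (if n \<le> int i then coord x (nat (int i - n)) else 0)"
  unfolding shift_op.rep_eq by (rule coord_reindex) (auto simp: inj_on_def)

lemma coord_diag_op:
  assumes "bounded (range a)"
  shows "coord (blinfun_apply (diag_op a) x) i = a i * coord x i"
proof -
  obtain B where "\<And>k. cmod (a k) \<le> B" using assms by (auto simp: bounded_iff)
  from coord_diag[of a, OF this] show ?thesis
    using assms by (simp add: diag_op.rep_eq)
qed

lemma coord_wshift:
  assumes "bounded (range a)"
  shows "coord (blinfun_apply (wshift n a) x) i =
    (if n \<le> int i then a (nat (int i - n)) * coord x (nat (int i - n)) else 0)"
  by (simp add: wshift_def coord_shift_op coord_diag_op assms)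

lemma blinfun_coord_eqI:
  "(\<And>x i. coord (blinfun_apply a x) i = coord (blinfun_apply b x) i) \<Longrightarrow> a = b"
  by (intro blinfun_eqI ell2_eqI)

text \<open>Exact periodicity does not survive multiplication: U U* is diagonal with weight 0 at
  index 0 and 1 elsewhere. Allowing finitely many exceptional indices makes the class stable under
  products.\<close>

definition eventually_periodic :: "nat \<Rightarrow> (nat \<Rightarrow> complex) \<Rightarrow> bool"
  where "eventually_periodic N a \<longleftrightarrow> (\<exists>L. \<forall>k\<ge>L. a (k + N) = a k)"

lemma eventually_periodic_mult_period:
  fixes a :: "nat \<Rightarrow> 'a"
  assumes "\<And>k. k \<ge> L \<Longrightarrow> a (k + N) = a k" "k \<ge> L"
  shows "a (k + N * m) = a k"
proof (induction m)
  case (Suc m)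
  have "a (k + N * Suc m) = a ((k + N * m) + N)" by (simp add: algebra_simps)
  also have "\<dots> = a (k + N * m)" using assms by simp
  finally show ?case using Suc by simp
qed simp

lemma eventually_periodic_bounded:
  assumes N: "N > 0" and "eventually_periodic N a"
  shows "bounded (range a)"
proof -
  obtain L where L: "\<And>k. k \<ge> L \<Longrightarrow> a (k + N) = a k"
    using assms by (auto simp: eventually_periodic_def)
  have "a k \<in> a ` {..<L + N}" for k
  proof (cases "k < L")
    case False
    have "a (L + (k - L) mod N + N * ((k - L) div N)) = a (L + (k - L) mod N)"
      by (rule eventually_periodic_mult_period[of L]) (use L in auto)
    moreover have "L + (k - L) mod N + N * ((k - L) div N) = k"
      using False by simp
    ultimately have "a k = a (L + (k - L) mod N)" by simp
    then show ?thesis using N by auto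
  qed auto
  then have "range a \<subseteq> a ` {..<L + N}" by blast
  then show ?thesis using finite_imp_bounded[of "a ` {..<L + N}"] bounded_subset by blast
qed

lemma bounded_range_mult:
  fixes a b :: "nat \<Rightarrow> complex"
  assumes "bounded (range a)" "bounded (range b)"
  shows "bounded (range (\<lambda>k. if n \<le> int k + m then a (nat (int k + m)) * b k else 0))"
proof -
  obtain A where A: "\<And>k. cmod (a k) \<le> A" using assms by (auto simp: bounded_iff)
  obtain B where B: "\<And>k. cmod (b k) \<le> B" using assms by (auto simp: bounded_iff)
  have "0 \<le> A" "0 \<le> B" using order_trans[OF norm_ge_zero A] order_trans[OF norm_ge_zero B] by auto
  then show ?thesis
    by (intro boundedI[where B = "A * B"]) (auto simp: norm_mult intro!: mult_mono A B)
qed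

lemma bounded_range_add:
  fixes a b :: "nat \<Rightarrow> complex"
  assumes "bounded (range a)" "bounded (range b)"
  shows "bounded (range (\<lambda>k. a k + b k))"
  using assms by (rule bounded_plus_comp)

lemma bounded_range_cmult:
  fixes a :: "nat \<Rightarrow> complex"
  assumes "bounded (range a)"
  shows "bounded (range (\<lambda>k. c * a k))"
proof -
  obtain A where A: "\<And>k. cmod (a k) \<le> A" using assms by (auto simp: bounded_iff)
  show ?thesis
    by (intro boundedI[where B = "cmod c * A"]) (auto simp: norm_mult intro!: mult_left_mono A)
qed

lemma bounded_range_const: "bounded (range (\<lambda>k::nat. c::complex))"
  by simp

lemma wshift_cong:
  assumes "bounded (range a)" "bounded (range b)" "\<And>k. 0 \<le> int k + n \<Longrightarrow> a k = b k" "n = m"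
  shows "wshift n a = wshift m b"
  using assms by (intro blinfun_coord_eqI) (auto simp: coord_wshift)

text \<open>The cut-off records the basis vectors killed by the inner factor: if k + m < 0, the
  vector is lost even when n + m would bring the index back to the nonnegative range.\<close>

lemma wshift_mult:
  assumes "bounded (range a)" "bounded (range b)"
  shows "wshift n a o\<^sub>L wshift m b =
    wshift (n + m) (\<lambda>k. if 0 \<le> int k + m then a (nat (int k + m)) * b k else 0)"
proof (rule blinfun_coord_eqI)
  fix x i
  have "nat (int (nat (int i - n - m)) + m) = nat (int i - n)" if "n + m \<le> int i"
    using that by simp
  moreover have "0 \<le> int (nat (int i - n - m)) + m \<longleftrightarrow> n \<le> int i" if "n + m \<le> int i"
    using that by linarith
  ultimately show "coord (blinfun_apply (wshift n a o\<^sub>L wshift m b) x) i = coord (blinfun_apply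
      (wshift (n + m) (\<lambda>k. if 0 \<le> int k + m then a (nat (int k + m)) * b k else 0)) x) i"
    unfolding blinfun_apply_blinfun_compose coord_wshift[OF assms(1)] coord_wshift[OF assms(2)]
      coord_wshift[OF bounded_range_mult[OF assms]]
    by (auto simp: diff_diff_eq)
qed

lemma wshift_add:
  assumes "bounded (range a)" "bounded (range b)"
  shows "wshift n a + wshift n b = wshift n (\<lambda>k. a k + b k)"
  by (intro blinfun_coord_eqI)
    (auto simp: coord_wshift assms bounded_range_add blinfun.add_left algebra_simps)

lemma wshift_cscale:
  assumes "bounded (range a)"
  shows "cscale_op c (wshift n a) = wshift n (\<lambda>k. c * a k)"
  by (intro blinfun_coord_eqI) (auto simp: coord_wshift assms bounded_range_cmult)

lemma wshift_zero: "wshift n (\<lambda>_. 0) = 0"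
  by (intro blinfun_coord_eqI) (auto simp: coord_wshift)

lemma wshift_id: "wshift 0 (\<lambda>_. 1) = id_blinfun"
  by (intro blinfun_coord_eqI) (auto simp: coord_wshift)

lemma wshift_0_eq_diag_op: "wshift 0 a = diag_op a"
proof -
  have "shift_op 0 = id_blinfun"
    by (intro blinfun_coord_eqI) (simp add: coord_shift_op)
  then show ?thesis by (intro blinfun_eqI) (simp add: wshift_def)
qed

lemma clinear_op_wshift:
  assumes "bounded (range a)"
  shows "clinear_op (wshift n a)"
  unfolding clinear_op_def by (auto intro!: ell2_eqI simp: coord_wshift assms)

lemma unilateral_shift_eq: "unilateral_shift = wshift 1 (\<lambda>_. 1)"
proof (rule blinfun_coord_eqI)
  fix x i
  have "coord (blinfun_apply unilateral_shift x) i = (if 0 < i then coord x (i - 1) else 0)"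
    unfolding unilateral_shift.rep_eq by (rule coord_reindex) (auto simp: inj_on_def)
  then show "coord (blinfun_apply unilateral_shift x) i = coord (blinfun_apply (wshift 1 (\<lambda>_. 1)) x) i"
    by (auto simp: coord_wshift nat_diff_distrib)
qed

lemma adj_unilateral_shift: "adj unilateral_shift = wshift (-1) (\<lambda>_. 1)"
proof (rule adj_eqI)
  fix x y
  have "cinner (blinfun_apply unilateral_shift x) y =
      infsum (\<lambda>k. coord x (k - 1) * cnj (coord y k)) (range Suc)"
    unfolding cinner_def unilateral_shift_eq
  proof (rule infsum_cong_neutral)
    fix k :: nat assume "k \<in> UNIV - range Suc"
    then have "k = 0" by (metis Diff_iff not0_implies_Suc range_eqI)
    then show "coord (blinfun_apply (wshift 1 (\<lambda>_. 1)) x) k * cnj (coord y k) = 0"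
      by (simp add: coord_wshift)
  qed (auto simp: coord_wshift)
  also have "\<dots> = infsum ((\<lambda>k. coord x (k - 1) * cnj (coord y k)) \<circ> Suc) UNIV"
    by (rule infsum_reindex) simp
  also have "\<dots> = cinner x (blinfun_apply (wshift (-1) (\<lambda>_. 1)) y)"
    unfolding cinner_def by (rule infsum_cong) (simp add: coord_wshift nat_add_distrib)
  finally show "cinner (blinfun_apply unilateral_shift x) y =
      cinner x (blinfun_apply (wshift (-1) (\<lambda>_. 1)) y)" .
qed

lemma diag_per_eq:
  assumes "N > 0"
  shows "diag_per N = {wshift 0 a | a. \<forall>k. a (k + N) = a k}"
proof -
  have "a (k + N) = a k" if "j dvd N" "\<forall>k. a (k + j) = a k" for a :: "nat \<Rightarrow> complex" and j k
  proof -
    obtain m where "N = j * m" using \<open>j dvd N\<close> by blast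
    then show ?thesis using eventually_periodic_mult_period[of 0 a j k m] that by simp
  qed
  then show ?thesis
    unfolding diag_per_def wshift_0_eq_diag_op using dvd_refl by blast
qed

lemma periodic_imp_evper: "\<forall>k. a (k + N) = a k \<Longrightarrow> eventually_periodic N a"
  by (auto simp: eventually_periodic_def)

lemma periodic_bounded:
  fixes a :: "nat \<Rightarrow> complex"
  shows "N > 0 \<Longrightarrow> \<forall>k. a (k + N) = a k \<Longrightarrow> bounded (range a)"
  by (rule eventually_periodic_bounded[OF _ periodic_imp_evper])

lemma eventually_periodic_const: "eventually_periodic N (\<lambda>_. c)"
  by (auto simp: eventually_periodic_def)

lemma eventually_periodic_cmult: "eventually_periodic N a \<Longrightarrow> eventually_periodic N (\<lambda>k. c * a k)"
  by (auto simp: eventually_periodic_def)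

lemma eventually_periodic_mult_shift:
  assumes "eventually_periodic N a" "eventually_periodic N b"
  shows "eventually_periodic N (\<lambda>k. if 0 \<le> int k + m then a (nat (int k + m)) * b k else 0)"
proof -
  obtain L M where *: "\<And>k. k \<ge> L \<Longrightarrow> a (k + N) = a k" "\<And>k. k \<ge> M \<Longrightarrow> b (k + N) = b k"
    using assms by (auto simp: eventually_periodic_def)
  have "a (nat (int (k + N) + m)) * b (k + N) = a (nat (int k + m)) * b k"
    if "k \<ge> L + M + nat \<bar>m\<bar>" for k
  proof -
    have "nat (int (k + N) + m) = nat (int k + m) + N" using that by simp
    moreover have "nat (int k + m) \<ge> L" using that by simp
    ultimately show ?thesis using * that by simp
  qed
  then show ?thesis unfolding eventually_periodic_def by (intro exI[of _ "L + M + nat \<bar>m\<bar>"]) auto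
qed

text \<open>A normal form for \<open>BDT_poly N\<close>: words in the generators collapse to sums of
  weighted shifts, with scalars absorbed into the weights. With \<open>wshift_in_BDT_poly\<close>
  below, the two sets coincide.\<close>

inductive_set band :: "nat \<Rightarrow> (nat ell2 \<Rightarrow>\<^sub>L nat ell2) set" for N where
  wshift: "eventually_periodic N a \<Longrightarrow> wshift n a \<in> band N"
| add: "x \<in> band N \<Longrightarrow> y \<in> band N \<Longrightarrow> x + y \<in> band N"

lemma band_mult:
  assumes N: "N > 0" and "x \<in> band N" and y: "y \<in> band N"
  shows "x o\<^sub>L y \<in> band N"
  using assms(2)
proof induction
  case (wshift a n)
  from y show ?case
  proof induction
    case (wshift b m)
    with \<open>eventually_periodic N a\<close> show ?case
      by (subst wshift_mult) (auto intro!: eventually_periodic_bounded N band.wshift eventually_periodic_mult_shift)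
  qed (simp add: blinfun_compose_bilinear band.add)
qed (simp add: blinfun_compose_bilinear band.add)

lemma cscale_op_add: "cscale_op c (x + y) = cscale_op c x + cscale_op c y"
  by (rule blinfun_eqI) (simp add: blinfun.add_left cscale_add_right)

lemma BDT_poly_subset_band:
  assumes N: "N > 0" shows "BDT_poly N \<subseteq> band N"
proof
  fix x assume "x \<in> BDT_poly N"
  then show "x \<in> band N"
    unfolding BDT_poly_def
  proof induction
    case (gen x)
    then show ?case
      unfolding adj_unilateral_shift diag_per_eq[OF N]
      by (auto simp: unilateral_shift_eq intro!: band.wshift eventually_periodic_const periodic_imp_evper)
  next
    case zero
    show ?case using band.wshift[OF eventually_periodic_const[of N 0], of 0] by (simp add: wshift_zero)
  next
    case (scale x c)
    from scale(2) show ?case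
    proof induction
      case (wshift a n)
      then show ?case by (subst wshift_cscale) (auto intro: eventually_periodic_bounded N band.wshift eventually_periodic_cmult)
    qed (simp add: cscale_op_add band.add)
  qed (auto intro: band.add band_mult N)
qed

lemma BDT_poly_intros:
  "unilateral_shift \<in> BDT_poly N" "adj unilateral_shift \<in> BDT_poly N"
  "a \<in> diag_per N \<Longrightarrow> a \<in> BDT_poly N"
  "0 \<in> BDT_poly N"
  "a \<in> BDT_poly N \<Longrightarrow> b \<in> BDT_poly N \<Longrightarrow> a + b \<in> BDT_poly N"
  "a \<in> BDT_poly N \<Longrightarrow> cscale_op c a \<in> BDT_poly N"
  "a \<in> BDT_poly N \<Longrightarrow> b \<in> BDT_poly N \<Longrightarrow> a o\<^sub>L b \<in> BDT_poly N"
  unfolding BDT_poly_def by (auto intro: generated_algebra.intros)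

text \<open>An eventually periodic weight is a periodic one plus a finitely supported correction.
  The projection onto the first basis vector is 1 - U U*, and conjugating it by powers of U reaches
  every other index, so the correction is a polynomial in the generators as well.\<close>

lemma wshift_in_BDT_poly:
  assumes N: "N > 0" and a: "eventually_periodic N a"
  shows "wshift n a \<in> BDT_poly N"
proof -
  have b1: "bounded (range (\<lambda>j. if P j then c else (0::complex)))" for P :: "nat \<Rightarrow> bool" and c
    by (rule boundedI[where B = "cmod c"]) auto
  have S: "wshift n (\<lambda>_. 1) \<in> BDT_poly N" for n
  proof -
    have id: "wshift 0 (\<lambda>_. 1) \<in> BDT_poly N"
      using diag_per_eq[OF N] by (auto intro: BDT_poly_intros)
    have "wshift (int k) (\<lambda>_. 1) \<in> BDT_poly N" for k
    proof (induction k)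
      case (Suc k)
      have "wshift (int (Suc k)) (\<lambda>_. 1) = unilateral_shift o\<^sub>L wshift (int k) (\<lambda>_. 1)"
        unfolding unilateral_shift_eq
        by (subst wshift_mult) (auto intro!: wshift_cong b1)
      then show ?case using Suc by (auto intro: BDT_poly_intros)
    qed (simp add: id)
    moreover have "wshift (- int k) (\<lambda>_. 1) \<in> BDT_poly N" for k
    proof (induction k)
      case (Suc k)
      have "wshift (- int (Suc k)) (\<lambda>_. 1) = adj unilateral_shift o\<^sub>L wshift (- int k) (\<lambda>_. 1)"
        unfolding adj_unilateral_shift
        by (subst wshift_mult) (auto intro!: wshift_cong b1)
      then show ?case using Suc by (auto intro: BDT_poly_intros)
    qed (simp add: id)
    ultimately show ?thesis by (metis int_cases2)
  qed
  have P0: "wshift 0 (\<lambda>j. if j = 0 then 1 else 0) \<in> BDT_poly N"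
  proof -
    have "wshift 0 (\<lambda>j. if j = 0 then 1 else 0) =
        wshift 0 (\<lambda>_. 1) + cscale_op (-1) (wshift 1 (\<lambda>_. 1) o\<^sub>L wshift (-1) (\<lambda>_. 1))"
      by (rule blinfun_coord_eqI) (auto simp: coord_wshift coord_wshift[OF b1] blinfun.add_left)
    then show ?thesis using S by (auto intro: BDT_poly_intros)
  qed
  have ind: "wshift 0 (\<lambda>j. if j = i then c else 0) \<in> BDT_poly N" for i c
  proof -
    have "wshift 0 (\<lambda>j. if j = i then c else 0) = cscale_op c
        (wshift (int i) (\<lambda>_. 1) o\<^sub>L wshift 0 (\<lambda>j. if j = 0 then 1 else 0) o\<^sub>L wshift (- int i) (\<lambda>_. 1))"
      by (rule blinfun_coord_eqI) (auto simp: coord_wshift coord_wshift[OF b1])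
    then show ?thesis using S P0 by (auto intro: BDT_poly_intros)
  qed
  have bd: "bounded (range (\<lambda>j. if j < L then b j else 0))" for b :: "nat \<Rightarrow> complex" and L
    by (rule bounded_subset[of "insert 0 (b ` {..<L})"]) (auto intro: finite_imp_bounded)
  have b0: "bounded ((\<lambda>_. c) ` A)" for c :: complex and A :: "nat set"
    by (rule boundedI[where B = "cmod c"]) auto
  have fin: "wshift 0 (\<lambda>j. if j < L then b j else 0) \<in> BDT_poly N" for L and b :: "nat \<Rightarrow> complex"
  proof (induction L)
    case 0
    show ?case using BDT_poly_intros(4) by (simp add: wshift_zero)
  next
    case (Suc L)
    have "wshift 0 (\<lambda>j. if j < Suc L then b j else 0) =
        wshift 0 (\<lambda>j. if j < L then b j else 0) + wshift 0 (\<lambda>j. if j = L then b L else 0)"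
      by (subst wshift_add) (auto intro!: wshift_cong bounded_range_add bd b1 b0)
    then show ?case using Suc ind by (auto intro: BDT_poly_intros)
  qed
  obtain L where L: "\<And>k. k \<ge> L \<Longrightarrow> a (k + N) = a k"
    using a by (auto simp: eventually_periodic_def)
  \<comment> \<open>Advancing by N * L steps stays in the same residue class and lands at an index
    of at least L, since N > 0; so \<open>p\<close> extends the periodic tail of \<open>a\<close> to
    all indices.\<close>
  define p where "p k = a (k + N * L)" for k
  have "L \<le> k + N * L" for k
    using N by (cases N) auto
  then have p: "\<forall>k. p (k + N) = p k"
    using L[of "k + N * L" for k] by (simp add: p_def algebra_simps)
  have pa: "p k = a k" if "k \<ge> L" for k
    unfolding p_def using eventually_periodic_mult_period[of L a N k L, OF L that] by simp
  have ba: "bounded (range a)" by (rule eventually_periodic_bounded[OF N a])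
  have "wshift 0 a = wshift 0 p + wshift 0 (\<lambda>j. if j < L then a j - p j else 0)"
    by (subst wshift_add) (auto intro!: wshift_cong bounded_range_add ba bd b0 periodic_bounded[OF N p] simp: pa)
  moreover have "wshift 0 p \<in> BDT_poly N"
    using diag_per_eq[OF N] p by (auto intro: BDT_poly_intros)
  ultimately have "wshift 0 a \<in> BDT_poly N"
    using fin[of L "\<lambda>j. a j - p j"] by (auto intro: BDT_poly_intros)
  moreover have "wshift n a = wshift n (\<lambda>_. 1) o\<^sub>L wshift 0 a"
    by (rule blinfun_coord_eqI) (auto simp: coord_wshift ba)
  ultimately show ?thesis using S by (auto intro: BDT_poly_intros)
qed

section \<open>The C*-algebra as norm closure of the polynomial algebra\<close>

lemma cstar_subalgebra_clinear: "cstar_subalgebra {a :: 'a ell2 \<Rightarrow>\<^sub>L 'a ell2. clinear_op a}"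
  unfolding cstar_subalgebra_def
  by (auto intro: clinear_op_intros clinear_op_adj closed_clinear_op)

lemma generators_clinear:
  assumes "N > 0" "a \<in> insert unilateral_shift (diag_per N)"
  shows "clinear_op a"
  using assms unfolding diag_per_eq[OF assms(1)] unilateral_shift_eq
  by (auto intro!: clinear_op_wshift periodic_bounded[OF assms(1)])

lemma BDT_alg_clinear: "N > 0 \<Longrightarrow> a \<in> BDT_alg N \<Longrightarrow> clinear_op a"
  unfolding BDT_alg_def generated_cstar_def
  using cstar_subalgebra_clinear generators_clinear by blast

lemma closed_generated_cstar: "closed (generated_cstar G)"
  unfolding generated_cstar_def by (intro closed_Inter) (auto simp: cstar_subalgebra_def)

lemma generated_cstar_intros:
  "a \<in> G \<Longrightarrow> a \<in> generated_cstar G"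
  "0 \<in> generated_cstar G"
  "a \<in> generated_cstar G \<Longrightarrow> b \<in> generated_cstar G \<Longrightarrow> a + b \<in> generated_cstar G"
  "a \<in> generated_cstar G \<Longrightarrow> cscale_op c a \<in> generated_cstar G"
  "a \<in> generated_cstar G \<Longrightarrow> b \<in> generated_cstar G \<Longrightarrow> a o\<^sub>L b \<in> generated_cstar G"
  "a \<in> generated_cstar G \<Longrightarrow> adj a \<in> generated_cstar G"
  unfolding generated_cstar_def cstar_subalgebra_def by blast+

lemma closed_BDT_alg: "closed (BDT_alg N)"
  by (simp add: BDT_alg_def closed_generated_cstar)

lemma BDT_poly_subset_alg: "BDT_poly N \<subseteq> BDT_alg N"
proof
  fix x assume "x \<in> BDT_poly N"
  then show "x \<in> BDT_alg N"
    unfolding BDT_poly_def BDT_alg_def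
    by induction (auto intro: generated_cstar_intros)
qed

lemma cscale_op_minus_one: "cscale_op (-1) a = - a"
  by (intro blinfun_coord_eqI) (simp add: blinfun.minus_left)

lemma cscale_op_real: "cscale_op (of_real r) a = r *\<^sub>R a"
  by (intro blinfun_eqI) (simp add: cscale_of_real blinfun.scaleR_left)

lemma BDT_alg_intros:
  "unilateral_shift \<in> BDT_alg N" "adj unilateral_shift \<in> BDT_alg N"
  "a \<in> diag_per N \<Longrightarrow> a \<in> BDT_alg N"
  "0 \<in> BDT_alg N"
  "a \<in> BDT_alg N \<Longrightarrow> b \<in> BDT_alg N \<Longrightarrow> a + b \<in> BDT_alg N"
  "a \<in> BDT_alg N \<Longrightarrow> b \<in> BDT_alg N \<Longrightarrow> a - b \<in> BDT_alg N"
  "a \<in> BDT_alg N \<Longrightarrow> - a \<in> BDT_alg N"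
  "a \<in> BDT_alg N \<Longrightarrow> cscale_op c a \<in> BDT_alg N"
  "a \<in> BDT_alg N \<Longrightarrow> r *\<^sub>R a \<in> BDT_alg N"
  "a \<in> BDT_alg N \<Longrightarrow> b \<in> BDT_alg N \<Longrightarrow> a o\<^sub>L b \<in> BDT_alg N"
proof -
  show m: "- a \<in> BDT_alg N" if "a \<in> BDT_alg N" for a
    using generated_cstar_intros(4)[of a _ "-1"] that by (simp add: BDT_alg_def cscale_op_minus_one)
  show "a \<in> BDT_alg N \<Longrightarrow> b \<in> BDT_alg N \<Longrightarrow> a - b \<in> BDT_alg N"
    using generated_cstar_intros(3)[of a _ "-b"] m[of b] by (simp add: BDT_alg_def)
  show "a \<in> BDT_alg N \<Longrightarrow> r *\<^sub>R a \<in> BDT_alg N"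
    using generated_cstar_intros(4)[of a _ "of_real r"] by (simp add: BDT_alg_def cscale_op_real)
qed (auto simp: BDT_alg_def intro: generated_cstar_intros)

lemma BDT_alg_sum: "(\<And>i. i \<in> I \<Longrightarrow> f i \<in> BDT_alg N) \<Longrightarrow> sum f I \<in> BDT_alg N"
  by (induction I rule: infinite_finite_induct) (auto intro: BDT_alg_intros)

lemma BDT_poly_clinear: "N > 0 \<Longrightarrow> a \<in> BDT_poly N \<Longrightarrow> clinear_op a"
  using BDT_poly_subset_alg BDT_alg_clinear by blast

lemma adj_diag:
  assumes "bounded (range a)"
  shows "adj (wshift 0 a) = wshift 0 (\<lambda>k. cnj (a k))"
proof (rule adj_eqI)
  fix x y
  have "bounded (range (\<lambda>k. cnj (a k)))"
    using assms by (simp add: bounded_iff)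
  then show "cinner (blinfun_apply (wshift 0 a) x) y = cinner x (blinfun_apply (wshift 0 (\<lambda>k. cnj (a k))) y)"
    unfolding cinner_def by (intro infsum_cong) (simp add: coord_wshift assms)
qed

lemma BDT_poly_adj:
  assumes N: "N > 0" and "x \<in> BDT_poly N"
  shows "adj x \<in> BDT_poly N"
  using assms(2)[unfolded BDT_poly_def]
proof induction
  case (gen x)
  then consider "x = unilateral_shift" | "x = adj unilateral_shift" | "x \<in> diag_per N" by blast
  then show ?case
  proof cases
    case 2
    then show ?thesis
      using BDT_poly_intros(1) generators_clinear[OF N, of unilateral_shift] by (simp add: adj_adj)
  next
    case 3
    then obtain a where a: "x = wshift 0 a" "\<forall>k. a (k + N) = a k"
      by (auto simp: diag_per_eq[OF N])
    then have "adj x = wshift 0 (\<lambda>k. cnj (a k))"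
      using adj_diag periodic_bounded[OF N] by blast
    then show ?thesis
      using a(2) by (intro BDT_poly_intros(3)) (auto simp: diag_per_eq[OF N])
  qed (simp add: BDT_poly_intros)
next
  case zero
  show ?case by (simp add: adj_zero BDT_poly_intros)
next
  case (add a b)
  then have "a \<in> BDT_poly N" "b \<in> BDT_poly N"
    by (simp_all add: BDT_poly_def)
  with add show ?case
    using BDT_poly_clinear[OF N] by (simp add: adj_add BDT_poly_intros)
next
  case (scale a c)
  then have "a \<in> BDT_poly N"
    by (simp add: BDT_poly_def)
  with scale show ?case
    using BDT_poly_clinear[OF N] by (simp add: adj_cscale BDT_poly_intros)
next
  case (mult a b)
  then have "a \<in> BDT_poly N" "b \<in> BDT_poly N"
    by (simp_all add: BDT_poly_def)
  with mult show ?case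
    using BDT_poly_clinear[OF N] by (simp add: adj_compose BDT_poly_intros)
qed

text \<open>The intersection defining \<open>BDT_alg\<close> gives no access to its elements. The
  closure of the polynomials is itself a C*-subalgebra containing the generators, so every element
  is a limit of finite sums of weighted shifts.\<close>

lemma closure_BDT_poly:
  assumes N: "N > 0" shows "closure (BDT_poly N) = BDT_alg N"
proof
  show "closure (BDT_poly N) \<subseteq> BDT_alg N"
    by (intro closure_minimal BDT_poly_subset_alg closed_BDT_alg)
  have cl: "x \<in> closure (BDT_poly N)" if "\<And>n. s n \<in> BDT_poly N" "s \<longlonglongrightarrow> x" for s x
    using that by (auto simp: closure_sequential)
  have "cstar_subalgebra (closure (BDT_poly N))"
    unfolding cstar_subalgebra_def
  proof (intro conjI ballI allI)
    fix a assume a: "a \<in> closure (BDT_poly N)"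
    show "clinear_op a"
      using a \<open>closure (BDT_poly N) \<subseteq> BDT_alg N\<close> BDT_alg_clinear[OF N] by blast
    obtain s where s: "\<And>n. s n \<in> BDT_poly N" "s \<longlonglongrightarrow> a"
      using a by (auto simp: closure_sequential)
    show "adj a \<in> closure (BDT_poly N)"
      by (rule cl[OF _ tendsto_adj[OF s(2)]]) (intro BDT_poly_adj[OF N] BDT_poly_clinear[OF N] s)+
    show "cscale_op c a \<in> closure (BDT_poly N)" for c
    proof -
      have e: "cscale_op c x = cscale_op c id_blinfun o\<^sub>L x" for x :: "nat ell2 \<Rightarrow>\<^sub>L nat ell2"
        by (rule blinfun_eqI) simp
      have "(\<lambda>n. cscale_op c (s n)) \<longlonglongrightarrow> cscale_op c a"
        by (subst (1 2) e) (intro tendsto_intros s)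
      then show ?thesis
        by (rule cl[rotated]) (intro BDT_poly_intros s)
    qed
    fix b assume b: "b \<in> closure (BDT_poly N)"
    obtain t where t: "\<And>n. t n \<in> BDT_poly N" "t \<longlonglongrightarrow> b"
      using b by (auto simp: closure_sequential)
    show "a + b \<in> closure (BDT_poly N)"
      by (rule cl[OF _ tendsto_add[OF s(2) t(2)]]) (intro BDT_poly_intros s t)
    have "(\<lambda>n. s n o\<^sub>L t n) \<longlonglongrightarrow> (a o\<^sub>L b)"
      by (intro tendsto_intros s t)
    then show "a o\<^sub>L b \<in> closure (BDT_poly N)"
      by (rule cl[rotated]) (intro BDT_poly_intros s t)
  qed (auto intro: closure_subset[THEN subsetD] BDT_poly_intros)
  moreover have "insert unilateral_shift (diag_per N) \<subseteq> closure (BDT_poly N)"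
    using closure_subset BDT_poly_intros by blast
  ultimately show "BDT_alg N \<subseteq> closure (BDT_poly N)"
    unfolding BDT_alg_def generated_cstar_def by blast
qed

section \<open>Laurent polynomials in the bilateral shift\<close>

lift_definition bshift :: "int \<Rightarrow> int ell2 \<Rightarrow>\<^sub>L int ell2"
  is "\<lambda>j x. Ell2 (\<lambda>l. coord x (l - j))"
  by (rule bounded_linear_reindex[where P = "\<lambda>_. True", simplified]) (auto simp: inj_on_def)

lemma coord_bshift [simp]: "coord (blinfun_apply (bshift j) x) l = coord x (l - j)"
  unfolding bshift.rep_eq
  by (rule coord_reindex[where P = "\<lambda>_. True", simplified]) (auto simp: inj_on_def)

lemma bshift_mult: "bshift i o\<^sub>L bshift j = bshift (i + j)"
  by (rule blinfun_coord_eqI) (simp add: algebra_simps)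

lemma bshift_0: "bshift 0 = id_blinfun"
  by (rule blinfun_coord_eqI) simp

lemma clinear_op_bshift: "clinear_op (bshift j)"
  unfolding clinear_op_def by (auto intro!: ell2_eqI)

lemma bilateral_shift_eq: "bilateral_shift = bshift 1"
  by (rule blinfun_eqI) (simp add: bilateral_shift.rep_eq bshift.rep_eq)

lemma op_pow_bilateral_shift: "op_pow bilateral_shift n = bshift (int n)"
proof (induction n)
  case (Suc n)
  have "op_pow bilateral_shift (Suc n) = bshift 1 o\<^sub>L op_pow bilateral_shift n"
    by (simp add: op_pow_def bilateral_shift_eq)
  then show ?case by (simp add: Suc bshift_mult)
qed (simp add: op_pow_def bshift_0)

lemma adj_bshift: "adj (bshift j) = bshift (- j)"
proof (rule adj_eqI)
  fix x y
  have "cinner x (blinfun_apply (bshift (- j)) y) =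
      infsum ((\<lambda>l. coord x (l - j) * cnj (coord y l)) \<circ> (\<lambda>l. l + j)) UNIV"
    unfolding cinner_def by (rule infsum_cong) simp
  also have "\<dots> = infsum (\<lambda>l. coord x (l - j) * cnj (coord y l)) (range (\<lambda>l. l + j))"
    by (rule infsum_reindex[symmetric]) simp
  also have "range (\<lambda>l. l + j) = UNIV" by (rule surj_plus_right)
  finally show "cinner (blinfun_apply (bshift j) x) y = cinner x (blinfun_apply (bshift (- j)) y)"
    by (simp add: cinner_def)
qed

text \<open>Symbol and operator are built in parallel, with e^{ijt} matched to V^{jN}. A relation
  avoids any choice of coefficients; that the symbol determines the operator follows later from the
  norm bound applied to a difference.\<close>

inductive laurent :: "nat \<Rightarrow> (real \<Rightarrow> complex) \<Rightarrow> (int ell2 \<Rightarrow>\<^sub>L int ell2) \<Rightarrow> bool" for N where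
  monom: "laurent N (\<lambda>t. c * cis (of_int j * t)) (cscale_op c (bshift (j * int N)))"
| add: "laurent N p a \<Longrightarrow> laurent N q b \<Longrightarrow> laurent N (\<lambda>t. p t + q t) (a + b)"

lemma laurent_const: "laurent N (\<lambda>_. c) (cscale_op c id_blinfun)"
  using laurent.monom[of N c 0] by (simp add: bshift_0)

lemma laurent_cmult:
  assumes "laurent N p a"
  shows "laurent N (\<lambda>t. c * p t) (cscale_op c a)"
  using assms
proof induction
  case (monom e j)
  have "cscale_op c (cscale_op e (bshift (j * int N))) = cscale_op (c * e) (bshift (j * int N))"
    by (rule blinfun_eqI) simp
  then show ?case using laurent.monom[of N "c * e" j] by (simp add: mult.assoc)
next
  case (add p a q b)
  then show ?case using laurent.add[OF add.IH] by (simp add: cscale_op_add distrib_left)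
qed

lemma laurent_mult:
  assumes "laurent N p a" and q: "laurent N q b"
  shows "laurent N (\<lambda>t. p t * q t) (a o\<^sub>L b)"
  using assms(1)
proof induction
  case (monom c j)
  from q show ?case
  proof induction
    case (monom e k)
    have "cscale_op c (bshift (j * int N)) o\<^sub>L cscale_op e (bshift (k * int N)) =
        cscale_op (c * e) (bshift ((j + k) * int N))"
      by (rule blinfun_coord_eqI) (simp add: algebra_simps)
    moreover have "c * cis (of_int j * t) * (e * cis (of_int k * t)) =
        c * e * cis (of_int (j + k) * t)" for t
      by (simp add: cis_mult[symmetric] distrib_right)
    ultimately show ?case using laurent.monom[of N "c * e" "j + k"] by (simp only:)
  next
    case (add q a q' b)
    then show ?case using laurent.add[OF add.IH] by (simp add: blinfun_compose_bilinear distrib_left)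
  qed
next
  case (add p a p' b)
  then show ?case using laurent.add[OF add.IH] by (simp add: blinfun_compose_bilinear distrib_right)
qed

lemma laurent_clinear: "laurent N p a \<Longrightarrow> clinear_op a"
  by (induction rule: laurent.induct) (auto intro: clinear_op_intros clinear_op_bshift)

lemma laurent_cnj:
  assumes "laurent N p a"
  shows "laurent N (\<lambda>t. cnj (p t)) (adj a)"
  using assms
proof induction
  case (monom c j)
  have "adj (cscale_op c (bshift (j * int N))) = cscale_op (cnj c) (bshift (- j * int N))"
    by (simp add: adj_cscale clinear_op_bshift adj_bshift)
  then show ?case using laurent.monom[of N "cnj c" "- j"] by (simp add: cis_cnj)
next
  case (add p a q b)
  then show ?case using laurent.add[OF add.IH] by (simp add: adj_add laurent_clinear)
qed

lemma laurent_diff: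
  assumes "laurent N p a" "laurent N q b"
  shows "laurent N (\<lambda>t. p t - q t) (a - b)"
  using laurent.add[OF assms(1) laurent_cmult[OF assms(2), of "-1"]]
  by (simp add: cscale_op_minus_one)

lemma C_circle_intros:
  "(\<lambda>t. cis (of_int j * t)) \<in> C_circle" "cis \<in> C_circle"
  "(\<lambda>_. c) \<in> C_circle"
  "f \<in> C_circle \<Longrightarrow> g \<in> C_circle \<Longrightarrow> (\<lambda>t. f t + g t) \<in> C_circle"
  "f \<in> C_circle \<Longrightarrow> g \<in> C_circle \<Longrightarrow> (\<lambda>t. f t - g t) \<in> C_circle"
  "f \<in> C_circle \<Longrightarrow> g \<in> C_circle \<Longrightarrow> (\<lambda>t. f t * g t) \<in> C_circle"
  "f \<in> C_circle \<Longrightarrow> (\<lambda>t. c * f t) \<in> C_circle"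
  "f \<in> C_circle \<Longrightarrow> (\<lambda>t. cnj (f t)) \<in> C_circle"
proof -
  have "cis (of_int j * (t + 2 * pi)) = cis (of_int j * t)" for j :: int and t
  proof -
    have "cis (of_int j * (t + 2 * pi)) = cis (of_int j * t) * cis (2 * pi * of_int j)"
      by (simp add: cis_mult algebra_simps)
    then show ?thesis by (simp add: cis_multiple_2pi)
  qed
  from this this[of 1] show "(\<lambda>t. cis (of_int j * t)) \<in> C_circle" "cis \<in> C_circle"
    by (auto simp: C_circle_def intro!: continuous_intros)
qed (auto simp: C_circle_def intro!: continuous_intros)

lemma laurent_C_circle: "laurent N p a \<Longrightarrow> p \<in> C_circle"
  by (induction rule: laurent.induct) (auto intro: C_circle_intros)

section \<open>Fourier transform on finitely supported vectors and Parseval's identity\<close>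

definition fourier :: "int ell2 \<Rightarrow> real \<Rightarrow> complex"
  where "fourier x t = (\<Sum>l | coord x l \<noteq> 0. coord x l * cis (of_int l * t))"

lemma fourier_eq:
  assumes "finite F" "\<And>l. l \<notin> F \<Longrightarrow> coord x l = 0"
  shows "fourier x t = (\<Sum>l\<in>F. coord x l * cis (of_int l * t))"
  unfolding fourier_def by (rule sum.mono_neutral_left) (use assms in auto)

text \<open>The Fourier transform diagonalizes V: V^{jN} becomes multiplication by e^{ijNt}, which
  is the monomial e^{ijs} at s = N t.\<close>

lemma laurent_fourier:
  assumes "laurent N p a" "finsupp x"
  shows "finsupp (blinfun_apply a x) \<and> fourier (blinfun_apply a x) t = p (real N * t) * fourier x t"
  using assms(1)
proof induction
  case (monom c j)
  let ?y = "blinfun_apply (cscale_op c (bshift (j * int N))) x" and ?S = "{l. coord x l \<noteq> 0}"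
  let ?F = "(\<lambda>l. l + j * int N) ` ?S"
  have F: "finite ?S" "finite ?F" using assms(2) by (auto simp: finsupp_def)
  have y: "coord ?y l = 0" if "l \<notin> ?F" for l
    using that by (auto simp: image_iff dest: spec[of _ "l - j * int N"])
  have "fourier ?y t = (\<Sum>l\<in>?F. coord ?y l * cis (of_int l * t))"
    by (rule fourier_eq[OF F(2) y])
  also have "\<dots> = (\<Sum>l\<in>?S. (c * cis (of_int j * (real N * t))) * (coord x l * cis (of_int l * t)))"
  proof (subst sum.reindex)
    show "inj_on (\<lambda>l. l + j * int N) ?S" by (simp add: inj_on_def)
    have "cis (of_int (l + j * int N) * t) = cis (of_int j * (real N * t)) * cis (of_int l * t)" for l
      by (simp add: cis_mult algebra_simps)
    then show "sum ((\<lambda>l. coord ?y l * cis (of_int l * t)) \<circ> (\<lambda>l. l + j * int N)) ?S =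
        (\<Sum>l\<in>?S. (c * cis (of_int j * (real N * t))) * (coord x l * cis (of_int l * t)))"
      by (intro sum.cong refl) (simp del: of_int_add of_int_mult)
  qed
  also have "\<dots> = (c * cis (of_int j * (real N * t))) * fourier x t"
    unfolding fourier_def sum_distrib_left ..
  finally show ?case
    using finite_subset[OF _ F(2), of "{l. coord ?y l \<noteq> 0}"] y unfolding finsupp_def by blast
next
  case (add p a q b)
  let ?u = "blinfun_apply a x" and ?v = "blinfun_apply b x"
  let ?F = "{l. coord ?u l \<noteq> 0} \<union> {l. coord ?v l \<noteq> 0}"
  have F: "finite ?F" using add by (auto simp: finsupp_def)
  have "fourier (?u + ?v) t = fourier ?u t + fourier ?v t"
    by (subst (1 2 3) fourier_eq[OF F]) (auto simp: distrib_right sum.distrib)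
  moreover have "finsupp (?u + ?v)"
    unfolding finsupp_def by (rule finite_subset[OF _ F]) auto
  ultimately show ?case
    using add.IH by (simp add: blinfun.add_left distrib_right)
qed

lemma has_integral_cis:
  "((\<lambda>t. cis (of_int k * t)) has_integral (if k = 0 then 2 * pi else 0)) {0..2 * pi}"
proof (cases "k = 0")
  case True
  then show ?thesis
    using has_integral_const_real[of "1::complex" 0 "2 * pi"] by (simp add: scaleR_conv_of_real)
next
  case False
  let ?F = "\<lambda>t. cis (of_int k * t) / (\<i> * of_int k)"
  have "((\<lambda>t. cis (of_int k * t)) has_integral (?F (2 * pi) - ?F 0)) {0..2 * pi}"
  proof (rule fundamental_theorem_of_calculus)
    fix t :: real
    have "(cis has_vector_derivative \<i> * cis (of_int k * t)) (at (of_int k * t) within UNIV)"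
      unfolding has_vector_derivative_def
      by (rule derivative_eq_intros refl | simp add: scaleR_conv_of_real fun_eq_iff)+
    then have "((\<lambda>t. cis (of_int k * t)) has_vector_derivative of_int k *\<^sub>R (\<i> * cis (of_int k * t))) (at t)"
      using vector_diff_chain_at[of "\<lambda>t. of_int k * t" "of_int k" t cis "\<i> * cis (of_int k * t)"]
      by (auto simp: o_def simp flip: has_real_derivative_iff_has_vector_derivative
          intro!: derivative_eq_intros)
    then have "(?F has_vector_derivative (of_int k *\<^sub>R (\<i> * cis (of_int k * t))) / (\<i> * of_int k)) (at t)"
      by (rule has_vector_derivative_divide)
    then show "(?F has_vector_derivative cis (of_int k * t)) (at t within {0..2 * pi})"
      using False by (simp add: scaleR_conv_of_real has_vector_derivative_at_within)
  qed simp
  moreover have "cis (of_int k * (2 * pi)) = 1"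
    using cis_multiple_2pi[of "of_int k"] by (simp add: mult.commute)
  ultimately show ?thesis using False by simp
qed

lemma parseval_finsupp:
  assumes "finsupp x"
  shows "((\<lambda>t. (cmod (fourier x t))\<^sup>2) has_integral (2 * pi * (norm x)\<^sup>2)) {0..2 * pi}"
proof -
  let ?S = "{l. coord x l \<noteq> 0}"
  have S: "finite ?S" using assms by (simp add: finsupp_def)
  have "((\<lambda>t. \<Sum>l\<in>?S. \<Sum>m\<in>?S. (coord x l * cnj (coord x m)) * cis (of_int (l - m) * t)) has_integral
      (\<Sum>l\<in>?S. \<Sum>m\<in>?S. (coord x l * cnj (coord x m)) * (if l - m = 0 then 2 * pi else 0))) {0..2 * pi}"
    by (intro has_integral_sum S has_integral_mult_right has_integral_cis)
  moreover have "(\<Sum>l\<in>?S. \<Sum>m\<in>?S. (coord x l * cnj (coord x m)) * cis (of_int (l - m) * t)) =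
      of_real ((cmod (fourier x t))\<^sup>2)" for t
  proof -
    have "of_real ((cmod (fourier x t))\<^sup>2) = fourier x t * cnj (fourier x t)"
      by (simp only: complex_norm_square)
    also have "\<dots> = (\<Sum>l\<in>?S. \<Sum>m\<in>?S. (coord x l * cis (of_int l * t)) * (cnj (coord x m) * cis (- (of_int m * t))))"
      unfolding fourier_def by (simp only: cnj_sum complex_cnj_mult cis_cnj sum_product)
    also have "\<dots> = (\<Sum>l\<in>?S. \<Sum>m\<in>?S. (coord x l * cnj (coord x m)) * cis (of_int (l - m) * t))"
    proof (intro sum.cong refl)
      fix l m
      have "cis (of_int (l - m) * t) = cis (of_int l * t) * cis (- (of_int m * t))"
        by (simp add: cis_mult left_diff_distrib)
      then show "(coord x l * cis (of_int l * t)) * (cnj (coord x m) * cis (- (of_int m * t))) =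
          (coord x l * cnj (coord x m)) * cis (of_int (l - m) * t)"
        by simp
    qed
    finally show ?thesis ..
  qed
  moreover have "(\<Sum>l\<in>?S. \<Sum>m\<in>?S. (coord x l * cnj (coord x m)) * (if l - m = 0 then 2 * pi else 0)) =
      of_real (2 * pi * (norm x)\<^sup>2)"
  proof -
    have "(\<Sum>l\<in>?S. \<Sum>m\<in>?S. (coord x l * cnj (coord x m)) * (if l - m = 0 then 2 * pi else 0)) =
      (\<Sum>l\<in>?S. \<Sum>m\<in>?S. if l = m then 2 * pi * (coord x l * cnj (coord x l)) else 0)"
      by (intro sum.cong refl) auto
    also have "\<dots> = (\<Sum>l\<in>?S. 2 * pi * (coord x l * cnj (coord x l)))"
      using S by (intro sum.cong refl) simp
    also have "\<dots> = of_real (2 * pi * (\<Sum>l\<in>?S. (cmod (coord x l))\<^sup>2))"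
      by (simp add: sum_distrib_left complex_norm_square del: of_real_power)
    also have "(\<Sum>l\<in>?S. (cmod (coord x l))\<^sup>2) = (norm x)\<^sup>2"
      by (rule norm_ell2_finite[symmetric]) (use S in auto)
    finally show ?thesis .
  qed
  ultimately have "((\<lambda>t. complex_of_real ((cmod (fourier x t))\<^sup>2)) has_integral
      complex_of_real (2 * pi * (norm x)\<^sup>2)) {0..2 * pi}"
    by (simp only:)
  from has_integral_linear[OF this bounded_linear_Re] show ?thesis
    by (simp only: o_def Re_complex_of_real)
qed

text \<open>On finitely supported vectors the operator is multiplication by a function of modulus at
  most \<open>B\<close> on the Fourier side, so Parseval bounds it there; density does the
  rest.\<close>

lemma laurent_norm_le:
  assumes a: "laurent N p a" and B: "\<And>t. cmod (p t) \<le> B"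
  shows "norm a \<le> B"
proof (rule norm_blinfun_finsupp_bound)
  show B0: "0 \<le> B" using order_trans[OF norm_ge_zero B] .
  fix x :: "int ell2" assume x: "finsupp x"
  have "2 * pi * (norm (blinfun_apply a x))\<^sup>2 \<le> B\<^sup>2 * (2 * pi * (norm x)\<^sup>2)"
  proof (rule has_integral_le)
    show "((\<lambda>t. (cmod (fourier (blinfun_apply a x) t))\<^sup>2) has_integral
        (2 * pi * (norm (blinfun_apply a x))\<^sup>2)) {0..2 * pi}"
      by (rule parseval_finsupp) (use laurent_fourier[OF a x] in blast)
    show "((\<lambda>t. B\<^sup>2 * (cmod (fourier x t))\<^sup>2) has_integral B\<^sup>2 * (2 * pi * (norm x)\<^sup>2)) {0..2 * pi}"
      by (intro has_integral_mult_right parseval_finsupp x)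
    show "(cmod (fourier (blinfun_apply a x) t))\<^sup>2 \<le> B\<^sup>2 * (cmod (fourier x t))\<^sup>2" for t
      using laurent_fourier[OF a x] by (simp add: norm_mult power_mult_distrib mult_right_mono power_mono B)
  qed
  then have "(norm (blinfun_apply a x))\<^sup>2 \<le> (B * norm x)\<^sup>2"
    by (simp add: power_mult_distrib mult.left_commute[of _ "2 * pi"])
  then show "norm (blinfun_apply a x) \<le> B * norm x"
    by (rule power2_le_imp_le) (simp add: B0)
qed

section \<open>The functional calculus of a power of the bilateral shift\<close>

text \<open>The closure of the graph of \<open>laurent\<close>: one sequence must converge on both
  sides at once. Sums, products and adjoints then pass to the limit without comparing different
  approximants.\<close>

definition laurent_limit :: "nat \<Rightarrow> (real \<Rightarrow> complex) \<Rightarrow> (int ell2 \<Rightarrow>\<^sub>L int ell2) \<Rightarrow> bool"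
  where "laurent_limit N f b \<longleftrightarrow>
    (\<exists>p a. (\<forall>n. laurent N (p n) (a n)) \<and> uniform_limit UNIV p f sequentially \<and> a \<longlonglongrightarrow> b)"

section \<open>Uniform approximation of continuous symbols by Laurent polynomials\<close>

lemma C_circle_periodic:
  fixes k :: int
  assumes "f \<in> C_circle"
  shows "f (t + 2 * pi * of_int k) = f t"
proof -
  have f: "f (t + 2 * pi) = f t" for t
    using assms by (auto simp: C_circle_def)
  show ?thesis
  proof (induction k arbitrary: t rule: int_induct[of _ 0])
    case (step1 i)
    have "t + 2 * pi * of_int (i + 1) = (t + 2 * pi * of_int i) + 2 * pi" by (simp add: algebra_simps)
    then show ?case using f step1 by metis
  next
    case (step2 i)
    have "(t + 2 * pi * of_int (i - 1)) + 2 * pi = t + 2 * pi * of_int i" by (simp add: algebra_simps)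
    then show ?case using f step2 by metis
  qed simp
qed

lemma C_circle_bounded:
  assumes "f \<in> C_circle" shows "bounded (range f)"
proof -
  have f: "continuous_on UNIV f" "\<And>t. f (t + 2 * pi) = f t"
    using assms by (auto simp: C_circle_def)
  have "range f \<subseteq> f ` {0..2 * pi}"
  proof
    fix y assume "y \<in> range f"
    then obtain t where t: "y = f t" by blast
    let ?k = "\<lfloor>t / (2 * pi)\<rfloor>"
    have "of_int ?k \<le> t / (2 * pi)" "t / (2 * pi) < of_int ?k + 1" by linarith+
    then have "of_int ?k * (2 * pi) \<le> t" "t < (of_int ?k + 1) * (2 * pi)"
      by (simp_all only: pos_le_divide_eq pos_divide_less_eq zero_less_mult_iff pi_gt_zero zero_less_numeral simp_thms)
    then have "t + 2 * pi * of_int (- ?k) \<in> {0..2 * pi}"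
      by (simp add: algebra_simps)
    then show "y \<in> f ` {0..2 * pi}" using C_circle_periodic[OF assms, of t "- ?k"] t by (metis imageI)
  qed
  moreover have "compact (f ` {0..2 * pi})"
    by (rule compact_continuous_image[OF continuous_on_subset[OF f(1)]]) auto
  ultimately show ?thesis using compact_imp_bounded bounded_subset by blast
qed

text \<open>\<open>Arg\<close> jumps on the negative axis and \<open>Arg2pi\<close> on the positive
  one, but by periodicity \<open>f\<close> does not distinguish them. The common composite is
  therefore continuous at every point of the circle, as needed for polynomial approximation on a
  compact subset of the plane.\<close>

lemma C_circle_factors:
  assumes "f \<in> C_circle"
  obtains F where "continuous_on (sphere 0 1) F" "\<And>t. F (cis t) = f t"
proof -
  have f: "continuous_on UNIV f" "\<And>t. f (t + 2 * pi) = f t"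
    using assms by (auto simp: C_circle_def)
  have per: "f s = f t" if "cis s = cis t" for s t
    using that C_circle_periodic[OF assms, of t] sin_cos_eq_iff[of s t] by (auto simp: complex_eq_iff)
  have c2: "z \<noteq> 0 \<Longrightarrow> cis (Arg2pi z) = sgn z" for z
    using Arg2pi_eq[of z] by (simp add: sgn_div_norm cis_conv_exp field_simps scaleR_conv_of_real)
  have eq: "(\<lambda>z. f (Arg z)) = (\<lambda>z. f (Arg2pi z))"
  proof
    fix z show "f (Arg z) = f (Arg2pi z)"
      by (cases "z = 0") (auto simp: Arg_zero c2 cis_Arg intro: per)
  qed
  have "isCont (\<lambda>z. f (Arg z)) z" if "z \<in> sphere 0 1" for z
  proof (cases "z \<in> \<real>\<^sub>\<le>\<^sub>0")
    case False
    have "isCont f (Arg z)" using f(1) by (simp add: continuous_on_eq_continuous_at)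
    then show ?thesis using isCont_o2[OF continuous_at_Arg[OF False]] by blast
  next
    case True
    then have "z \<notin> \<real>\<^sub>\<ge>\<^sub>0"
      using that by (auto simp: complex_nonpos_Reals_iff complex_nonneg_Reals_iff cmod_def)
    moreover have "isCont f (Arg2pi z)" using f(1) by (simp add: continuous_on_eq_continuous_at)
    ultimately show ?thesis unfolding eq using isCont_o2[OF continuous_at_Arg2pi] by blast
  qed
  then have "continuous_on (sphere 0 1) (\<lambda>z. f (Arg z))"
    by (intro continuous_at_imp_continuous_on) auto
  moreover have "f (Arg (cis t)) = f t" for t
    by (rule per) (simp add: cis_Arg sgn_div_norm)
  ultimately show ?thesis using that by blast
qed

text \<open>Stone-Weierstrass supplies polynomials in the real coordinates of the plane; on the
  circle these coordinates are cos t and sin t, hence Laurent polynomials.\<close>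

lemma laurent_dense:
  assumes "f \<in> C_circle"
  obtains p a where "\<And>n. laurent N (p n) (a n)" "uniform_limit UNIV p f sequentially"
proof -
  obtain F where F: "continuous_on (sphere 0 1) F" "\<And>t. F (cis t) = f t"
    using C_circle_factors[OF assms] by blast
  have lin: "\<exists>b. laurent N (\<lambda>t. of_real (h (cis t))) b" if "real_polynomial_function h" for h :: "complex \<Rightarrow> real"
    using that
  proof induction
    case (linear h)
    interpret h: bounded_linear h by fact
    \<comment> \<open>Euler's formulas: these are the coefficients of e^{it} and e^{-it} in
      \<open>h 1 * cos t + h \<i> * sin t\<close>.\<close>
    let ?c = "(of_real (h 1) - \<i> * of_real (h \<i>)) / 2 :: complex"
    let ?d = "(of_real (h 1) + \<i> * of_real (h \<i>)) / 2 :: complex"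
    have "(\<lambda>t. complex_of_real (h (cis t))) = (\<lambda>t. ?c * cis (of_int 1 * t) + ?d * cis (of_int (-1) * t))"
    proof
      fix t
      have "cis t = cos t *\<^sub>R 1 + sin t *\<^sub>R \<i>" by (simp add: complex_eq_iff)
      then have "h (cis t) = cos t * h 1 + sin t * h \<i>"
        by (simp only: h.add h.scaleR real_scaleR_def)
      then show "complex_of_real (h (cis t)) = ?c * cis (of_int 1 * t) + ?d * cis (of_int (-1) * t)"
        by (simp add: complex_eq_iff) (simp add: diff_divide_distrib mult.commute)
    qed
    then show ?case by (simp only:) (rule exI, rule laurent.add[OF laurent.monom laurent.monom])
  next
    case (const c)
    then show ?case using laurent_const by blast
  next
    case (add g h)
    then obtain a b where "laurent N (\<lambda>t. of_real (g (cis t))) a" "laurent N (\<lambda>t. of_real (h (cis t))) b" by blast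
    from laurent.add[OF this] show ?case by auto
  next
    case (mult g h)
    then obtain a b where "laurent N (\<lambda>t. of_real (g (cis t))) a" "laurent N (\<lambda>t. of_real (h (cis t))) b" by blast
    from laurent_mult[OF this] show ?case by auto
  qed
  have ex: "\<exists>p. (\<exists>b. laurent N p b) \<and> (\<forall>t. cmod (f t - p t) < inverse (real (Suc n)))" for n
  proof -
    obtain g where g: "polynomial_function g" "\<And>z. z \<in> sphere 0 1 \<Longrightarrow> norm (F z - g z) < inverse (real (Suc n))"
      using Stone_Weierstrass_polynomial_function[OF compact_sphere F(1), of "inverse (real (Suc n))"] by auto
    obtain b c where "laurent N (\<lambda>t. of_real (Re (g (cis t)))) b" "laurent N (\<lambda>t. of_real (Im (g (cis t)))) c"
      using lin[of "Re \<circ> g"] lin[of "Im \<circ> g"] g(1) bounded_linear_Re bounded_linear_Im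
      unfolding polynomial_function_def o_def by blast
    from laurent.add[OF this(1) laurent_cmult[OF this(2), of \<i>]]
    have "\<exists>b. laurent N (\<lambda>t. g (cis t)) b"
      by (auto simp flip: complex_eq)
    moreover have "cmod (f t - g (cis t)) < inverse (real (Suc n))" for t
      using g(2)[of "cis t"] F(2) by simp
    ultimately show ?thesis by blast
  qed
  then obtain p a where p: "\<And>n. laurent N (p n) (a n)" "\<And>n t. cmod (f t - p n t) < inverse (real (Suc n))"
    by metis
  have "uniform_limit UNIV p f sequentially"
  proof (rule uniform_limitI)
    fix e :: real assume "0 < e"
    with LIMSEQ_inverse_real_of_nat have "\<forall>\<^sub>F n in sequentially. inverse (real (Suc n)) < e"
      by (rule order_tendstoD)
    then show "\<forall>\<^sub>F n in sequentially. \<forall>x\<in>UNIV. dist (p n x) (f x) < e"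
      by eventually_elim (use p(2) in \<open>force simp: dist_norm norm_minus_commute intro: less_trans\<close>)
  qed
  then show ?thesis using that p(1) by blast
qed

lemma laurent_limit_norm_le:
  assumes "laurent_limit N f b" "\<And>t. cmod (f t) \<le> B"
  shows "norm b \<le> B"
proof -
  obtain p a where p: "\<And>n. laurent N (p n) (a n)" "uniform_limit UNIV p f sequentially" "a \<longlonglongrightarrow> b"
    using assms(1) by (auto simp: laurent_limit_def)
  show ?thesis
  proof (rule field_le_epsilon)
    fix e :: real assume "e > 0"
    then have "\<forall>\<^sub>F n in sequentially. \<forall>t\<in>UNIV. dist (p n t) (f t) < e"
      using p(2) by (auto simp: uniform_limit_iff)
    then have "\<forall>\<^sub>F n in sequentially. norm (a n) \<le> B + e"
    proof eventually_elim
      case (elim n)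
      have "cmod (p n t) \<le> B + e" for t
        using bspec[OF elim UNIV_I, of t] assms(2)[of t] norm_triangle_sub[of "p n t" "f t"]
        by (simp add: dist_norm)
      then show ?case using laurent_norm_le[OF p(1)] by blast
    qed
    then show "norm b \<le> B + e"
      using tendsto_upperbound[OF tendsto_norm[OF p(3)]] by simp
  qed
qed

lemma laurent_limitI:
  assumes "\<And>n. laurent N (p n) (a n)" "uniform_limit UNIV p f sequentially" "a \<longlonglongrightarrow> b"
  shows "laurent_limit N f b"
  using assms unfolding laurent_limit_def by blast

lemma tendsto_cscale_op:
  assumes "a \<longlonglongrightarrow> b" shows "(\<lambda>n. cscale_op c (a n)) \<longlonglongrightarrow> cscale_op c b"
proof -
  have e: "cscale_op c x = cscale_op c id_blinfun o\<^sub>L x" for x :: "'a ell2 \<Rightarrow>\<^sub>L 'b ell2"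
    by (rule blinfun_eqI) simp
  show ?thesis by (subst (1 2) e) (intro tendsto_intros assms)
qed

lemma laurent_limit_laurent: "laurent N p a \<Longrightarrow> laurent_limit N p a"
  unfolding laurent_limit_def
  by (rule exI[of _ "\<lambda>_. p"], rule exI[of _ "\<lambda>_. a"]) (simp add: uniform_limit_const)

lemma laurent_limit_add:
  assumes "laurent_limit N f a" "laurent_limit N g b"
  shows "laurent_limit N (\<lambda>t. f t + g t) (a + b)"
proof -
  obtain p r q s where
    p: "\<And>n. laurent N (p n) (r n)" "uniform_limit UNIV p f sequentially" "r \<longlonglongrightarrow> a" and
    q: "\<And>n. laurent N (q n) (s n)" "uniform_limit UNIV q g sequentially" "s \<longlonglongrightarrow> b"
    using assms by (auto simp: laurent_limit_def)
  show ?thesis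
    by (rule laurent_limitI[OF laurent.add[OF p(1) q(1)] uniform_limit_add[OF p(2) q(2)] tendsto_add[OF p(3) q(3)]])
qed

lemma laurent_limit_cmult:
  assumes "laurent_limit N f a"
  shows "laurent_limit N (\<lambda>t. c * f t) (cscale_op c a)"
proof -
  obtain p r where
    p: "\<And>n. laurent N (p n) (r n)" "uniform_limit UNIV p f sequentially" "r \<longlonglongrightarrow> a"
    using assms by (auto simp: laurent_limit_def)
  show ?thesis
    by (rule laurent_limitI[OF laurent_cmult[OF p(1)]
          bounded_linear.uniform_limit[OF bounded_linear_mult_right p(2)] tendsto_cscale_op[OF p(3)]])
qed

lemma laurent_limit_diff:
  assumes "laurent_limit N f a" "laurent_limit N g b"
  shows "laurent_limit N (\<lambda>t. f t - g t) (a - b)"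
  using laurent_limit_add[OF assms(1) laurent_limit_cmult[OF assms(2), of "-1"]]
  by (simp add: cscale_op_minus_one)

lemma laurent_limit_mult:
  assumes "laurent_limit N f a" "laurent_limit N g b" "f \<in> C_circle" "g \<in> C_circle"
  shows "laurent_limit N (\<lambda>t. f t * g t) (a o\<^sub>L b)"
proof -
  obtain p r q s where
    p: "\<And>n. laurent N (p n) (r n)" "uniform_limit UNIV p f sequentially" "r \<longlonglongrightarrow> a" and
    q: "\<And>n. laurent N (q n) (s n)" "uniform_limit UNIV q g sequentially" "s \<longlonglongrightarrow> b"
    using assms by (auto simp: laurent_limit_def)
  show ?thesis
    by (rule laurent_limitI[OF laurent_mult[OF p(1) q(1)]
          uniform_lim_mult[OF p(2) q(2) C_circle_bounded[OF assms(3)] C_circle_bounded[OF assms(4)]]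
          bounded_bilinear.tendsto[OF bounded_bilinear_blinfun_compose p(3) q(3)]])
qed

lemma laurent_limit_cnj:
  assumes "laurent_limit N f a"
  shows "laurent_limit N (\<lambda>t. cnj (f t)) (adj a)"
proof -
  obtain p r where
    p: "\<And>n. laurent N (p n) (r n)" "uniform_limit UNIV p f sequentially" "r \<longlonglongrightarrow> a"
    using assms by (auto simp: laurent_limit_def)
  show ?thesis
    by (rule laurent_limitI[OF laurent_cnj[OF p(1)]
          bounded_linear.uniform_limit[OF bounded_linear_cnj p(2)] tendsto_adj[OF p(3) laurent_clinear[OF p(1)]]])
qed

lemma laurent_limit_clinear:
  assumes "laurent_limit N f a" shows "clinear_op a"
proof -
  obtain p s where p: "\<And>n. laurent N (p n) (s n)" "s \<longlonglongrightarrow> a"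
    using assms by (auto simp: laurent_limit_def)
  then show ?thesis
    using closed_sequentially[OF closed_clinear_op _ p(2)] laurent_clinear by blast
qed

lemma laurent_limit_unique:
  assumes "laurent_limit N f a" "laurent_limit N f b" shows "a = b"
  using laurent_limit_norm_le[OF laurent_limit_diff[OF assms], of 0] by simp

lemma laurent_limit_exists:
  assumes "f \<in> C_circle"
  obtains a where "laurent_limit N f a"
proof -
  obtain p a where p: "\<And>n. laurent N (p n) (a n)" "uniform_limit UNIV p f sequentially"
    using laurent_dense[OF assms, of N] by blast
  have "Cauchy a"
  proof (rule CauchyI)
    fix e :: real assume e: "e > 0"
    then have "\<forall>\<^sub>F n in sequentially. \<forall>t\<in>UNIV. dist (p n t) (f t) < e / 4"
      by (intro uniform_limitD[OF p(2)]) simp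
    then obtain M where M: "\<And>n t. n \<ge> M \<Longrightarrow> dist (p n t) (f t) < e / 4"
      by (auto simp: eventually_sequentially)
    have "norm (a m - a n) < e" if "m \<ge> M" "n \<ge> M" for m n
    proof -
      have "cmod (p m t - p n t) \<le> e / 2" for t
        using dist_triangle_half_l[of "p m t" "f t" "e/2" "p n t"] M[OF that(1), of t] M[OF that(2), of t]
        by (simp add: dist_norm)
      then show ?thesis using laurent_norm_le[OF laurent_diff[OF p(1) p(1)], of m n "e/2"] e by simp
    qed
    then show "\<exists>M. \<forall>m\<ge>M. \<forall>n\<ge>M. norm (a m - a n) < e" by blast
  qed
  then obtain b where "a \<longlonglongrightarrow> b" by (meson Cauchy_convergent convergent_def)
  then show ?thesis using that p by (auto simp: laurent_limit_def)
qed

definition laurent_op :: "nat \<Rightarrow> (real \<Rightarrow> complex) \<Rightarrow> (int ell2 \<Rightarrow>\<^sub>L int ell2)"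
  where "laurent_op N f = (THE b. laurent_limit N f b)"

lemma laurent_op_eq: "laurent_limit N f b \<Longrightarrow> laurent_op N f = b"
  unfolding laurent_op_def by (rule the_equality) (auto intro: laurent_limit_unique)

lemma laurent_op_limit: "f \<in> C_circle \<Longrightarrow> laurent_limit N f (laurent_op N f)"
  using laurent_limit_exists laurent_op_eq by metis

lemma is_calculus_laurent_op: "is_calculus (bshift (int N)) (laurent_op N)"
  unfolding is_calculus_def
proof (intro conjI ballI allI)
  fix f g c assume f: "f \<in> C_circle"
  show "clinear_op (laurent_op N f)"
    by (rule laurent_limit_clinear[OF laurent_op_limit[OF f]])
  show "laurent_op N (\<lambda>t. c * f t) = cscale_op c (laurent_op N f)"
    by (intro laurent_op_eq laurent_limit_cmult laurent_op_limit f)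
  show "laurent_op N (\<lambda>t. cnj (f t)) = adj (laurent_op N f)"
    by (intro laurent_op_eq laurent_limit_cnj laurent_op_limit f)
  assume g: "g \<in> C_circle"
  show "laurent_op N (\<lambda>t. f t + g t) = laurent_op N f + laurent_op N g"
    by (intro laurent_op_eq laurent_limit_add laurent_op_limit f g)
  show "laurent_op N (\<lambda>t. f t * g t) = laurent_op N f o\<^sub>L laurent_op N g"
    by (intro laurent_op_eq laurent_limit_mult laurent_op_limit f g)
next
  have one: "cscale_op 1 a = a" for a :: "int ell2 \<Rightarrow>\<^sub>L int ell2"
    by (rule blinfun_coord_eqI) simp
  show "laurent_op N (\<lambda>_. 1) = id_blinfun"
    using laurent_op_eq[OF laurent_limit_laurent[OF laurent_const[of N 1]]] by (simp add: one)
  show "laurent_op N cis = bshift (int N)"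
    using laurent_op_eq[OF laurent_limit_laurent[OF laurent.monom[of N 1 1]]] by (simp add: one)
qed

section \<open>Uniqueness of the functional calculus\<close>

context
  fixes u :: "'a ell2 \<Rightarrow>\<^sub>L 'a ell2" and \<Phi>
  assumes calc: "is_calculus u \<Phi>"
begin

lemma calculus_simps:
  "f \<in> C_circle \<Longrightarrow> clinear_op (\<Phi> f)"
  "f \<in> C_circle \<Longrightarrow> g \<in> C_circle \<Longrightarrow> \<Phi> (\<lambda>t. f t + g t) = \<Phi> f + \<Phi> g"
  "f \<in> C_circle \<Longrightarrow> \<Phi> (\<lambda>t. c * f t) = cscale_op c (\<Phi> f)"
  "f \<in> C_circle \<Longrightarrow> g \<in> C_circle \<Longrightarrow> \<Phi> (\<lambda>t. f t * g t) = \<Phi> f o\<^sub>L \<Phi> g"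
  "f \<in> C_circle \<Longrightarrow> \<Phi> (\<lambda>t. cnj (f t)) = adj (\<Phi> f)"
  "\<Phi> (\<lambda>_. 1) = id_blinfun" "\<Phi> cis = u"
  using calc unfolding is_calculus_def by blast+

text \<open>\<open>B\<^sup>2 - |f|\<^sup>2\<close> is the square of a continuous real function \<open>h\<close>.\<close>

lemma calculus_norm_le:
  assumes f: "f \<in> C_circle" and B: "\<And>t. cmod (f t) \<le> B"
  shows "norm (\<Phi> f) \<le> B"
proof (rule norm_blinfun_bound)
  show B0: "0 \<le> B" using order_trans[OF norm_ge_zero B] .
  fix x
  define h where "h t = complex_of_real (sqrt (B\<^sup>2 - (cmod (f t))\<^sup>2))" for t
  have h: "h \<in> C_circle"
    using f unfolding C_circle_def h_def by (auto intro!: continuous_intros)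
  have le: "(cmod (f t))\<^sup>2 \<le> B\<^sup>2" for t
    by (intro power_mono B) simp
  have sq: "cnj (f t) * f t + cnj (h t) * h t = complex_of_real (B\<^sup>2) * 1" for t
  proof -
    have "cnj (f t) * f t = of_real ((cmod (f t))\<^sup>2)"
      by (simp only: complex_norm_square mult.commute)
    moreover have "cnj (h t) * h t = of_real (B\<^sup>2 - (cmod (f t))\<^sup>2)"
      using le[of t] unfolding h_def complex_cnj_complex_of_real of_real_mult[symmetric]
      by (simp only: real_sqrt_mult_self abs_of_nonneg diff_ge_0_iff_ge)
    ultimately show ?thesis by (simp del: of_real_power)
  qed
  have n: "cinner x (blinfun_apply (\<Phi> (\<lambda>t. cnj (g t) * g t)) x) = of_real ((norm (blinfun_apply (\<Phi> g) x))\<^sup>2)"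
    if g: "g \<in> C_circle" for g
    using g C_circle_intros(8)[OF g]
    by (simp add: calculus_simps cinner_adj[symmetric] cinner_self)
  have "cinner x (blinfun_apply (\<Phi> (\<lambda>t. cnj (f t) * f t + cnj (h t) * h t)) x) =
      of_real ((norm (blinfun_apply (\<Phi> f) x))\<^sup>2 + (norm (blinfun_apply (\<Phi> h) x))\<^sup>2)"
    using f h by (simp add: calculus_simps(2) C_circle_intros blinfun.add_left cinner_add_right n)
  moreover have "cinner x (blinfun_apply (\<Phi> (\<lambda>t. cnj (f t) * f t + cnj (h t) * h t)) x) = of_real (B\<^sup>2 * (norm x)\<^sup>2)"
    unfolding sq by (subst calculus_simps(3)) (auto simp: C_circle_intros calculus_simps(6) cinner_cscale_right cinner_self)
  ultimately have "(norm (blinfun_apply (\<Phi> f) x))\<^sup>2 + (norm (blinfun_apply (\<Phi> h) x))\<^sup>2 = B\<^sup>2 * (norm x)\<^sup>2"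
    by (metis of_real_eq_iff)
  then have "(norm (blinfun_apply (\<Phi> f) x))\<^sup>2 \<le> (B * norm x)\<^sup>2"
    by (simp add: power_mult_distrib) (smt (verit) zero_le_power2)
  then show "norm (blinfun_apply (\<Phi> f) x) \<le> B * norm x"
    by (rule power2_le_imp_le) (simp add: B0)
qed

end

lemma calculus_laurent:
  assumes calc: "is_calculus (bshift (int N)) \<Phi>" and "laurent N p a"
  shows "\<Phi> p = a"
  using assms(2)
proof induction
  note calc_simps = calculus_simps[OF calc]
  case (monom c j)
  have nat: "\<Phi> (\<lambda>t. cis (of_int (int k) * t)) = bshift (int k * int N)" for k
  proof (induction k)
    case 0
    then show ?case by (simp add: calc_simps bshift_0)
  next
    case (Suc k)
    have "(\<lambda>t. cis (of_int (int (Suc k)) * t)) = (\<lambda>t. cis t * cis (of_int (int k) * t))"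
      by (simp add: cis_mult distrib_right fun_eq_iff)
    then show ?case
      using Suc by (simp only: calc_simps C_circle_intros bshift_mult) (simp add: algebra_simps)
  qed
  have "\<Phi> (\<lambda>t. cis (of_int j * t)) = bshift (j * int N)"
  proof (cases "0 \<le> j")
    case True
    then show ?thesis using nat[of "nat j"] by simp
  next
    case False
    have "(\<lambda>t. cis (of_int j * t)) = (\<lambda>t. cnj (cis (of_int (int (nat (- j))) * t)))"
      using False by (simp add: cis_cnj fun_eq_iff)
    then show ?thesis
      using False by (simp only: calc_simps C_circle_intros nat adj_bshift) simp
  qed
  then show ?case by (simp add: calc_simps C_circle_intros)
next
  case (add p a q b)
  then show ?case by (simp add: calculus_simps[OF calc] laurent_C_circle)
qed

text \<open>\<open>is_calculus\<close> asks for no continuity; it comes from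
  \<open>calculus_norm_le\<close>. The values on Laurent polynomials are forced algebraically, and
  contractivity carries them to uniform limits.\<close>

lemma calculus_unique:
  assumes calc: "is_calculus (bshift (int N)) \<Phi>" and f: "f \<in> C_circle"
  shows "\<Phi> f = laurent_op N f"
proof -
  obtain p a where p: "\<And>n. laurent N (p n) (a n)" "uniform_limit UNIV p f sequentially"
    using laurent_dense[OF f, of N] by blast
  have "a \<longlonglongrightarrow> \<Phi> f"
  proof (rule LIMSEQ_I)
    fix e :: real assume e: "e > 0"
    then have "\<forall>\<^sub>F n in sequentially. \<forall>t\<in>UNIV. dist (p n t) (f t) < e / 2"
      by (intro uniform_limitD[OF p(2)]) simp
    then obtain M where M: "\<And>n t. n \<ge> M \<Longrightarrow> dist (p n t) (f t) < e / 2"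
      by (auto simp: eventually_sequentially)
    have "norm (a n - \<Phi> f) < e" if "n \<ge> M" for n
    proof -
      have pn: "p n \<in> C_circle" by (rule laurent_C_circle[OF p(1)])
      have "\<Phi> (\<lambda>t. p n t + (- 1) * f t) = a n - \<Phi> f"
        unfolding calculus_simps(2)[OF calc pn C_circle_intros(7)[OF f]] calculus_simps(3)[OF calc f]
        by (simp add: calculus_laurent[OF calc p(1)] cscale_op_minus_one)
      moreover have "norm (\<Phi> (\<lambda>t. p n t + (- 1) * f t)) \<le> e / 2"
        using M[OF that] by (intro calculus_norm_le[OF calc]) (auto simp: dist_norm less_imp_le pn f intro!: C_circle_intros)
      ultimately show ?thesis using e by simp
    qed
    then show "\<exists>M. \<forall>n\<ge>M. norm (a n - \<Phi> f) < e" by blast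
  qed
  then have "laurent_limit N f (\<Phi> f)"
    using p by (auto simp: laurent_limit_def)
  then show ?thesis by (simp add: laurent_op_eq)
qed

lemma fun_calc_eq:
  assumes "f \<in> C_circle"
  shows "fun_calc f (op_pow bilateral_shift N) = laurent_op N f"
  unfolding fun_calc_def op_pow_bilateral_shift
  by (rule the_equality) (use is_calculus_laurent_op calculus_unique[OF _ assms] in blast)+

section \<open>Toeplitz operators with continuous symbol\<close>

lemma coord_nat_proj [simp]: "coord (blinfun_apply nat_proj x) k = coord x (int k)"
  unfolding nat_proj.rep_eq
  by (rule coord_reindex[where P = "\<lambda>_. True", simplified]) (auto simp: inj_on_def)

lemma coord_nat_embed [simp]:
  "coord (blinfun_apply nat_embed x) l = (if 0 \<le> l then coord x (nat l) else 0)"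
  unfolding nat_embed.rep_eq by (rule coord_reindex) (auto simp: inj_on_def)

lemma norm_reindex_le:
  assumes "inj_on g {j. P j}" "\<And>j. coord y j = (if P j then coord x (g j) else 0)"
  shows "norm y \<le> norm x"
  unfolding norm_ell2_def assms(2)
  using ell2_reindex_le[OF coord_summable assms(1)] by simp

lemma norm_nat_proj_le: "norm (blinfun_apply nat_proj x) \<le> norm x"
  by (rule norm_reindex_le[of int "\<lambda>_. True"]) auto

lemma norm_nat_embed_le: "norm (blinfun_apply nat_embed x) \<le> norm x"
  by (rule norm_reindex_le[of nat "\<lambda>l. 0 \<le> l"]) (auto simp: inj_on_def)

lemma norm_bshift_le: "norm (blinfun_apply (bshift j) x) \<le> norm x"
  by (rule norm_reindex_le[of "\<lambda>l. l - j" "\<lambda>_. True"]) auto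

lemma toeplitz_bshift: "toeplitz (cscale_op c (bshift j)) = wshift j (\<lambda>_. c)"
  by (rule blinfun_coord_eqI) (auto simp: toeplitz_def coord_wshift)

lemma toeplitz_add: "toeplitz (a + b) = toeplitz a + toeplitz b"
  by (simp add: toeplitz_def blinfun_compose_bilinear)

lemma toeplitz_diff: "toeplitz (a - b) = toeplitz a - toeplitz b"
  by (simp add: toeplitz_def blinfun_compose_bilinear)

lemma toeplitz_cscale: "toeplitz (cscale_op c a) = cscale_op c (toeplitz a)"
  by (rule blinfun_coord_eqI) (simp add: toeplitz_def)

lemma norm_toeplitz_le: "norm (toeplitz a) \<le> norm a"
proof (rule norm_blinfun_bound)
  fix x
  have "norm (blinfun_apply (toeplitz a) x) \<le> norm (blinfun_apply a (blinfun_apply nat_embed x))"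
    by (simp add: toeplitz_def norm_nat_proj_le)
  also have "\<dots> \<le> norm a * norm (blinfun_apply nat_embed x)"
    by (rule norm_blinfun)
  also have "\<dots> \<le> norm a * norm x"
    by (intro mult_left_mono norm_nat_embed_le) simp
  finally show "norm (blinfun_apply (toeplitz a) x) \<le> norm a * norm x" .
qed simp

lemma tendsto_toeplitz:
  assumes "a \<longlonglongrightarrow> b" shows "(\<lambda>n. toeplitz (a n)) \<longlonglongrightarrow> toeplitz b"
  unfolding toeplitz_def
  by (intro bounded_bilinear.tendsto[OF bounded_bilinear_blinfun_compose] tendsto_const assms)

text \<open>The formal eigenvector of V^N for the eigenvalue e^{it}, truncated to M terms. Its
  support lies in the nonnegative integers, so \<open>nat_embed\<close> after
  \<open>nat_proj\<close> fixes it and the compression to the half line can be tested on it.\<close>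

definition geometric_vec :: "nat \<Rightarrow> real \<Rightarrow> nat \<Rightarrow> int ell2"
  where "geometric_vec N t M = (\<Sum>k<M. cscale (cis (- (real k * t))) (ell2_basis (int (k * N))))"

lemma bshift_basis: "blinfun_apply (bshift j) (ell2_basis i) = ell2_basis (i + j)"
  by (rule ell2_eqI) auto

lemma coord_geometric_vec:
  assumes "N > 0"
  shows "coord (geometric_vec N t M) l =
    (if l \<in> (\<lambda>k. int (k * N)) ` {..<M} then cis (- (real (nat (l div int N)) * t)) else 0)"
proof -
  have "coord (geometric_vec N t M) l = (\<Sum>k<M. if l = int (k * N) then cis (- (real k * t)) else 0)"
    unfolding geometric_vec_def coord_sum by (rule sum.cong) auto
  also have "\<dots> = (if l \<in> (\<lambda>k. int (k * N)) ` {..<M} then cis (- (real (nat (l div int N)) * t)) else 0)"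
  proof (cases "l \<in> (\<lambda>k. int (k * N)) ` {..<M}")
    case True
    then obtain m where m: "m < M" "l = int (m * N)" by auto
    then have "(\<Sum>k<M. if l = int (k * N) then cis (- (real k * t)) else 0) =
        (\<Sum>k<M. if k = m then cis (- (real k * t)) else 0)"
      using assms by (intro sum.cong) auto
    also have "\<dots> = cis (- (real m * t))" using m by simp
    finally show ?thesis using True m assms by simp
  next
    case False
    then show ?thesis by (auto intro!: sum.neutral)
  qed
  finally show ?thesis .
qed

lemma norm_geometric_vec:
  assumes "N > 0"
  shows "norm (geometric_vec N t M) = sqrt (real M)"
proof -
  have "(norm (geometric_vec N t M))\<^sup>2 =
      (\<Sum>l\<in>(\<lambda>k. int (k * N)) ` {..<M}. (cmod (coord (geometric_vec N t M) l))\<^sup>2)"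
    by (rule norm_ell2_finite) (auto simp: coord_geometric_vec[OF assms])
  also have "\<dots> = (\<Sum>l\<in>(\<lambda>k. int (k * N)) ` {..<M}. 1)"
    by (rule sum.cong) (auto simp: coord_geometric_vec[OF assms])
  also have "\<dots> = real M"
    using assms by (simp add: card_image inj_on_def)
  finally show ?thesis by (simp add: real_sqrt_unique)
qed

text \<open>The vectors \<^const>\<open>geometric_vec\<close> are approximate eigenvectors of every Laurent polynomial.\<close>

lemma laurent_geometric_vec:
  assumes "laurent N p a"
  shows "\<exists>C. \<forall>M. norm (blinfun_apply a (geometric_vec N t M) - cscale (p t) (geometric_vec N t M)) \<le> C"
  using assms
proof induction
  case (monom c j)
  let ?Y = "geometric_vec N t"
  let ?D = "\<lambda>j M. blinfun_apply (bshift (j * int N)) (?Y M) - cscale (cis (of_int j * t)) (?Y M)"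
  define g where "g k = cscale (cis (- (real k * t))) (ell2_basis (int (k * N)))" for k
  have Y: "?Y M = (\<Sum>k<M. g k)" for M
    by (simp add: geometric_vec_def g_def)
  have g_shift: "blinfun_apply (bshift (int N)) (g k) = cscale (cis t) (g (Suc k))" for k
  proof -
    have "cis (- (real k * t)) = cis t * cis (- (real (Suc k) * t))"
      by (simp add: cis_mult algebra_simps)
    moreover have "int (k * N) + int N = int (Suc k * N)" by (simp add: algebra_simps)
    ultimately show ?thesis
      unfolding g_def using clinear_op_bshift[of "int N"]
      by (simp only: clinear_op_def bshift_basis cscale_cscale)
  qed
  \<comment> \<open>V^N moves each summand to e^{it} times the next one, so the difference
    telescopes to the two end terms, both of norm one, whatever \<open>M\<close> is.\<close>
  have base: "norm (?D 1 M) \<le> 2" for M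
  proof -
    have "?D 1 M = cscale (cis t) (\<Sum>k<M. g (Suc k) - g k)"
      unfolding Y by (simp add: blinfun.sum_right g_shift sum_subtractf cscale_diff_right cscale_sum_right)
    also have "\<dots> = cscale (cis t) (g M - g 0)"
      by (simp add: sum_lessThan_telescope)
    finally have "norm (?D 1 M) \<le> norm (g M) + norm (g 0)"
      using norm_triangle_ineq4[of "g M" "g 0"] by (simp add: norm_cscale)
    moreover have "norm (ell2_basis i) = 1" for i :: int
    proof -
      have "(norm (ell2_basis i))\<^sup>2 = (\<Sum>l\<in>{i}. (cmod (coord (ell2_basis i) l))\<^sup>2)"
        by (rule norm_ell2_finite) auto
      then show ?thesis by (simp add: power2_eq_1_iff) (smt (verit) norm_ge_zero)
    qed
    then have "norm (g k) = 1" for k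
      by (simp add: g_def norm_cscale)
    ultimately show ?thesis by simp
  qed
  have nat: "norm (?D (int k) M) \<le> 2 * real k" for k M
  proof (induction k)
    case (Suc k)
    \<comment> \<open>With v = V^N and w = e^{it}, this is v^(k+1) - w^(k+1) = v^k (v - w) + w (v^k
      - w^k), so the error grows by at most 2 per step.\<close>
    have "?D (int (Suc k)) M = blinfun_apply (bshift (int k * int N)) (?D 1 M) + cscale (cis t) (?D (int k) M)"
    proof (rule ell2_eqI)
      fix l
      have "cis (real (Suc k) * t) = cis t * cis (real k * t)" by (simp add: cis_mult algebra_simps)
      then show "coord (?D (int (Suc k)) M) l =
          coord (blinfun_apply (bshift (int k * int N)) (?D 1 M) + cscale (cis t) (?D (int k) M)) l"
        by (simp del: of_nat_Suc) (simp add: algebra_simps)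
    qed
    then have "norm (?D (int (Suc k)) M) \<le> norm (?D 1 M) + norm (?D (int k) M)"
      using norm_triangle_ineq[of "blinfun_apply (bshift (int k * int N)) (?D 1 M)" "cscale (cis t) (?D (int k) M)"]
        norm_bshift_le[of "int k * int N" "?D 1 M"] by (simp add: norm_cscale)
    then show ?case using base[of M] Suc by simp
  qed (simp add: bshift_0 ell2_eqI cscale.rep_eq)
  have "norm (?D j M) \<le> 2 * \<bar>of_int j\<bar>" for M
  proof (cases "0 \<le> j")
    case True
    then show ?thesis using nat[of "nat j" M] by simp
  next
    case False
    \<comment> \<open>Negative exponents reduce to positive ones: v^(-k) - w^(-k) = - w^(-k) v^(-k)
      (v^k - w^k), whose outer factors do not increase the norm.\<close>
    have "?D j M = cscale (- cis (of_int j * t)) (blinfun_apply (bshift (j * int N)) (?D (- j) M))"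
    proof (rule ell2_eqI)
      fix l
      have "cis (of_int j * t) * cis (- (of_int j * t)) = 1" by (simp add: cis_mult)
      then show "coord (?D j M) l =
          coord (cscale (- cis (of_int j * t)) (blinfun_apply (bshift (j * int N)) (?D (- j) M))) l"
        by (simp add: algebra_simps)
    qed
    then have "norm (?D j M) \<le> norm (?D (- j) M)"
      using norm_bshift_le[of "j * int N" "?D (- j) M"] by (simp add: norm_cscale)
    then show ?thesis using nat[of "nat (- j)" M] False by simp
  qed
  then have "norm (cscale c (?D j M)) \<le> cmod c * (2 * \<bar>of_int j\<bar>)" for M
    by (simp only: norm_cscale mult_left_mono norm_ge_zero)
  then show ?case
    by (intro exI[of _ "cmod c * (2 * \<bar>of_int j\<bar>)"]) (simp add: cscale_diff_right)
next
  case (add p a q b)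
  then obtain C D where CD:
    "\<And>M. norm (blinfun_apply a (geometric_vec N t M) - cscale (p t) (geometric_vec N t M)) \<le> C"
    "\<And>M. norm (blinfun_apply b (geometric_vec N t M) - cscale (q t) (geometric_vec N t M)) \<le> D"
    by blast
  have "norm (blinfun_apply (a + b) x - cscale (p t + q t) x) \<le>
      norm (blinfun_apply a x - cscale (p t) x) + norm (blinfun_apply b x - cscale (q t) x)" for x
  proof -
    have "blinfun_apply (a + b) x - cscale (p t + q t) x =
        (blinfun_apply a x - cscale (p t) x) + (blinfun_apply b x - cscale (q t) x)"
      by (rule ell2_eqI) (simp add: blinfun.add_left algebra_simps)
    then show ?thesis by (simp only: norm_triangle_ineq)
  qed
  then show ?case using CD by (intro exI[of _ "C + D"]) (meson add_mono order_trans)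
qed

text \<open>The test vectors have norm sqrt M, while the eigenvector error stays below a constant
  \<open>C\<close>; dividing by sqrt M and letting M grow removes the error.\<close>

lemma laurent_le_norm_toeplitz:
  assumes N: "N > 0" and a: "laurent N p a"
  shows "cmod (p t) \<le> norm (toeplitz a)"
proof -
  obtain C where C: "\<And>M. norm (blinfun_apply a (geometric_vec N t M) - cscale (p t) (geometric_vec N t M)) \<le> C"
    using laurent_geometric_vec[OF a] by blast
  have le: "cmod (p t) * sqrt (real M) \<le> norm (toeplitz a) * sqrt (real M) + C" for M
  proof -
    let ?Y = "geometric_vec N t M"
    let ?x = "blinfun_apply nat_proj ?Y"
    have emb: "blinfun_apply nat_embed ?x = ?Y"
      by (rule ell2_eqI) (auto simp: coord_geometric_vec[OF N])
    have "cscale (p t) ?x = blinfun_apply (toeplitz a) ?x - blinfun_apply nat_proj (blinfun_apply a ?Y - cscale (p t) ?Y)"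
      by (rule ell2_eqI) (simp add: toeplitz_def emb)
    then have "cmod (p t) * norm ?x \<le> norm (blinfun_apply (toeplitz a) ?x) +
        norm (blinfun_apply nat_proj (blinfun_apply a ?Y - cscale (p t) ?Y))"
      by (metis norm_cscale norm_triangle_ineq4)
    also have "\<dots> \<le> norm (toeplitz a) * norm ?x + C"
      by (intro add_mono norm_blinfun order_trans[OF norm_nat_proj_le C])
    also have "norm ?x = sqrt (real M)"
      using norm_nat_proj_le[of ?Y] norm_nat_embed_le[of ?x] emb norm_geometric_vec[OF N, of t M] by simp
    finally show ?thesis .
  qed
  show ?thesis
  proof (rule ccontr)
    assume "\<not> ?thesis"
    then have d: "cmod (p t) - norm (toeplitz a) > 0" by simp
    \<comment> \<open>The estimate is used at M = m^2, so that the square root is the integer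
      m.\<close>
    obtain m :: nat where m: "(C / (cmod (p t) - norm (toeplitz a))) < real m"
      using reals_Archimedean2 by blast
    then have "C < (cmod (p t) - norm (toeplitz a)) * sqrt (real (m\<^sup>2))"
      using d by (simp add: field_simps)
    then show False using le[of "m\<^sup>2"] by (simp add: algebra_simps)
  qed
qed

section \<open>The operators T(f(V^N)) and their norms\<close>

definition toeplitz_fun :: "nat \<Rightarrow> (real \<Rightarrow> complex) \<Rightarrow> (nat ell2 \<Rightarrow>\<^sub>L nat ell2)"
  where "toeplitz_fun N f = toeplitz (fun_calc f (op_pow bilateral_shift N))"

lemma toeplitz_fun_eq: "f \<in> C_circle \<Longrightarrow> toeplitz_fun N f = toeplitz (laurent_op N f)"
  by (simp add: toeplitz_fun_def fun_calc_eq)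

lemma toeplitz_fun_limit:
  assumes "f \<in> C_circle"
  obtains p a where "\<And>n. laurent N (p n) (a n)" "uniform_limit UNIV p f sequentially"
    "(\<lambda>n. toeplitz (a n)) \<longlonglongrightarrow> toeplitz_fun N f"
  using laurent_op_limit[OF assms, of N] tendsto_toeplitz
  unfolding toeplitz_fun_eq[OF assms] laurent_limit_def by metis

lemma toeplitz_fun_laurent: "laurent N p a \<Longrightarrow> toeplitz_fun N p = toeplitz a"
  by (simp add: toeplitz_fun_eq laurent_C_circle laurent_op_eq[OF laurent_limit_laurent])

text \<open>The induction principle for T(f(V^N)): closed additive properties need checking only on
  constant multiples of U^{jN}. It yields membership in A(N), invariance under z -> U* z U, and
  commutation with the periodic diagonal.\<close>

lemma toeplitz_fun_closed_induct:
  assumes "f \<in> C_circle" "closed S" "\<And>j c. wshift (j * int N) (\<lambda>_. c) \<in> S"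
    "\<And>x y. x \<in> S \<Longrightarrow> y \<in> S \<Longrightarrow> x + y \<in> S"
  shows "toeplitz_fun N f \<in> S"
proof -
  obtain p a where p: "\<And>n. laurent N (p n) (a n)" "(\<lambda>n. toeplitz (a n)) \<longlonglongrightarrow> toeplitz_fun N f"
    using toeplitz_fun_limit[OF assms(1)] by metis
  have "toeplitz b \<in> S" if "laurent N q b" for q b
    using that by induction (auto simp: toeplitz_bshift toeplitz_add assms)
  then show ?thesis
    using closed_sequentially[OF assms(2) _ p(2)] p(1) by blast
qed

lemma toeplitz_fun_diff:
  assumes "f \<in> C_circle" "g \<in> C_circle"
  shows "toeplitz_fun N (\<lambda>t. f t - g t) = toeplitz_fun N f - toeplitz_fun N g"
  using assms laurent_op_eq[OF laurent_limit_diff[OF laurent_op_limit laurent_op_limit, of f g N]]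
  by (simp add: toeplitz_fun_eq C_circle_intros toeplitz_diff)

lemma toeplitz_fun_add:
  assumes "f \<in> C_circle" "g \<in> C_circle"
  shows "toeplitz_fun N (\<lambda>t. f t + g t) = toeplitz_fun N f + toeplitz_fun N g"
  using assms laurent_op_eq[OF laurent_limit_add[OF laurent_op_limit laurent_op_limit, of f g N]]
  by (simp add: toeplitz_fun_eq C_circle_intros toeplitz_add)

lemma toeplitz_fun_cmult:
  assumes "f \<in> C_circle"
  shows "toeplitz_fun N (\<lambda>t. c * f t) = cscale_op c (toeplitz_fun N f)"
  using assms laurent_op_eq[OF laurent_limit_cmult[OF laurent_op_limit, of f N c]]
  by (simp add: toeplitz_fun_eq C_circle_intros toeplitz_cscale)

lemma norm_toeplitz_fun_le:
  assumes "f \<in> C_circle" "\<And>t. cmod (f t) \<le> B"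
  shows "norm (toeplitz_fun N f) \<le> B"
  using norm_toeplitz_le laurent_limit_norm_le[OF laurent_op_limit[OF assms(1)] assms(2)]
  by (simp add: toeplitz_fun_eq[OF assms(1)]) (meson order_trans)

lemma le_norm_toeplitz_fun:
  assumes N: "N > 0" and f: "f \<in> C_circle"
  shows "cmod (f t) \<le> norm (toeplitz_fun N f)"
proof -
  obtain p a where p: "\<And>n. laurent N (p n) (a n)" "uniform_limit UNIV p f sequentially"
    "(\<lambda>n. toeplitz (a n)) \<longlonglongrightarrow> toeplitz_fun N f"
    using toeplitz_fun_limit[OF f] by metis
  show ?thesis
  proof (rule LIMSEQ_le)
    show "(\<lambda>n. cmod (p n t)) \<longlonglongrightarrow> cmod (f t)"
      by (intro tendsto_norm tendsto_uniform_limitI[OF p(2)]) simp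
    show "(\<lambda>n. norm (toeplitz (a n))) \<longlonglongrightarrow> norm (toeplitz_fun N f)"
      by (intro tendsto_norm p)
    show "\<exists>M. \<forall>n\<ge>M. cmod (p n t) \<le> norm (toeplitz (a n))"
      using laurent_le_norm_toeplitz[OF N p(1)] by blast
  qed
qed

lemma toeplitz_fun_in_BDT_alg:
  assumes N: "N > 0" and "f \<in> C_circle"
  shows "toeplitz_fun N f \<in> BDT_alg N"
  by (rule toeplitz_fun_closed_induct[OF assms(2) closed_BDT_alg])
    (use wshift_in_BDT_poly[OF N eventually_periodic_const] BDT_poly_subset_alg in \<open>auto intro: BDT_alg_intros\<close>)

lemma toeplitz_fun_shift_invariant:
  assumes "f \<in> C_circle"
  shows "adj unilateral_shift o\<^sub>L toeplitz_fun N f o\<^sub>L unilateral_shift = toeplitz_fun N f"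
proof -
  have "toeplitz_fun N f \<in> {t. adj unilateral_shift o\<^sub>L t o\<^sub>L unilateral_shift = t}"
  proof (rule toeplitz_fun_closed_induct[OF assms])
    show "closed {t. adj unilateral_shift o\<^sub>L t o\<^sub>L unilateral_shift = t}"
      by (intro closed_Collect_eq continuous_intros bounded_bilinear.continuous_on[OF bounded_bilinear_blinfun_compose])
    show "wshift (j * int N) (\<lambda>_. c) \<in> {t. adj unilateral_shift o\<^sub>L t o\<^sub>L unilateral_shift = t}" for j c
      unfolding adj_unilateral_shift
      unfolding unilateral_shift_eq
      by (auto intro!: blinfun_coord_eqI simp: coord_wshift)
  qed (auto simp: blinfun_compose_bilinear)
  then show ?thesis by simp
qed

section \<open>The commutant of the periodic diagonal, and closedness of the Toeplitz range\<close>

definition diag_commutes :: "nat \<Rightarrow> (nat ell2 \<Rightarrow>\<^sub>L nat ell2) \<Rightarrow> bool"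
  where "diag_commutes N y \<longleftrightarrow> (\<forall>D\<in>diag_per N. y o\<^sub>L D = D o\<^sub>L y)"

lemma closed_diag_commutes: "closed {y. diag_commutes N y}"
  unfolding diag_commutes_def Collect_ball_eq
  by (intro closed_INT ballI closed_Collect_eq continuous_intros
      bounded_bilinear.continuous_on[OF bounded_bilinear_blinfun_compose])

lemma diag_commutes_intros:
  "diag_commutes N 0"
  "diag_commutes N x \<Longrightarrow> diag_commutes N y \<Longrightarrow> diag_commutes N (x + y)"
  "diag_commutes N x \<Longrightarrow> diag_commutes N y \<Longrightarrow> diag_commutes N (x - y)"
  by (auto simp: diag_commutes_def blinfun_compose_bilinear)

lemma periodic_shift:
  fixes a :: "nat \<Rightarrow> complex"
  assumes "\<forall>k. a (k + N) = a k" "0 \<le> int k + j * int N"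
  shows "a (nat (int k + j * int N)) = a k"
proof (cases "0 \<le> j")
  case True
  have "nat (int k + j * int N) = k + N * nat j"
    using True by (simp add: nat_add_distrib nat_mult_distrib mult.commute)
  then show ?thesis using eventually_periodic_mult_period[of 0 a N k "nat j"] assms by simp
next
  case False
  have "int k = int (nat (int k + j * int N) + N * nat (- j))"
    using False assms(2) by simp
  then have "k = nat (int k + j * int N) + N * nat (- j)"
    by (simp only: of_nat_eq_iff)
  then show ?thesis
    using eventually_periodic_mult_period[of 0 a N "nat (int k + j * int N)" "nat (- j)"] assms(1) by simp
qed

lemma wshift_diag_commutes:
  assumes N: "N > 0" and b: "bounded (range b)"
  shows "diag_commutes N (wshift (j * int N) b)"
  unfolding diag_commutes_def diag_per_eq[OF N]
proof clarify
  fix a :: "nat \<Rightarrow> complex" assume a: "\<forall>k. a (k + N) = a k"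
  have ba: "bounded (range a)" using periodic_bounded[OF N a] .
  have "a (nat (int i - j * int N)) = a i" if "j * int N \<le> int i" for i
    using periodic_shift[OF a, of i "- j"] that by simp
  then show "wshift (j * int N) b o\<^sub>L wshift 0 a = wshift 0 a o\<^sub>L wshift (j * int N) b"
    by (intro blinfun_coord_eqI) (auto simp: coord_wshift ba b)
qed

lemma toeplitz_fun_diag_commutes:
  assumes N: "N > 0" and "f \<in> C_circle"
  shows "diag_commutes N (toeplitz_fun N f)"
proof -
  have "toeplitz_fun N f \<in> {y. diag_commutes N y}"
    by (rule toeplitz_fun_closed_induct[OF assms(2) closed_diag_commutes])
      (simp_all add: diag_commutes_intros wshift_diag_commutes[OF N])
  then show ?thesis by simp
qed

text \<open>The lower bound \<open>le_norm_toeplitz_fun\<close> turns norm Cauchy operators into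
  uniformly Cauchy symbols, whose limit is continuous and periodic; the upper bound identifies the
  limit operator.\<close>

lemma closed_range_toeplitz_fun:
  assumes N: "N > 0"
  shows "closed (toeplitz_fun N ` C_circle)"
  unfolding closed_sequential_limits
proof clarify
  fix s t assume s: "\<forall>n. s n \<in> toeplitz_fun N ` C_circle" and lim: "s \<longlonglongrightarrow> t"
  have "\<exists>f. \<forall>n. f n \<in> C_circle \<and> s n = toeplitz_fun N (f n)"
    by (rule choice) (use s in blast)
  then obtain f where f: "\<And>n. f n \<in> C_circle" "\<And>n. s n = toeplitz_fun N (f n)"
    by blast
  have "uniformly_Cauchy_on UNIV f"
  proof (rule uniformly_Cauchy_onI)
    fix e :: real assume "e > 0"
    then obtain M where M: "\<And>m n. m \<ge> M \<Longrightarrow> n \<ge> M \<Longrightarrow> norm (s m - s n) < e"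
      using CauchyD[OF LIMSEQ_imp_Cauchy[OF lim]] by blast
    have "dist (f m x) (f n x) < e" if "m \<ge> M" "n \<ge> M" for m n x
      using le_norm_toeplitz_fun[OF N, of "\<lambda>x. f m x - f n x" x] M[OF that] f
      by (simp add: dist_norm C_circle_intros toeplitz_fun_diff)
    then show "\<exists>M. \<forall>x\<in>UNIV. \<forall>m\<ge>M. \<forall>n\<ge>M. dist (f m x) (f n x) < e" by blast
  qed
  then obtain g where g: "uniform_limit UNIV f g sequentially"
    using Cauchy_uniformly_convergent uniformly_convergent_on_def by blast
  have "continuous_on UNIV g"
    by (rule uniform_limit_theorem[OF _ g]) (use f(1) in \<open>auto simp: C_circle_def\<close>)
  moreover have "g (x + 2 * pi) = g x" for x
  proof (rule LIMSEQ_unique)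
    show "(\<lambda>n. f n (x + 2 * pi)) \<longlonglongrightarrow> g (x + 2 * pi)"
      by (rule tendsto_uniform_limitI[OF g]) simp
    have "(\<lambda>n. f n x) \<longlonglongrightarrow> g x" by (rule tendsto_uniform_limitI[OF g]) simp
    then show "(\<lambda>n. f n (x + 2 * pi)) \<longlonglongrightarrow> g x" using f(1) by (simp add: C_circle_def)
  qed
  ultimately have gC: "g \<in> C_circle" by (simp add: C_circle_def)
  have "s \<longlonglongrightarrow> toeplitz_fun N g"
  proof (rule LIMSEQ_I)
    fix e :: real assume e: "e > 0"
    then have "\<forall>\<^sub>F n in sequentially. \<forall>t\<in>UNIV. dist (f n t) (g t) < e / 2"
      by (intro uniform_limitD[OF g]) simp
    then obtain M where M: "\<And>n t. n \<ge> M \<Longrightarrow> dist (f n t) (g t) < e / 2"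
      by (auto simp: eventually_sequentially)
    have "norm (s n - toeplitz_fun N g) < e" if "n \<ge> M" for n
    proof -
      have "norm (toeplitz_fun N (\<lambda>t. f n t - g t)) \<le> e / 2"
        using M[OF that] f(1) gC by (intro norm_toeplitz_fun_le C_circle_intros) (auto simp: dist_norm less_imp_le)
      then show ?thesis using f gC e by (simp add: toeplitz_fun_diff)
    qed
    then show "\<exists>M. \<forall>n\<ge>M. norm (s n - toeplitz_fun N g) < e" by blast
  qed
  then have "t = toeplitz_fun N g" using LIMSEQ_unique lim by blast
  then show "t \<in> toeplitz_fun N ` C_circle" using gC by blast
qed

section \<open>Derivations\<close>

abbreviation "U \<equiv> unilateral_shift"
abbreviation "U' \<equiv> adj unilateral_shift"

lemma compose_assoc: "(a o\<^sub>L b) o\<^sub>L c = a o\<^sub>L (b o\<^sub>L c)"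
  by (rule blinfun_eqI) simp

lemma compose_id [simp]: "id_blinfun o\<^sub>L a = a" "a o\<^sub>L id_blinfun = a"
  by (auto intro: blinfun_eqI)

lemma coord_unilateral_shift: "coord (blinfun_apply U x) i = (if 0 < i then coord x (i - 1) else 0)"
  by (simp add: unilateral_shift_eq coord_wshift nat_diff_distrib)

lemma coord_adj_unilateral_shift: "coord (blinfun_apply U' x) i = coord x (Suc i)"
  by (simp add: adj_unilateral_shift coord_wshift nat_add_distrib)

lemma adj_shift_shift: "U' o\<^sub>L U = id_blinfun"
  by (rule blinfun_coord_eqI) (simp add: coord_unilateral_shift coord_adj_unilateral_shift)

lemma adj_shift_shift': "U' o\<^sub>L (U o\<^sub>L a) = a"
  by (simp add: compose_assoc[symmetric] adj_shift_shift)

lemma norm_shift_le: "norm U \<le> 1" "norm U' \<le> 1"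
proof -
  have "norm (blinfun_apply U x) \<le> norm x" for x
    by (rule norm_reindex_le[of "\<lambda>i. i - 1" "\<lambda>i. 0 < i"]) (auto simp: inj_on_def coord_unilateral_shift)
  then show "norm U \<le> 1" by (intro norm_blinfun_bound) auto
  have "norm (blinfun_apply U' x) \<le> norm x" for x
    by (rule norm_reindex_le[of Suc "\<lambda>i. True"]) (auto simp: coord_adj_unilateral_shift)
  then show "norm U' \<le> 1" by (intro norm_blinfun_bound) auto
qed

lemma norm_compose_le1: "norm a \<le> 1 \<Longrightarrow> norm (a o\<^sub>L b) \<le> norm b" "norm a \<le> 1 \<Longrightarrow> norm (c o\<^sub>L a) \<le> norm c"
  using norm_blinfun_compose[of a b] norm_blinfun_compose[of c a]
    mult_left_le_one_le[of "norm b" "norm a"] mult_right_le_one_le[of "norm c" "norm a"] by auto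

text \<open>Moving a diagonal operator past U translates its weights by one, and the same translate
  works for U*. Translation preserves periodicity, so the result is still in the periodic
  diagonal.\<close>

lemma diag_past_shift:
  assumes N: "N > 0" and D: "D \<in> diag_per N"
  obtains D' where "D' \<in> diag_per N" "D o\<^sub>L U = U o\<^sub>L D'" "U' o\<^sub>L D = D' o\<^sub>L U'"
proof -
  obtain a where a: "D = wshift 0 a" "\<forall>k. a (k + N) = a k"
    using D by (auto simp: diag_per_eq[OF N])
  define b where "b k = a (Suc k)" for k
  have b: "\<forall>k. b (k + N) = b k"
    using a(2) unfolding b_def by (metis add_Suc)
  have bd: "bounded (range a)" "bounded (range b)"
    using periodic_bounded[OF N] a(2) b by blast+
  have "wshift 0 b \<in> diag_per N" using b by (auto simp: diag_per_eq[OF N])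
  moreover have "D o\<^sub>L U = U o\<^sub>L wshift 0 b" "U' o\<^sub>L D = wshift 0 b o\<^sub>L U'"
    by (auto intro!: blinfun_coord_eqI simp: a coord_wshift[OF bd(1)] coord_wshift[OF bd(2)]
        coord_unilateral_shift coord_adj_unilateral_shift b_def nat_diff_distrib nat_add_distrib)
  ultimately show ?thesis using that by blast
qed

lemma shift_past_diag:
  assumes N: "N > 0" and D: "D \<in> diag_per N"
  obtains D' where "D' \<in> diag_per N" "U o\<^sub>L D = D' o\<^sub>L U" "D o\<^sub>L U' = U' o\<^sub>L D'"
proof -
  obtain a where a: "D = wshift 0 a" "\<forall>k. a (k + N) = a k"
    using D by (auto simp: diag_per_eq[OF N])
  \<comment> \<open>A translate by -1, with N added so that it is also meaningful at k = 0;
    periodicity makes the extra N harmless.\<close>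
  define b where "b k = a (k + N - 1)" for k
  have b: "\<forall>k. b (k + N) = b k"
    using a(2) N unfolding b_def by (metis Nat.add_diff_assoc2 Suc_leI add_gr_0 One_nat_def)
  have ba: "b (Suc k) = a k" for k using a(2) by (simp add: b_def)
  have bd: "bounded (range a)" "bounded (range b)"
    using periodic_bounded[OF N] a(2) b by blast+
  have "wshift 0 b \<in> diag_per N" using b by (auto simp: diag_per_eq[OF N])
  moreover have "U o\<^sub>L D = wshift 0 b o\<^sub>L U"
  proof (rule blinfun_coord_eqI)
    fix x i
    show "coord (blinfun_apply (U o\<^sub>L D) x) i = coord (blinfun_apply (wshift 0 b o\<^sub>L U) x) i"
      by (cases i) (simp_all add: a coord_wshift[OF bd(1)] coord_wshift[OF bd(2)] coord_unilateral_shift ba nat_add_distrib)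
  qed
  moreover have "D o\<^sub>L U' = U' o\<^sub>L wshift 0 b"
    by (rule blinfun_coord_eqI) (simp add: a coord_wshift[OF bd(1)] coord_wshift[OF bd(2)] coord_adj_unilateral_shift ba nat_add_distrib)
  ultimately show ?thesis using that by blast
qed

lemma diag_commutes_conj_shift:
  assumes N: "N > 0" and z: "diag_commutes N z"
  shows "diag_commutes N (U o\<^sub>L z o\<^sub>L U')"
  unfolding diag_commutes_def
proof
  fix D assume D: "D \<in> diag_per N"
  obtain D' where D': "D' \<in> diag_per N" "D o\<^sub>L U = U o\<^sub>L D'" "U' o\<^sub>L D = D' o\<^sub>L U'"
    using diag_past_shift[OF N D] .
  have "(U o\<^sub>L z o\<^sub>L U') o\<^sub>L D = U o\<^sub>L (z o\<^sub>L D') o\<^sub>L U'"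
    by (simp add: compose_assoc D')
  also have "\<dots> = (U o\<^sub>L D') o\<^sub>L z o\<^sub>L U'"
    using z D'(1) by (simp add: diag_commutes_def compose_assoc)
  also have "\<dots> = D o\<^sub>L (U o\<^sub>L z o\<^sub>L U')"
    unfolding D'(2)[symmetric] by (simp add: compose_assoc)
  finally show "(U o\<^sub>L z o\<^sub>L U') o\<^sub>L D = D o\<^sub>L (U o\<^sub>L z o\<^sub>L U')" .
qed

section \<open>Derivations and limits of commutators, reduced to generators\<close>

lemma BDT_poly_induct [consumes 1, case_names shift adj diag zero add scale mult]:
  assumes "a \<in> BDT_poly N" "P U" "P U'" "\<And>D. D \<in> diag_per N \<Longrightarrow> P D" "P 0"
    "\<And>a b. a \<in> BDT_poly N \<Longrightarrow> b \<in> BDT_poly N \<Longrightarrow> P a \<Longrightarrow> P b \<Longrightarrow> P (a + b)"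
    "\<And>c a. a \<in> BDT_poly N \<Longrightarrow> P a \<Longrightarrow> P (cscale_op c a)"
    "\<And>a b. a \<in> BDT_poly N \<Longrightarrow> b \<in> BDT_poly N \<Longrightarrow> P a \<Longrightarrow> P b \<Longrightarrow> P (a o\<^sub>L b)"
  shows "P a"
  using assms(1) unfolding BDT_poly_def
  by induction (use assms(2-) in \<open>auto simp: BDT_poly_def\<close>)

lemma derivationD:
  assumes "derivation_in N d"
  shows "a \<in> BDT_poly N \<Longrightarrow> d a \<in> BDT_alg N"
    and "a \<in> BDT_poly N \<Longrightarrow> b \<in> BDT_poly N \<Longrightarrow> d (a + b) = d a + d b"
    and "a \<in> BDT_poly N \<Longrightarrow> d (cscale_op c a) = cscale_op c (d a)"
    and "a \<in> BDT_poly N \<Longrightarrow> b \<in> BDT_poly N \<Longrightarrow> d (a o\<^sub>L b) = (d a o\<^sub>L b) + (a o\<^sub>L d b)"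
  using assms unfolding derivation_in_def by blast+

lemma derivation_zero: "derivation_in N d \<Longrightarrow> d 0 = 0"
  using derivationD(2)[of N d 0 0] BDT_poly_intros(4) by simp

lemma derivation_eq_on_generators:
  assumes d: "derivation_in N d" and d': "derivation_in N d'"
    and eq: "d U = d' U" "d U' = d' U'" "\<And>D. D \<in> diag_per N \<Longrightarrow> d D = d' D"
    and a: "a \<in> BDT_poly N"
  shows "d a = d' a"
  using a by (induction rule: BDT_poly_induct)
    (simp_all add: eq derivation_zero[OF d] derivation_zero[OF d'] derivationD[OF d] derivationD[OF d'])

lemma derivation_diff:
  assumes d: "derivation_in N d" and d': "derivation_in N d'"
  shows "derivation_in N (\<lambda>a. d a - d' a)"
proof -
  have cs: "cscale_op c (a - b) = cscale_op c a - cscale_op c b" for c and a b :: "nat ell2 \<Rightarrow>\<^sub>L nat ell2"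
    by (rule blinfun_eqI) (simp add: blinfun.diff_left cscale_diff_right)
  show ?thesis
    unfolding derivation_in_def
    by (auto simp: derivationD[OF d] derivationD[OF d'] cs blinfun_compose_bilinear intro: BDT_alg_intros)
qed

lemma derivation_commutator:
  assumes N: "N > 0" and b: "b \<in> BDT_alg N"
  shows "derivation_in N (\<lambda>a. (b o\<^sub>L a) - (a o\<^sub>L b))"
proof -
  have "b o\<^sub>L cscale_op c a = cscale_op c (b o\<^sub>L a)" for c a
    using BDT_alg_clinear[OF N b] by (intro blinfun_eqI) (simp add: clinear_op_def)
  moreover have "cscale_op c a o\<^sub>L b = cscale_op c (a o\<^sub>L b)" for c and a :: "nat ell2 \<Rightarrow>\<^sub>L nat ell2"
    by (rule blinfun_eqI) simp
  moreover have "cscale_op c (a - b) = cscale_op c a - cscale_op c b" for c and a b :: "nat ell2 \<Rightarrow>\<^sub>L nat ell2"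
    by (rule blinfun_eqI) (simp add: blinfun.diff_left cscale_diff_right)
  ultimately show ?thesis
    unfolding derivation_in_def
    by (auto simp: blinfun_compose_bilinear compose_assoc intro!: BDT_alg_intros(6,10) b
        dest: BDT_poly_subset_alg[THEN subsetD])
qed

text \<open>Each commutator map satisfies the Leibniz rule, and so does \<open>d\<close>; norm
  limits on two factors therefore give the limit on their product.\<close>

lemma commutator_limit_on_generators:
  assumes N: "N > 0" and d: "derivation_in N d" and s: "\<And>n. s n \<in> BDT_alg N"
    and "(\<lambda>n. (s n o\<^sub>L U) - (U o\<^sub>L s n)) \<longlonglongrightarrow> d U"
    and "(\<lambda>n. (s n o\<^sub>L U') - (U' o\<^sub>L s n)) \<longlonglongrightarrow> d U'"
    and "\<And>D. D \<in> diag_per N \<Longrightarrow> (\<lambda>n. (s n o\<^sub>L D) - (D o\<^sub>L s n)) \<longlonglongrightarrow> d D"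
    and a: "a \<in> BDT_poly N"
  shows "(\<lambda>n. (s n o\<^sub>L a) - (a o\<^sub>L s n)) \<longlonglongrightarrow> d a"
  using a
proof (induction rule: BDT_poly_induct)
  case zero
  then show ?case by (simp add: derivation_zero[OF d])
next
  case (add a b)
  then show ?case
    using tendsto_add[OF add(3,4)] derivationD(2)[OF d] derivationD(2)[OF derivation_commutator[OF N s]] by simp
next
  case (scale c a)
  then show ?case
    using tendsto_cscale_op[OF scale(2), of c] derivationD(3)[OF d] derivationD(3)[OF derivation_commutator[OF N s]] by simp
next
  case (mult a b)
  have "(\<lambda>n. (((s n o\<^sub>L a) - (a o\<^sub>L s n)) o\<^sub>L b) + (a o\<^sub>L ((s n o\<^sub>L b) - (b o\<^sub>L s n)))) \<longlonglongrightarrow> (d a o\<^sub>L b) + (a o\<^sub>L d b)"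
    by (intro tendsto_add bounded_bilinear.tendsto[OF bounded_bilinear_blinfun_compose] tendsto_const mult)
  then show ?case
    using mult derivationD(4)[OF d] derivationD(4)[OF derivation_commutator[OF N s]] by simp
qed (use assms in auto)

text \<open>A finitely supported vector is annihilated once M passes its support. Density and
  contractivity extend this to all vectors.\<close>

lemma backward_shift_tendsto_0:
  "(\<lambda>M. blinfun_apply (wshift (- int M) (\<lambda>_. 1)) x) \<longlonglongrightarrow> 0"
proof (rule LIMSEQ_I)
  fix e :: real assume e: "e > 0"
  let ?V = "\<lambda>M. blinfun_apply (wshift (- int M) (\<lambda>_. 1))"
  have c: "coord (?V M z) i = coord z (i + M)" for M z i
    by (simp add: coord_wshift nat_add_distrib)
  obtain y where y: "finsupp y" "dist y x < e"
    using closure_finsupp e by (auto simp: closure_approachable set_eq_iff)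
  from y(1) obtain L where L: "\<And>i. coord y i \<noteq> 0 \<Longrightarrow> i < L"
    using finite_nat_set_iff_bounded[of "{i. coord y i \<noteq> 0}"] by (auto simp: finsupp_def)
  have "norm (?V M x - 0) < e" if "M \<ge> L" for M
  proof -
    have "?V M y = 0"
      using L that by (intro ell2_eqI) (force simp: c)
    then have "norm (?V M x) = norm (?V M (x - y))"
      by (simp add: blinfun.diff_right)
    also have "\<dots> \<le> norm (x - y)"
      by (rule norm_reindex_le[of "\<lambda>i. i + M" "\<lambda>_. True"]) (auto simp: c inj_on_def)
    finally show ?thesis using y(2) by (simp add: dist_norm norm_minus_commute)
  qed
  then show "\<exists>L. \<forall>M\<ge>L. norm (?V M x - 0) < e" by blast
qed

primrec shift_sum :: "(nat ell2 \<Rightarrow>\<^sub>L nat ell2) \<Rightarrow> nat \<Rightarrow> (nat ell2 \<Rightarrow>\<^sub>L nat ell2)" where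
  "shift_sum y 0 = 0"
| "shift_sum y (Suc M) = U o\<^sub>L (y + shift_sum y M) o\<^sub>L U'"

text \<open>
  The derivation with \<open>U \<mapsto> U y\<close> is formally the commutator with \<open>\<Sum>\<^sub>m\<^sub>\<ge>\<^sub>1 U\<^sup>m y U\<^sup>*\<^sup>m\<close>. The series need
  not converge, but the commutators with its partial sums converge strongly.
\<close>

lemma derivation_exists:
  assumes N: "N > 0" and y: "y \<in> BDT_alg N" "diag_commutes N y"
  obtains \<delta> where "derivation_in N \<delta>" "\<And>D. D \<in> diag_per N \<Longrightarrow> \<delta> D = 0"
    "\<delta> U = U o\<^sub>L y" "\<delta> U' = - (y o\<^sub>L U')"
proof -
  define F where "F = shift_sum y"
  \<comment> \<open>\<open>P a b\<close> says that the commutators of the partial sums with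
    \<open>a\<close> converge to \<open>b\<close> strongly, that is, vector by vector.\<close>
  define P where "P a b \<longleftrightarrow> (\<forall>x. (\<lambda>M. blinfun_apply ((F M o\<^sub>L a) - (a o\<^sub>L F M)) x) \<longlonglongrightarrow> blinfun_apply b x)" for a b
  have F_alg: "F M \<in> BDT_alg N" for M
    unfolding F_def by (induction M) (auto intro: BDT_alg_intros y)
  have F_diag: "diag_commutes N (F M)" for M
    unfolding F_def by (induction M) (auto intro!: diag_commutes_intros y(2) diag_commutes_conj_shift[OF N])
  have diff: "F (Suc M) - F M = wshift (int (Suc M)) (\<lambda>_. 1) o\<^sub>L y o\<^sub>L wshift (- int (Suc M)) (\<lambda>_. 1)" for M
  proof (induction M)
    case 0
    show ?case by (simp add: F_def adj_unilateral_shift flip: unilateral_shift_eq)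
  next
    case (Suc M)
    have "F (Suc (Suc M)) - F (Suc M) = U o\<^sub>L (F (Suc M) - F M) o\<^sub>L U'"
      by (simp add: F_def blinfun_compose_bilinear)
    moreover have "wshift (int (Suc (Suc M))) (\<lambda>_. 1) = U o\<^sub>L wshift (int (Suc M)) (\<lambda>_. 1)"
      by (rule blinfun_coord_eqI) (auto simp: coord_unilateral_shift coord_wshift nat_diff_distrib' nat_add_distrib numeral_2_eq_2)
    moreover have "wshift (- int (Suc (Suc M))) (\<lambda>_. 1) = wshift (- int (Suc M)) (\<lambda>_. 1) o\<^sub>L U'"
      by (rule blinfun_coord_eqI) (auto simp: coord_adj_unilateral_shift coord_wshift intro!: arg_cong[of _ _ "coord _"])
    ultimately show ?case by (simp add: Suc compose_assoc)
  qed
  \<comment> \<open>The increment is U^m y U*^m with m = M + 1. Its norm need not decay, but U*^m x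
    tends to 0 and U^m is a contraction, so it tends to 0 strongly.\<close>
  have lim0: "(\<lambda>M. blinfun_apply (F (Suc M) - F M) x) \<longlonglongrightarrow> 0" for x
  proof (rule Lim_null_comparison)
    let ?v = "\<lambda>M. blinfun_apply (wshift (- int (Suc M)) (\<lambda>_. 1)) x"
    have n: "norm (blinfun_apply (wshift (int m) (\<lambda>_. 1)) z) \<le> norm z" for m z
      by (rule norm_reindex_le[of "\<lambda>i. nat (int i - int m)" "\<lambda>i. int m \<le> int i"]) (auto simp: coord_wshift inj_on_def)
    show "\<forall>\<^sub>F M in sequentially. norm (blinfun_apply (F (Suc M) - F M) x) \<le> norm y * norm (?v M)"
      unfolding diff by (intro always_eventually allI) (auto intro: order_trans[OF n norm_blinfun] simp del: of_nat_Suc)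
    have "?v \<longlonglongrightarrow> 0"
      using LIMSEQ_Suc[OF backward_shift_tendsto_0] .
    then show "(\<lambda>M. norm y * norm (?v M)) \<longlonglongrightarrow> 0"
      by (intro tendsto_mult_right_zero tendsto_norm_zero)
  qed
  have P_shift: "P U (U o\<^sub>L y)"
    unfolding P_def
  proof
    fix x
    \<comment> \<open>By the recursion and U* U = 1, the product of \<open>F (Suc M)\<close> and
      \<open>U\<close> is \<open>U\<close> times \<open>y + F M\<close>; the commutator thus misses
      \<open>U y\<close> only by one increment.\<close>
    have "(F (Suc M) o\<^sub>L U) - (U o\<^sub>L F (Suc M)) = (U o\<^sub>L y) - (U o\<^sub>L (F (Suc M) - F M))" for M
      by (simp add: F_def blinfun_compose_bilinear compose_assoc adj_shift_shift)
    then have "(\<lambda>M. blinfun_apply ((F (Suc M) o\<^sub>L U) - (U o\<^sub>L F (Suc M))) x) \<longlonglongrightarrow> blinfun_apply (U o\<^sub>L y) x - blinfun_apply U 0"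
      by (simp only: blinfun.diff_left blinfun_apply_blinfun_compose)
        (intro tendsto_diff tendsto_const blinfun.tendsto lim0[unfolded blinfun.diff_left])
    then show "(\<lambda>M. blinfun_apply ((F M o\<^sub>L U) - (U o\<^sub>L F M)) x) \<longlonglongrightarrow> blinfun_apply (U o\<^sub>L y) x"
      by (subst filterlim_sequentially_Suc[symmetric]) (simp add: blinfun.zero_right)
  qed
  have P_adj: "P U' (- (y o\<^sub>L U'))"
    unfolding P_def
  proof
    fix x
    have "(F (Suc M) o\<^sub>L U') - (U' o\<^sub>L F (Suc M)) = ((F (Suc M) - F M) o\<^sub>L U') - (y o\<^sub>L U')" for M
      by (simp add: F_def blinfun_compose_bilinear compose_assoc adj_shift_shift')
    then have "(\<lambda>M. blinfun_apply ((F (Suc M) o\<^sub>L U') - (U' o\<^sub>L F (Suc M))) x) \<longlonglongrightarrow> 0 - blinfun_apply (y o\<^sub>L U') x"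
      by (simp only: blinfun.diff_left blinfun_apply_blinfun_compose)
        (intro tendsto_diff tendsto_const lim0[unfolded blinfun.diff_left])
    then show "(\<lambda>M. blinfun_apply ((F M o\<^sub>L U') - (U' o\<^sub>L F M)) x) \<longlonglongrightarrow> blinfun_apply (- (y o\<^sub>L U')) x"
      by (subst filterlim_sequentially_Suc[symmetric]) (simp add: blinfun.minus_left)
  qed
  have P_diag: "P D 0" if "D \<in> diag_per N" for D
    using F_diag that by (simp add: P_def diag_commutes_def)
  have P_add: "P (a + a') (b + b')" if "P a b" "P a' b'" for a a' b b'
    unfolding P_def
  proof
    fix x
    from that have "(\<lambda>M. blinfun_apply ((F M o\<^sub>L a) - (a o\<^sub>L F M)) x + blinfun_apply ((F M o\<^sub>L a') - (a' o\<^sub>L F M)) x)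
        \<longlonglongrightarrow> blinfun_apply b x + blinfun_apply b' x"
      unfolding P_def by (intro tendsto_add) auto
    then show "(\<lambda>M. blinfun_apply ((F M o\<^sub>L (a + a')) - ((a + a') o\<^sub>L F M)) x) \<longlonglongrightarrow> blinfun_apply (b + b') x"
      by (simp add: blinfun.bilinear_simps blinfun_compose_bilinear algebra_simps)
  qed
  have P_scale: "P (cscale_op c a) (cscale_op c b)" if "P a b" for a b c
    unfolding P_def
  proof
    fix x
    from that have "(\<lambda>M. cscale c (blinfun_apply ((F M o\<^sub>L a) - (a o\<^sub>L F M)) x)) \<longlonglongrightarrow> cscale c (blinfun_apply b x)"
      unfolding P_def by (intro bounded_linear.tendsto[OF bounded_linear_cscale]) auto
    then show "(\<lambda>M. blinfun_apply ((F M o\<^sub>L cscale_op c a) - (cscale_op c a o\<^sub>L F M)) x) \<longlonglongrightarrow> blinfun_apply (cscale_op c b) x"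
      using BDT_alg_clinear[OF N F_alg] by (simp add: blinfun.diff_left cscale_diff_right clinear_op_def)
  qed
  have P_mult: "P (a o\<^sub>L a') ((b o\<^sub>L a') + (a o\<^sub>L b'))" if "P a b" "P a' b'" for a a' b b'
    unfolding P_def
  proof
    fix x
    have "(\<lambda>M. blinfun_apply ((F M o\<^sub>L a) - (a o\<^sub>L F M)) (blinfun_apply a' x))
        \<longlonglongrightarrow> blinfun_apply b (blinfun_apply a' x)"
      using that(1) unfolding P_def by blast
    moreover have "(\<lambda>M. blinfun_apply a (blinfun_apply ((F M o\<^sub>L a') - (a' o\<^sub>L F M)) x))
        \<longlonglongrightarrow> blinfun_apply a (blinfun_apply b' x)"
      using that(2) unfolding P_def by (intro bounded_linear.tendsto[OF blinfun.bounded_linear_right]) blast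
    ultimately have "(\<lambda>M. blinfun_apply ((F M o\<^sub>L a) - (a o\<^sub>L F M)) (blinfun_apply a' x) +
        blinfun_apply a (blinfun_apply ((F M o\<^sub>L a') - (a' o\<^sub>L F M)) x))
        \<longlonglongrightarrow> blinfun_apply b (blinfun_apply a' x) + blinfun_apply a (blinfun_apply b' x)"
      by (rule tendsto_add)
    then show "(\<lambda>M. blinfun_apply ((F M o\<^sub>L (a o\<^sub>L a')) - ((a o\<^sub>L a') o\<^sub>L F M)) x) \<longlonglongrightarrow> blinfun_apply ((b o\<^sub>L a') + (a o\<^sub>L b')) x"
      by (simp add: blinfun.bilinear_simps)
  qed
  have P_unique: "(THE b. P a b) = b" if "P a b" for a b
    using that by (intro the_equality blinfun_eqI) (auto simp: P_def intro: LIMSEQ_unique)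
  \<comment> \<open>A strong limit could leave the norm closed algebra. Its membership is therefore
    obtained from the generators, where the limits are explicit, and propagated by the Leibniz
    rule.\<close>
  have P_ex: "\<exists>b\<in>BDT_alg N. P a b" if "a \<in> BDT_poly N" for a
    using that
  proof (induction rule: BDT_poly_induct)
    case zero
    then show ?case by (intro bexI[of _ 0]) (auto simp: P_def intro: BDT_alg_intros)
  next
    case (mult a b)
    then show ?case using P_mult BDT_poly_subset_alg by (blast intro: BDT_alg_intros)
  next
    case shift
    show ?case using P_shift y(1) by (blast intro: BDT_alg_intros)
  next
    case adj
    show ?case using P_adj y(1) by (blast intro: BDT_alg_intros)
  qed (use P_add P_scale P_diag in \<open>blast intro: BDT_alg_intros\<close>)+
  define \<delta> where "\<delta> a = (THE b. P a b)" for a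
  have \<delta>: "P a (\<delta> a)" "\<delta> a \<in> BDT_alg N" if "a \<in> BDT_poly N" for a
    using P_ex[OF that] P_unique unfolding \<delta>_def by metis+
  have "derivation_in N \<delta>"
    unfolding derivation_in_def
    by (auto simp: \<delta> \<delta>_def[of "_ + _"] \<delta>_def[of "cscale_op _ _"] \<delta>_def[of "_ o\<^sub>L _"]
        intro!: P_unique P_add P_scale P_mult)
  then show ?thesis
    using that[of \<delta>] P_unique P_shift P_adj P_diag unfolding \<delta>_def by blast
qed

section \<open>Approximation by commutators\<close>

text \<open>An epsilon form, free of any derivation, of the statement that U -> U (y - t), U* -> -(y
  - t) U* is a limit of commutators. Requiring \<open>s\<close> to commute with the periodic
  diagonal makes the commutators vanish there. In this form the relation is additive and stable
  under limits in \<open>y\<close> and \<open>t\<close>.\<close>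

definition approx_by_commutators ::
    "nat \<Rightarrow> (nat ell2 \<Rightarrow>\<^sub>L nat ell2) \<Rightarrow> (nat ell2 \<Rightarrow>\<^sub>L nat ell2) \<Rightarrow> bool"
  where "approx_by_commutators N y t \<longleftrightarrow> (\<forall>e>0. \<exists>s\<in>BDT_alg N. diag_commutes N s \<and>
    norm (((s o\<^sub>L U) - (U o\<^sub>L s)) - (U o\<^sub>L (y - t))) < e \<and>
    norm (((s o\<^sub>L U') - (U' o\<^sub>L s)) + ((y - t) o\<^sub>L U')) < e)"

text \<open>Averaging over \<open>z \<mapsto> U\<^sup>* z U\<close> telescopes the commutator part and fixes \<open>t\<close>.\<close>

lemma shift_invariant_norm_le:
  assumes t: "U' o\<^sub>L t o\<^sub>L U = t"
    and le: "norm (((s o\<^sub>L U) - (U o\<^sub>L s)) - (U o\<^sub>L (y - t))) \<le> e"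
  shows "norm t \<le> norm y + e"
proof -
  define c where "c z = U' o\<^sub>L z o\<^sub>L U" for z
  have c_norm: "norm (c z) \<le> norm z" for z
    unfolding c_def using norm_compose_le1[OF norm_shift_le(2)] norm_compose_le1[OF norm_shift_le(1)]
    by (meson order_trans)
  have c_simps: "c (x + z) = c x + c z" "c (x - z) = c x - c z" "c (r *\<^sub>R z) = r *\<^sub>R c z" for x z r
    by (simp_all add: c_def blinfun_compose_bilinear)
  define W where "W = U' o\<^sub>L (((s o\<^sub>L U) - (U o\<^sub>L s)) - (U o\<^sub>L (y - t)))"
  have W: "norm W \<le> e"
    unfolding W_def using norm_compose_le1(1)[OF norm_shift_le(2)] le by (meson order_trans)
  \<comment> \<open>Multiplying the approximate commutator equation by U* on the left turns its
    commutator into \<open>c s - s\<close> and U (y - t) into y - t; \<open>W\<close> is the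
    error.\<close>
  have cs: "c s = s + y - t + W"
    by (simp add: W_def c_def blinfun_compose_bilinear adj_shift_shift' compose_assoc)
  have ct: "c t = t" using t by (simp add: c_def)
  \<comment> \<open>\<open>Z\<close> collects the M contributions of \<open>y\<close> and of the
    error. Each has norm at most \<open>norm y + e\<close>, because \<open>c\<close> is a
    contraction, while \<open>t\<close> accumulates exactly as it is fixed by
    \<open>c\<close>.\<close>
  have "\<exists>Z. norm Z \<le> real M * (norm y + e) \<and> (c ^^ M) s = s + Z - real M *\<^sub>R t" for M
  proof (induction M)
    case 0
    show ?case by (intro exI[of _ 0]) simp
  next
    case (Suc M)
    then obtain Z where Z: "norm Z \<le> real M * (norm y + e)" "(c ^^ M) s = s + Z - real M *\<^sub>R t"
      by blast
    have "(c ^^ Suc M) s = s + (y + W + c Z) - real (Suc M) *\<^sub>R t"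
      by (simp add: Z(2) c_simps cs ct algebra_simps)
    moreover have "norm (y + W + c Z) \<le> norm y + e + real M * (norm y + e)"
      by (intro norm_triangle_le[OF add_mono] norm_triangle_le W order_trans[OF c_norm Z(1)] order_refl)
    ultimately show ?case by (intro exI[of _ "y + W + c Z"]) (simp add: algebra_simps)
  qed
  note telescope = this
  have cM: "norm ((c ^^ M) s) \<le> norm s" for M
    by (induction M) (auto intro: order_trans[OF c_norm])
  have le: "real M * norm t \<le> real M * (norm y + e) + 2 * norm s" for M
  proof -
    obtain Z where Z: "norm Z \<le> real M * (norm y + e)" "(c ^^ M) s = s + Z - real M *\<^sub>R t"
      using telescope by blast
    have "norm (real M *\<^sub>R t) = norm (s + Z - (c ^^ M) s)" using Z(2) by simp
    also have "\<dots> \<le> norm s + norm Z + norm ((c ^^ M) s)"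
      by (intro order_trans[OF norm_triangle_ineq4] add_mono norm_triangle_ineq order_refl)
    finally show ?thesis using Z(1) cM[of M] by simp
  qed
  show ?thesis
  proof (rule ccontr)
    assume "\<not> ?thesis"
    then have d: "norm t - (norm y + e) > 0" by simp
    obtain M :: nat where "2 * norm s / (norm t - (norm y + e)) < real M"
      using reals_Archimedean2 by blast
    then have "2 * norm s < real M * (norm t - (norm y + e))"
      using d by (simp add: field_simps)
    then show False using le[of M] by (simp add: algebra_simps)
  qed
qed

lemma approx_norm_le:
  assumes "approx_by_commutators N y t" "U' o\<^sub>L t o\<^sub>L U = t"
  shows "norm t \<le> norm y"
proof (rule field_le_epsilon)
  fix e :: real assume "e > 0"
  then obtain s where "norm (((s o\<^sub>L U) - (U o\<^sub>L s)) - (U o\<^sub>L (y - t))) < e"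
    using assms(1) unfolding approx_by_commutators_def by blast
  then show "norm t \<le> norm y + e"
    using shift_invariant_norm_le[OF assms(2)] less_imp_le by blast
qed

lemma approx_exactI:
  assumes "s \<in> BDT_alg N" "diag_commutes N s"
    "(s o\<^sub>L U) - (U o\<^sub>L s) = U o\<^sub>L (y - t)" "(s o\<^sub>L U') - (U' o\<^sub>L s) = - ((y - t) o\<^sub>L U')"
  shows "approx_by_commutators N y t"
  unfolding approx_by_commutators_def using assms by (auto intro!: bexI[of _ s])

lemma approx_add:
  assumes "approx_by_commutators N y t" "approx_by_commutators N y' t'"
  shows "approx_by_commutators N (y + y') (t + t')"
  unfolding approx_by_commutators_def
proof (intro allI impI)
  fix e :: real assume e: "e > 0"
  obtain s where s: "s \<in> BDT_alg N" "diag_commutes N s"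
    "norm (((s o\<^sub>L U) - (U o\<^sub>L s)) - (U o\<^sub>L (y - t))) < e / 2"
    "norm (((s o\<^sub>L U') - (U' o\<^sub>L s)) + ((y - t) o\<^sub>L U')) < e / 2"
    using assms(1) e unfolding approx_by_commutators_def by (meson half_gt_zero)
  obtain s' where s': "s' \<in> BDT_alg N" "diag_commutes N s'"
    "norm (((s' o\<^sub>L U) - (U o\<^sub>L s')) - (U o\<^sub>L (y' - t'))) < e / 2"
    "norm (((s' o\<^sub>L U') - (U' o\<^sub>L s')) + ((y' - t') o\<^sub>L U')) < e / 2"
    using assms(2) e unfolding approx_by_commutators_def by (meson half_gt_zero)
  show "\<exists>s\<in>BDT_alg N. diag_commutes N s \<and>
    norm (((s o\<^sub>L U) - (U o\<^sub>L s)) - (U o\<^sub>L (y + y' - (t + t')))) < e \<and>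
    norm (((s o\<^sub>L U') - (U' o\<^sub>L s)) + ((y + y' - (t + t')) o\<^sub>L U')) < e"
    using norm_add_less[OF s(3) s'(3)] norm_add_less[OF s(4) s'(4)] s(1,2) s'(1,2)
    by (intro bexI[of _ "s + s'"]) (auto simp: blinfun_compose_bilinear algebra_simps intro: BDT_alg_intros diag_commutes_intros)
qed

lemma approx_diff:
  assumes "approx_by_commutators N y t" "approx_by_commutators N y' t'"
  shows "approx_by_commutators N (y - y') (t - t')"
  unfolding approx_by_commutators_def
proof (intro allI impI)
  fix e :: real assume e: "e > 0"
  obtain s where s: "s \<in> BDT_alg N" "diag_commutes N s"
    "norm (((s o\<^sub>L U) - (U o\<^sub>L s)) - (U o\<^sub>L (y - t))) < e / 2"
    "norm (((s o\<^sub>L U') - (U' o\<^sub>L s)) + ((y - t) o\<^sub>L U')) < e / 2"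
    using assms(1) e unfolding approx_by_commutators_def by (meson half_gt_zero)
  obtain s' where s': "s' \<in> BDT_alg N" "diag_commutes N s'"
    "norm (((s' o\<^sub>L U) - (U o\<^sub>L s')) - (U o\<^sub>L (y' - t'))) < e / 2"
    "norm (((s' o\<^sub>L U') - (U' o\<^sub>L s')) + ((y' - t') o\<^sub>L U')) < e / 2"
    using assms(2) e unfolding approx_by_commutators_def by (meson half_gt_zero)
  show "\<exists>s\<in>BDT_alg N. diag_commutes N s \<and>
    norm (((s o\<^sub>L U) - (U o\<^sub>L s)) - (U o\<^sub>L (y - y' - (t - t')))) < e \<and>
    norm (((s o\<^sub>L U') - (U' o\<^sub>L s)) + ((y - y' - (t - t')) o\<^sub>L U')) < e"
    using norm_add_less[OF s(3), of "- (((s' o\<^sub>L U) - (U o\<^sub>L s')) - (U o\<^sub>L (y' - t')))" "e/2"]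
      norm_add_less[OF s(4), of "- (((s' o\<^sub>L U') - (U' o\<^sub>L s')) + ((y' - t') o\<^sub>L U'))" "e/2"]
      s(1,2) s'
    unfolding norm_minus_cancel
    by (intro bexI[of _ "s - s'"]) (auto simp: blinfun_compose_bilinear algebra_simps intro: BDT_alg_intros diag_commutes_intros)
qed

lemma approx_limit:
  assumes "\<And>n. approx_by_commutators N (y n) (t n)" "y \<longlonglongrightarrow> y0" "t \<longlonglongrightarrow> t0"
  shows "approx_by_commutators N y0 t0"
  unfolding approx_by_commutators_def
proof (intro allI impI)
  fix e :: real assume e: "e > 0"
  have "(\<lambda>n. y n - t n) \<longlonglongrightarrow> y0 - t0" by (intro tendsto_diff assms)
  then obtain n where n: "norm ((y n - t n) - (y0 - t0)) < e / 2"
    using LIMSEQ_D[of "\<lambda>n. y n - t n" "y0 - t0" "e / 2"] e by auto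
  obtain s where s: "s \<in> BDT_alg N" "diag_commutes N s"
    "norm (((s o\<^sub>L U) - (U o\<^sub>L s)) - (U o\<^sub>L (y n - t n))) < e / 2"
    "norm (((s o\<^sub>L U') - (U' o\<^sub>L s)) + ((y n - t n) o\<^sub>L U')) < e / 2"
    using assms(1)[of n] e unfolding approx_by_commutators_def by (meson half_gt_zero)
  let ?z = "(y n - t n) - (y0 - t0)"
  have z: "norm (U o\<^sub>L ?z) < e / 2" "norm (- (?z o\<^sub>L U')) < e / 2"
    using norm_compose_le1(1)[OF norm_shift_le(1), of ?z] norm_compose_le1(2)[OF norm_shift_le(2), of ?z] n
    unfolding norm_minus_cancel by linarith+
  show "\<exists>s\<in>BDT_alg N. diag_commutes N s \<and>
    norm (((s o\<^sub>L U) - (U o\<^sub>L s)) - (U o\<^sub>L (y0 - t0))) < e \<and>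
    norm (((s o\<^sub>L U') - (U' o\<^sub>L s)) + ((y0 - t0) o\<^sub>L U')) < e"
    using norm_add_less[OF s(3) z(1)] norm_add_less[OF s(4) z(2)] s(1,2)
    by (intro bexI[of _ s]) (auto simp: blinfun_compose_bilinear algebra_simps)
qed

definition splits_off_toeplitz :: "nat \<Rightarrow> (nat ell2 \<Rightarrow>\<^sub>L nat ell2) \<Rightarrow> bool"
  where "splits_off_toeplitz N y \<longleftrightarrow> (\<exists>t\<in>toeplitz_fun N ` C_circle. approx_by_commutators N y t)"

lemma splits_off_toeplitz_add:
  assumes "splits_off_toeplitz N y" "splits_off_toeplitz N y'"
  shows "splits_off_toeplitz N (y + y')"
proof -
  obtain f g where fg: "f \<in> C_circle" "approx_by_commutators N y (toeplitz_fun N f)"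
    "g \<in> C_circle" "approx_by_commutators N y' (toeplitz_fun N g)"
    using assms unfolding splits_off_toeplitz_def by blast
  have "approx_by_commutators N (y + y') (toeplitz_fun N (\<lambda>x. f x + g x))"
    unfolding toeplitz_fun_add[OF fg(1,3)] by (intro approx_add fg)
  then show ?thesis
    unfolding splits_off_toeplitz_def using C_circle_intros(4)[OF fg(1,3)] by blast
qed

text \<open>\<open>approx_norm_le\<close> for differences makes the chosen Toeplitz parts Cauchy
  whenever the \<open>y n\<close> are, and the closed range gives their limit a continuous
  symbol.\<close>

lemma closed_splits_off_toeplitz:
  assumes N: "N > 0"
  shows "closed {y. splits_off_toeplitz N y}"
  unfolding closed_sequential_limits
proof (intro allI impI, elim conjE)
  fix y y0 assume y: "\<forall>n. y n \<in> {y. splits_off_toeplitz N y}" and lim: "y \<longlonglongrightarrow> y0"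
  have "\<exists>f. \<forall>n. f n \<in> C_circle \<and> approx_by_commutators N (y n) (toeplitz_fun N (f n))"
    by (rule choice) (use y in \<open>auto simp: splits_off_toeplitz_def\<close>)
  then obtain f where f: "\<And>n. f n \<in> C_circle" "\<And>n. approx_by_commutators N (y n) (toeplitz_fun N (f n))"
    by blast
  let ?t = "\<lambda>n. toeplitz_fun N (f n)"
  have le: "norm (?t m - ?t n) \<le> norm (y m - y n)" for m n
    by (rule approx_norm_le[OF approx_diff[OF f(2) f(2)]])
      (use f(1) in \<open>simp add: toeplitz_fun_shift_invariant blinfun_compose_bilinear\<close>)
  have "Cauchy ?t"
  proof (rule CauchyI)
    fix e :: real assume "e > 0"
    then obtain M where "\<And>m n. m \<ge> M \<Longrightarrow> n \<ge> M \<Longrightarrow> norm (y m - y n) < e"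
      using CauchyD[OF LIMSEQ_imp_Cauchy[OF lim]] by blast
    then show "\<exists>M. \<forall>m\<ge>M. \<forall>n\<ge>M. norm (?t m - ?t n) < e"
      using le le_less_trans by blast
  qed
  then obtain t where t: "?t \<longlonglongrightarrow> t" by (meson Cauchy_convergent convergent_def)
  have "t \<in> toeplitz_fun N ` C_circle"
    by (rule closed_sequentially[OF closed_range_toeplitz_fun[OF N] _ t]) (use f(1) in blast)
  moreover have "approx_by_commutators N y0 t"
    by (rule approx_limit[OF f(2) lim t])
  ultimately show "y0 \<in> {y. splits_off_toeplitz N y}"
    unfolding splits_off_toeplitz_def by blast
qed

section \<open>Solving the commutator equation for a single weighted shift\<close>

lemma eventually_periodic_partial_sums:
  assumes N: "N > 0" and a: "eventually_periodic N a"
  obtains m where "\<And>k0. eventually_periodic N (\<lambda>k. \<Sum>i=k0..<k. a i - m)"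
proof -
  obtain L where L: "\<And>k. k \<ge> L \<Longrightarrow> a (k + N) = a k"
    using a by (auto simp: eventually_periodic_def)
  define A where "A = (\<Sum>i=L..<L + N. a i)"
  have A: "(\<Sum>i=k..<k + N. a i) = A" if "k \<ge> L" for k
    using that
  proof (induction k rule: dec_induct)
    case (step k)
    have "(\<Sum>i=k..<k + N. a i) = a k + (\<Sum>i=Suc k..<k + N. a i)"
      using N by (simp add: sum.atLeast_Suc_lessThan)
    moreover have "(\<Sum>i=Suc k..<Suc k + N. a i) = (\<Sum>i=Suc k..<k + N. a i) + a (k + N)"
      using N by (simp add: sum.atLeastLessThan_Suc)
    ultimately show ?case using step L[of k] by (simp add: algebra_simps)
  qed (simp add: A_def)
  \<comment> \<open>\<open>A / of_nat N\<close> is the mean over a period, so each window of N terms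
    past the threshold contributes zero to the partial sums.\<close>
  have "eventually_periodic N (\<lambda>k. \<Sum>i=k0..<k. a i - A / of_nat N)" for k0
  proof -
    have "(\<Sum>i=k0..<k + N. a i - A / of_nat N) = (\<Sum>i=k0..<k. a i - A / of_nat N)" if "k \<ge> max L k0" for k
    proof -
      have "(\<Sum>i=k0..<k + N. a i - A / of_nat N) =
          (\<Sum>i=k0..<k. a i - A / of_nat N) + (\<Sum>i=k..<k + N. a i - A / of_nat N)"
        using that by (intro sum.atLeastLessThan_concat[symmetric]) auto
      then show ?thesis using A[of k] that N by (simp add: sum_subtractf)
    qed
    then show ?thesis unfolding eventually_periodic_def by blast
  qed
  then show ?thesis using that by blast
qed

lemma toeplitz_fun_monom: "toeplitz_fun N (\<lambda>t. c * cis (of_int j * t)) = wshift (j * int N) (\<lambda>_. c)"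
  using toeplitz_fun_laurent[OF laurent.monom] toeplitz_bshift by metis

text \<open>For s = U^n \<sigma>(K) the commutator s U - U s has weight \<sigma>(k+1) - \<sigma>(k),
  apart from boundary terms. The equation to solve is \<sigma>(k+1) - \<sigma>(k) = a(k) - m, and
  the Toeplitz part left over is m U^n.\<close>

lemma splits_off_toeplitz_wshift:
  assumes N: "N > 0" and a: "eventually_periodic N a"
  shows "splits_off_toeplitz N (wshift (j * int N) a)"
proof -
  obtain m where m: "\<And>k0. eventually_periodic N (\<lambda>k. \<Sum>i=k0..<k. a i - m)"
    using eventually_periodic_partial_sums[OF N a] by blast
  define n where "n = j * int N"
  \<comment> \<open>The first index that U^n does not annihilate. Starting the sum there makes
    \<sigma> vanish at the boundary, where only one of the two products in the commutator has a
    nonzero cut-off.\<close>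
  define k0 where "k0 = nat (- n)"
  define \<sigma> where "\<sigma> k = (\<Sum>i=k0..<k. a i - m)" for k
  have \<sigma>: "eventually_periodic N \<sigma>" using m[of k0] unfolding \<sigma>_def .
  have \<sigma>_Suc: "\<sigma> (Suc k) = \<sigma> k + (a k - m)" if "k \<ge> k0" for k
    using that by (simp add: \<sigma>_def)
  have \<sigma>_0: "\<sigma> k = 0" if "k \<le> k0" for k
    using that by (simp add: \<sigma>_def)
  note bd = eventually_periodic_bounded[OF N a] eventually_periodic_bounded[OF N \<sigma>]
  note coords = coord_wshift[OF bd(1)] coord_wshift[OF bd(2)] coord_wshift[OF bounded_range_const]
    coord_unilateral_shift coord_adj_unilateral_shift
  let ?s = "wshift n \<sigma>" and ?z = "wshift n a - wshift n (\<lambda>_. m)"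
  have "approx_by_commutators N (wshift n a) (wshift n (\<lambda>_. m))"
  proof (rule approx_exactI)
    show "?s \<in> BDT_alg N"
      using wshift_in_BDT_poly[OF N \<sigma>] BDT_poly_subset_alg by blast
    show "diag_commutes N ?s"
      unfolding n_def by (rule wshift_diag_commutes[OF N bd(2)])
    show "(?s o\<^sub>L U) - (U o\<^sub>L ?s) = U o\<^sub>L ?z"
    proof (rule blinfun_coord_eqI)
      fix x i
      let ?k = "nat (int i - n - 1)"
      consider "i = 0" "n < 0" | "i = 0" "n \<ge> 0" | "i > 0" "n < int i" | "i > 0" "n \<ge> int i" by linarith
      then show "coord (blinfun_apply ((?s o\<^sub>L U) - (U o\<^sub>L ?s)) x) i = coord (blinfun_apply (U o\<^sub>L ?z) x) i"
      proof cases
        case 1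
        then show ?thesis
          using \<sigma>_0[of "nat (- n)"] by (simp add: blinfun.diff_left coords k0_def)
      next
        case 3
        then have "nat (int i - n) = Suc ?k" "nat (int (i - 1) - n) = ?k" "k0 \<le> ?k"
          by (auto simp: k0_def)
        then show ?thesis
          using 3 arg_cong[OF \<sigma>_Suc[of ?k], of "\<lambda>z. z * coord x ?k"]
          by (simp add: blinfun.diff_left coords algebra_simps)
      qed (simp_all add: blinfun.diff_left coords)
    qed
    show "(?s o\<^sub>L U') - (U' o\<^sub>L ?s) = - (?z o\<^sub>L U')"
    proof (rule blinfun_coord_eqI)
      fix x i
      let ?k = "nat (int i - n)"
      consider "n \<le> int i" | "n = int i + 1" | "n > int i + 1" by linarith
      then show "coord (blinfun_apply ((?s o\<^sub>L U') - (U' o\<^sub>L ?s)) x) i = coord (blinfun_apply (- (?z o\<^sub>L U')) x) i"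
      proof cases
        case 1
        then have "nat (int (Suc i) - n) = Suc ?k" "k0 \<le> ?k" by (auto simp: k0_def)
        then show ?thesis
          using 1 arg_cong[OF \<sigma>_Suc[of ?k], of "\<lambda>z. z * coord x (Suc ?k)"]
          by (simp add: blinfun.diff_left blinfun.minus_left coords algebra_simps del: of_nat_Suc)
      next
        case 2
        then show ?thesis
          using \<sigma>_0[of 0] by (simp add: blinfun.diff_left blinfun.minus_left coords)
      qed (simp_all add: blinfun.diff_left blinfun.minus_left coords)
    qed
  qed
  then show ?thesis
    unfolding splits_off_toeplitz_def n_def
    using toeplitz_fun_monom[of N m j] C_circle_intros(7)[OF C_circle_intros(1), of m j] by (metis imageI)
qed

section \<open>The conditional expectation given by the residue projections\<close>

definition residue_proj :: "nat \<Rightarrow> nat \<Rightarrow> (nat ell2 \<Rightarrow>\<^sub>L nat ell2)"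
  where "residue_proj N r = wshift 0 (\<lambda>k. if k mod N = r then 1 else 0)"

lemma coord_residue_proj:
  "coord (blinfun_apply (residue_proj N r) x) i = (if i mod N = r then coord x i else 0)"
proof -
  have "bounded (range (\<lambda>k. if k mod N = r then 1 else 0 :: complex))"
    by (rule boundedI[where B = 1]) auto
  from coord_wshift[OF this] show ?thesis by (simp add: residue_proj_def)
qed

lemma residue_proj_in_diag_per: "N > 0 \<Longrightarrow> residue_proj N r \<in> diag_per N"
  by (auto simp: diag_per_eq residue_proj_def)

lemma residue_proj_mult:
  "residue_proj N r o\<^sub>L residue_proj N q = (if r = q then residue_proj N r else 0)"
  by (rule blinfun_coord_eqI) (simp add: coord_residue_proj)

lemma coord_sum_apply: "coord (blinfun_apply (sum f A) x) i = (\<Sum>j\<in>A. coord (blinfun_apply (f j) x) i)"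
  by (simp add: blinfun.sum_left coord_sum)

lemma diag_per_expand:
  assumes N: "N > 0" and D: "D \<in> diag_per N"
  obtains a where "D = (\<Sum>r<N. cscale_op (a r) (residue_proj N r))"
proof -
  obtain a where a: "D = wshift 0 a" "\<forall>k. a (k + N) = a k"
    using D by (auto simp: diag_per_eq[OF N])
  have "a (i mod N) = a i" for i
    using eventually_periodic_mult_period[of 0 a N "i mod N" "i div N"] a(2) by simp
  then have "D = (\<Sum>r<N. cscale_op (a r) (residue_proj N r))"
    using N by (intro blinfun_coord_eqI)
      (simp add: a(1) coord_sum_apply coord_wshift periodic_bounded[OF N a(2)] coord_residue_proj if_distrib cong: if_cong)
  then show ?thesis using that by blast
qed

lemma sum_residue_proj:
  assumes N: "N > 0" shows "(\<Sum>r<N. residue_proj N r) = id_blinfun"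
  using N by (intro blinfun_coord_eqI) (simp add: coord_sum_apply coord_residue_proj)

text \<open>Compression to the N diagonal blocks. It is norm continuous and replaces approximants
  that do not commute with the periodic diagonal by block diagonal ones.\<close>

definition diag_expectation :: "nat \<Rightarrow> (nat ell2 \<Rightarrow>\<^sub>L nat ell2) \<Rightarrow> (nat ell2 \<Rightarrow>\<^sub>L nat ell2)"
  where "diag_expectation N x = (\<Sum>r<N. residue_proj N r o\<^sub>L x o\<^sub>L residue_proj N r)"

lemma diag_expectation_fixes:
  assumes N: "N > 0" and y: "diag_commutes N y"
  shows "diag_expectation N y = y"
proof -
  have "residue_proj N r o\<^sub>L y o\<^sub>L residue_proj N r = y o\<^sub>L residue_proj N r" for r
  proof -
    have "residue_proj N r o\<^sub>L y = y o\<^sub>L residue_proj N r"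
      using y residue_proj_in_diag_per[OF N] by (simp add: diag_commutes_def)
    then show ?thesis by (simp add: compose_assoc residue_proj_mult)
  qed
  then have "diag_expectation N y = y o\<^sub>L (\<Sum>r<N. residue_proj N r)"
    by (simp add: diag_expectation_def blinfun_compose_bilinear)
  then show ?thesis by (simp add: sum_residue_proj[OF N])
qed

text \<open>A shift by n carries residue class r to r + n modulo N, so it meets the diagonal blocks
  entirely or not at all.\<close>

lemma diag_expectation_wshift:
  assumes N: "N > 0" and b: "bounded (range a)"
  shows "diag_expectation N (wshift n a) = (if int N dvd n then wshift n a else 0)"
proof (rule blinfun_coord_eqI)
  fix x i
  let ?k = "nat (int i - n)"
  have "coord (blinfun_apply (diag_expectation N (wshift n a)) x) i =
      (\<Sum>r<N. if i mod N = r then (if n \<le> int i \<and> ?k mod N = i mod N then a ?k * coord x ?k else 0) else 0)"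
    unfolding diag_expectation_def coord_sum_apply
    by (intro sum.cong) (auto simp: coord_residue_proj coord_wshift[OF b])
  also have "\<dots> = (if n \<le> int i \<and> ?k mod N = i mod N then a ?k * coord x ?k else 0)"
    using N by simp
  also have "n \<le> int i \<and> ?k mod N = i mod N \<longleftrightarrow> n \<le> int i \<and> int N dvd n"
  proof -
    have "?k mod N = i mod N \<longleftrightarrow> int N dvd n" if "n \<le> int i"
    proof -
      have "?k mod N = i mod N \<longleftrightarrow> (int i - n) mod int N = int i mod int N"
        using that by (metis diff_ge_0_iff_ge nat_0_le of_nat_eq_iff zmod_int)
      also have "\<dots> \<longleftrightarrow> int N dvd n"
        by (simp add: mod_eq_dvd_iff)
      finally show ?thesis .
    qed
    then show ?thesis by blast
  qed
  finally show "coord (blinfun_apply (diag_expectation N (wshift n a)) x) i =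
      coord (blinfun_apply (if int N dvd n then wshift n a else 0) x) i"
    by (simp add: coord_wshift[OF b])
qed

lemma splits_off_toeplitz_expectation:
  assumes N: "N > 0" and "x \<in> band N"
  shows "splits_off_toeplitz N (diag_expectation N x)"
  using assms(2)
proof induction
  case (wshift a n)
  have 0: "splits_off_toeplitz N 0"
    using splits_off_toeplitz_wshift[OF N eventually_periodic_const, of 0 0] by (simp add: wshift_zero)
  have "splits_off_toeplitz N (wshift n a)" if "int N dvd n"
    using splits_off_toeplitz_wshift[OF N wshift] that by (metis dvd_def mult.commute)
  with 0 show ?case
    by (simp add: diag_expectation_wshift[OF N eventually_periodic_bounded[OF N wshift]])
next
  case (add x y)
  have "diag_expectation N (x + y) = diag_expectation N x + diag_expectation N y"
    by (simp add: diag_expectation_def blinfun_compose_bilinear sum.distrib)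
  then show ?case using splits_off_toeplitz_add[OF add.IH] by simp
qed

text \<open>Polynomials approximating \<open>y\<close> may contain shifts by arbitrary steps. The
  expectation fixes \<open>y\<close> and discards every step not divisible by N, leaving
  approximants that split.\<close>

lemma splits_off_toeplitz_diag_commutes:
  assumes N: "N > 0" and y: "y \<in> BDT_alg N" "diag_commutes N y"
  shows "splits_off_toeplitz N y"
proof -
  obtain x where x: "\<And>n. x n \<in> BDT_poly N" "x \<longlonglongrightarrow> y"
    using y(1) closure_BDT_poly[OF N] closure_sequential by blast
  have "(\<lambda>n. diag_expectation N (x n)) \<longlonglongrightarrow> diag_expectation N y"
    unfolding diag_expectation_def
    by (intro tendsto_sum bounded_bilinear.tendsto[OF bounded_bilinear_blinfun_compose] tendsto_const x)
  then have "(\<lambda>n. diag_expectation N (x n)) \<longlonglongrightarrow> y"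
    by (simp add: diag_expectation_fixes[OF N y(2)])
  then have "y \<in> {y. splits_off_toeplitz N y}"
    by (rule closed_sequentially[OF closed_splits_off_toeplitz[OF N], rotated])
      (use splits_off_toeplitz_expectation[OF N] x(1) BDT_poly_subset_band[OF N] in blast)
  then show ?thesis by simp
qed

section \<open>The decomposition of a derivation\<close>

lemma derivation_sum:
  assumes d: "derivation_in N d" and "\<And>i. i \<in> I \<Longrightarrow> f i \<in> BDT_poly N"
  shows "d (sum f I) = (\<Sum>i\<in>I. d (f i))"
proof -
  have "sum f I \<in> BDT_poly N \<and> d (sum f I) = (\<Sum>i\<in>I. d (f i))"
    using assms(2) by (induction I rule: infinite_finite_induct)
      (auto simp: derivation_zero[OF d] derivationD(2)[OF d] intro: BDT_poly_intros)
  then show ?thesis by blast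
qed

lemma diag_commutes_compose:
  assumes "diag_commutes N x" "diag_commutes N y"
  shows "diag_commutes N (x o\<^sub>L y)"
  using assms unfolding diag_commutes_def by (metis compose_assoc)

lemma diag_commutes_id: "diag_commutes N id_blinfun"
  by (simp add: diag_commutes_def)

lemma id_in_diag_per: "N > 0 \<Longrightarrow> id_blinfun \<in> diag_per N"
  by (auto simp: diag_per_eq simp flip: wshift_id)

text \<open>The usual averaging argument for an algebra spanned by orthogonal projections e_r of sum
  1, with b = sum of d(e_r) e_r. Differentiating e_q e_r gives e_q b = d(e_q) e_q - d(e_q), while b
  e_q = d(e_q) e_q; hence the commutator of b with e_q is d(e_q).\<close>

lemma derivation_inner_on_diag:
  assumes N: "N > 0" and d: "derivation_in N d"
  obtains b where "b \<in> BDT_alg N" "\<And>D. D \<in> diag_per N \<Longrightarrow> d D = (b o\<^sub>L D) - (D o\<^sub>L b)"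
proof -
  let ?e = "residue_proj N"
  define b where "b = (\<Sum>r<N. d (?e r) o\<^sub>L ?e r)"
  have e: "?e r \<in> BDT_poly N" for r
    using residue_proj_in_diag_per[OF N] BDT_poly_intros(3) by blast
  have b: "b \<in> BDT_alg N"
    unfolding b_def using e derivationD(1)[OF d] BDT_poly_subset_alg
    by (intro BDT_alg_sum BDT_alg_intros(10)) auto
  let ?\<delta> = "\<lambda>a. d a - ((b o\<^sub>L a) - (a o\<^sub>L b))"
  have \<delta>: "derivation_in N ?\<delta>"
    by (intro derivation_diff d derivation_commutator[OF N b])
  have vanish: "?\<delta> (?e q) = 0" if q: "q < N" for q
  proof -
    have "?e q o\<^sub>L d (?e r) = d (?e q o\<^sub>L ?e r) - (d (?e q) o\<^sub>L ?e r)" for r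
      using derivationD(4)[OF d e e] by simp
    then have "?e q o\<^sub>L (d (?e r) o\<^sub>L ?e r) = (if r = q then d (?e q) o\<^sub>L ?e q else 0) - (d (?e q) o\<^sub>L ?e r)" for r
      by (simp add: compose_assoc[symmetric] blinfun_compose_bilinear residue_proj_mult derivation_zero[OF d])
        (simp add: compose_assoc residue_proj_mult)
    then have "?e q o\<^sub>L b = (d (?e q) o\<^sub>L ?e q) - (d (?e q) o\<^sub>L (\<Sum>r<N. ?e r))"
      using q by (simp add: b_def blinfun_compose_bilinear sum_subtractf)
    moreover have "b o\<^sub>L ?e q = d (?e q) o\<^sub>L ?e q"
    proof -
      have "b o\<^sub>L ?e q = (\<Sum>r<N. if r = q then d (?e q) o\<^sub>L ?e q else 0)"
        unfolding b_def blinfun_compose_bilinear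
        by (intro sum.cong) (auto simp: compose_assoc residue_proj_mult)
      then show ?thesis using q by simp
    qed
    ultimately show ?thesis by (simp add: sum_residue_proj[OF N])
  qed
  have vanish_scaled: "?\<delta> (cscale_op c (?e q)) = 0" if "q < N" for c q
  proof -
    have "cscale_op c (0 :: nat ell2 \<Rightarrow>\<^sub>L nat ell2) = 0" by (rule blinfun_eqI) simp
    then show ?thesis
      unfolding derivationD(3)[OF \<delta> e] vanish[OF that] .
  qed
  have "?\<delta> D = 0" if D: "D \<in> diag_per N" for D
  proof -
    obtain a where "D = (\<Sum>r<N. cscale_op (a r) (?e r))"
      using diag_per_expand[OF N D] .
    then have "?\<delta> D = (\<Sum>r<N. ?\<delta> (cscale_op (a r) (?e r)))"
      using derivation_sum[OF \<delta>, of "{..<N}" "\<lambda>r. cscale_op (a r) (?e r)"] BDT_poly_intros(6)[OF e] by simp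
    then show ?thesis
      using vanish_scaled by simp
  qed
  then show ?thesis using that[OF b] by simp
qed

text \<open>After subtracting the part that is inner on the diagonal, the images \<open>X\<close> of
  U and \<open>X'\<close> of U* satisfy X' U = - U* X. Two defects remain, P X and X' P with P = 1 -
  U U*, and a single commutator absorbs both.\<close>

lemma derivation_normal_form:
  assumes N: "N > 0" and d: "derivation_in N d"
  obtains s y where "s \<in> BDT_alg N" "y \<in> BDT_alg N" "diag_commutes N y"
    "\<And>D. D \<in> diag_per N \<Longrightarrow> d D = (s o\<^sub>L D) - (D o\<^sub>L s)"
    "d U = ((s o\<^sub>L U) - (U o\<^sub>L s)) + (U o\<^sub>L y)"
    "d U' = ((s o\<^sub>L U') - (U' o\<^sub>L s)) - (y o\<^sub>L U')"
proof -
  obtain b where b: "b \<in> BDT_alg N" "\<And>D. D \<in> diag_per N \<Longrightarrow> d D = (b o\<^sub>L D) - (D o\<^sub>L b)"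
    using derivation_inner_on_diag[OF N d] by blast
  define \<delta> where "\<delta> a = d a - ((b o\<^sub>L a) - (a o\<^sub>L b))" for a
  have \<delta>: "derivation_in N \<delta>"
    unfolding \<delta>_def by (intro derivation_diff d derivation_commutator[OF N b(1)])
  have \<delta>_diag: "\<delta> D = 0" if "D \<in> diag_per N" for D
    using b(2)[OF that] by (simp add: \<delta>_def)
  define X where "X = \<delta> U"
  define X' where "X' = \<delta> U'"
  have X_alg: "X \<in> BDT_alg N" "X' \<in> BDT_alg N"
    unfolding X_def X'_def by (intro derivationD(1)[OF \<delta>] BDT_poly_intros)+
  have "(X' o\<^sub>L U) + (U' o\<^sub>L X) = 0"
    using derivationD(4)[OF \<delta>, of U' U] \<delta>_diag[OF id_in_diag_per[OF N]]
    by (simp add: BDT_poly_intros adj_shift_shift X_def X'_def)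
  then have rel: "X' o\<^sub>L U = - (U' o\<^sub>L X)"
    by (simp add: eq_neg_iff_add_eq_0)
  then have rel': "X' o\<^sub>L (U o\<^sub>L z) = - (U' o\<^sub>L (X o\<^sub>L z))" for z
    by (simp add: compose_assoc[symmetric] blinfun_compose_bilinear)
  \<comment> \<open>As \<open>\<delta>\<close> kills the diagonal, applying it to D U = U D' shows
    that \<open>X\<close> passes the diagonal exactly as U does. Hence a product of one U-like and
    one U*-like factor commutes with the periodic diagonal.\<close>
  have X_past: "D o\<^sub>L X = X o\<^sub>L D'" if "D \<in> diag_per N" "D' \<in> diag_per N" "D o\<^sub>L U = U o\<^sub>L D'" for D D'
    using derivationD(4)[OF \<delta>, of D U] derivationD(4)[OF \<delta>, of U D'] \<delta>_diag that
    by (simp add: BDT_poly_intros X_def)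
  have X'_past: "X' o\<^sub>L D = D' o\<^sub>L X'" if "D \<in> diag_per N" "D' \<in> diag_per N" "U' o\<^sub>L D = D' o\<^sub>L U'" for D D'
    using derivationD(4)[OF \<delta>, of U' D] derivationD(4)[OF \<delta>, of D' U'] \<delta>_diag that
    by (simp add: BDT_poly_intros X'_def)
  have "diag_commutes N (A o\<^sub>L B)"
    if "A \<in> {U, X}" "B \<in> {U', X'}" for A B
    unfolding diag_commutes_def
  proof
    fix D assume D: "D \<in> diag_per N"
    obtain D' where D': "D' \<in> diag_per N" "D o\<^sub>L U = U o\<^sub>L D'" "U' o\<^sub>L D = D' o\<^sub>L U'"
      using diag_past_shift[OF N D] .
    have "D o\<^sub>L A = A o\<^sub>L D'" "B o\<^sub>L D = D' o\<^sub>L B"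
      using that D' X_past[OF D D'(1,2)] X'_past[OF D D'(1,3)] by auto
    then show "(A o\<^sub>L B) o\<^sub>L D = D o\<^sub>L (A o\<^sub>L B)" by (metis compose_assoc)
  qed
  then have comm: "diag_commutes N (U o\<^sub>L U')" "diag_commutes N (X o\<^sub>L U')" "diag_commutes N (U o\<^sub>L X')"
    by simp_all
  have comm': "diag_commutes N (U' o\<^sub>L X)"
    unfolding diag_commutes_def
  proof
    fix D assume D: "D \<in> diag_per N"
    obtain D' where D': "D' \<in> diag_per N" "U o\<^sub>L D = D' o\<^sub>L U" "D o\<^sub>L U' = U' o\<^sub>L D'"
      using shift_past_diag[OF N D] .
    show "(U' o\<^sub>L X) o\<^sub>L D = D o\<^sub>L (U' o\<^sub>L X)"
      using X_past[OF D'(1) D D'(2)[symmetric]] D'(3) by (metis compose_assoc)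
  qed
  define P where "P = id_blinfun - (U o\<^sub>L U')"
  \<comment> \<open>From P U = 0 and U* P = 0 follow c U = P X and U* c = - X' P, precisely the two
    defects. Adding \<open>c\<close> to \<open>y\<close> below cancels the remaining terms U c and c
    U*.\<close>
  define c where "c = (P o\<^sub>L (X o\<^sub>L U')) - ((U o\<^sub>L X') o\<^sub>L P)"
  have P: "P \<in> BDT_alg N" "diag_commutes N P"
    unfolding P_def using BDT_alg_intros(3)[OF id_in_diag_per[OF N]]
    by (auto intro!: BDT_alg_intros(1,2,6,10) diag_commutes_intros diag_commutes_id comm)
  have c: "c \<in> BDT_alg N" "diag_commutes N c"
    unfolding c_def using P X_alg
    by (auto intro!: BDT_alg_intros(1,2,6,10) diag_commutes_intros diag_commutes_compose comm)
  define y where "y = (U' o\<^sub>L X) + c"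
  have y: "y \<in> BDT_alg N" "diag_commutes N y"
    unfolding y_def using c X_alg by (auto intro!: BDT_alg_intros(1,2,5,10) diag_commutes_intros comm')
  have dS: "X = ((c o\<^sub>L U) - (U o\<^sub>L c)) + (U o\<^sub>L y)"
    by (simp add: y_def c_def P_def blinfun_compose_bilinear compose_assoc adj_shift_shift adj_shift_shift' rel rel')
  have dS': "X' = ((c o\<^sub>L U') - (U' o\<^sub>L c)) - (y o\<^sub>L U')"
    by (simp add: y_def c_def P_def blinfun_compose_bilinear compose_assoc adj_shift_shift adj_shift_shift' rel rel')
  show ?thesis
  proof (rule that[of "b + c" y])
    show "b + c \<in> BDT_alg N" by (intro BDT_alg_intros(5) b c)
    show "d D = ((b + c) o\<^sub>L D) - (D o\<^sub>L (b + c))" if "D \<in> diag_per N" for D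
      using b(2)[OF that] c(2) that by (simp add: diag_commutes_def blinfun_compose_bilinear)
    show "d U = (((b + c) o\<^sub>L U) - (U o\<^sub>L (b + c))) + (U o\<^sub>L y)"
      using dS unfolding X_def \<delta>_def by (simp add: blinfun_compose_bilinear algebra_simps)
    show "d U' = (((b + c) o\<^sub>L U') - (U' o\<^sub>L (b + c))) - (y o\<^sub>L U')"
      using dS' unfolding X'_def \<delta>_def by (simp add: blinfun_compose_bilinear algebra_simps)
  qed (fact y)+
qed

lemma special_derivation_iff:
  "special_derivation N f d \<longleftrightarrow> derivation_in N d \<and> (\<forall>a\<in>diag_per N. d a = 0) \<and>
    d U = (1 / real N) *\<^sub>R (U o\<^sub>L toeplitz_fun N f) \<and> d U' = - ((1 / real N) *\<^sub>R (toeplitz_fun N f o\<^sub>L U'))"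
  unfolding special_derivation_def toeplitz_fun_def ..

lemma special_derivation_unique:
  assumes "special_derivation N f d" "special_derivation N f d'" "a \<in> BDT_poly N"
  shows "d a = d' a"
proof -
  note d = assms(1)[unfolded special_derivation_iff] and d' = assms(2)[unfolded special_derivation_iff]
  show ?thesis
    by (rule derivation_eq_on_generators[of N d d', OF _ _ _ _ _ assms(3)]) (simp_all add: d d')
qed

lemma decomposition_exists:
  assumes N: "N > 0" and d: "derivation_in N d"
  obtains f d\<^sub>f where "f \<in> C_circle" "special_derivation N f d\<^sub>f" "approximately_inner N (\<lambda>a. d a - d\<^sub>f a)"
proof -
  obtain s y where s: "s \<in> BDT_alg N" and y: "y \<in> BDT_alg N" "diag_commutes N y"
    and d_gen: "\<And>D. D \<in> diag_per N \<Longrightarrow> d D = (s o\<^sub>L D) - (D o\<^sub>L s)"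
    "d U = ((s o\<^sub>L U) - (U o\<^sub>L s)) + (U o\<^sub>L y)"
    "d U' = ((s o\<^sub>L U') - (U' o\<^sub>L s)) - (y o\<^sub>L U')"
    using derivation_normal_form[OF N d] by metis
  obtain g where g: "g \<in> C_circle" "approx_by_commutators N y (toeplitz_fun N g)"
    using splits_off_toeplitz_diag_commutes[OF N y] unfolding splits_off_toeplitz_def by blast
  let ?t = "toeplitz_fun N g"
  obtain d\<^sub>f where df: "derivation_in N d\<^sub>f" "\<And>D. D \<in> diag_per N \<Longrightarrow> d\<^sub>f D = 0"
    "d\<^sub>f U = U o\<^sub>L ?t" "d\<^sub>f U' = - (?t o\<^sub>L U')"
    using derivation_exists[OF N toeplitz_fun_in_BDT_alg[OF N g(1)] toeplitz_fun_diag_commutes[OF N g(1)]] by blast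
  \<comment> \<open>The factor N compensates the normalization 1/N in
    \<open>special_derivation\<close>.\<close>
  let ?f = "\<lambda>x. of_nat N * g x"
  have f: "?f \<in> C_circle" by (rule C_circle_intros(7)[OF g(1)])
  have tf: "toeplitz_fun N ?f = real N *\<^sub>R ?t"
    using toeplitz_fun_cmult[OF g(1), of N "of_nat N"] cscale_op_real[of "real N" ?t] by simp
  have special: "special_derivation N ?f d\<^sub>f"
    unfolding special_derivation_iff tf using df N by (auto simp: blinfun_compose_bilinear)
  have "\<exists>\<sigma>. \<forall>n. \<sigma> n \<in> BDT_alg N \<and> diag_commutes N (\<sigma> n) \<and>
    norm (((\<sigma> n o\<^sub>L U) - (U o\<^sub>L \<sigma> n)) - (U o\<^sub>L (y - ?t))) < inverse (real (Suc n)) \<and>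
    norm (((\<sigma> n o\<^sub>L U') - (U' o\<^sub>L \<sigma> n)) + ((y - ?t) o\<^sub>L U')) < inverse (real (Suc n))"
  proof (rule choice, rule allI)
    fix n
    have "inverse (real (Suc n)) > 0" by simp
    then show "\<exists>s. s \<in> BDT_alg N \<and> diag_commutes N s \<and>
      norm (((s o\<^sub>L U) - (U o\<^sub>L s)) - (U o\<^sub>L (y - ?t))) < inverse (real (Suc n)) \<and>
      norm (((s o\<^sub>L U') - (U' o\<^sub>L s)) + ((y - ?t) o\<^sub>L U')) < inverse (real (Suc n))"
      using g(2) unfolding approx_by_commutators_def by blast
  qed
  then obtain \<sigma> where \<sigma>: "\<And>n. \<sigma> n \<in> BDT_alg N" "\<And>n. diag_commutes N (\<sigma> n)"
    "\<And>n. norm (((\<sigma> n o\<^sub>L U) - (U o\<^sub>L \<sigma> n)) - (U o\<^sub>L (y - ?t))) < inverse (real (Suc n))"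
    "\<And>n. norm (((\<sigma> n o\<^sub>L U') - (U' o\<^sub>L \<sigma> n)) + ((y - ?t) o\<^sub>L U')) < inverse (real (Suc n))"
    by blast
  have null: "u \<longlonglongrightarrow> 0" if "\<And>n. norm (u n) < inverse (real (Suc n))" for u :: "nat \<Rightarrow> nat ell2 \<Rightarrow>\<^sub>L nat ell2"
    by (rule Lim_null_comparison[OF always_eventually LIMSEQ_inverse_real_of_nat]) (use that less_imp_le in blast)
  \<comment> \<open>\<open>s\<close> implements the exactly inner part of \<open>d\<close>, and
    \<open>\<sigma> n\<close> the approximation of the remainder attached to
    \<open>y - ?t\<close>.\<close>
  let ?d' = "\<lambda>a. d a - d\<^sub>f a" and ?s = "\<lambda>n. s + \<sigma> n"
  have d': "derivation_in N ?d'" by (rule derivation_diff[OF d df(1)])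
  have s_alg: "?s n \<in> BDT_alg N" for n by (intro BDT_alg_intros(5) s \<sigma>)
  have "approximately_inner N ?d'"
    unfolding approximately_inner_def
  proof (intro conjI exI[of _ ?s] allI ballI d' s_alg)
    fix a assume "a \<in> BDT_poly N"
    then show "(\<lambda>n. (?s n o\<^sub>L a) - (a o\<^sub>L ?s n)) \<longlonglongrightarrow> ?d' a"
    proof (rule commutator_limit_on_generators[OF N d' s_alg, rotated 3])
      show "(\<lambda>n. (?s n o\<^sub>L U) - (U o\<^sub>L ?s n)) \<longlonglongrightarrow> ?d' U"
        by (rule LIM_zero_cancel, rule Lim_transform_eventually[OF null[OF \<sigma>(3)]])
          (simp add: d_gen df blinfun_compose_bilinear algebra_simps)
      show "(\<lambda>n. (?s n o\<^sub>L U') - (U' o\<^sub>L ?s n)) \<longlonglongrightarrow> ?d' U'"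
        by (rule LIM_zero_cancel, rule Lim_transform_eventually[OF null[OF \<sigma>(4)]])
          (simp add: d_gen df blinfun_compose_bilinear algebra_simps)
      show "(\<lambda>n. (?s n o\<^sub>L D) - (D o\<^sub>L ?s n)) \<longlonglongrightarrow> ?d' D" if "D \<in> diag_per N" for D
        using that \<sigma>(2) by (simp add: d_gen df blinfun_compose_bilinear diag_commutes_def)
    qed
  qed
  then show ?thesis using that[OF f special] by blast
qed

text \<open>Comparing values at U, the difference of the two approximately inner parts sends U to -
  U t with t = T((f - g)(V^N)) / N. So U (0 - t) is a limit of commutators with U; averaging forces
  t = 0, and the lower norm bound gives f = g.\<close>

lemma decomposition_unique:
  assumes N: "N > 0" and f: "f \<in> C_circle" and g: "g \<in> C_circle"
    and special: "special_derivation N f d\<^sub>f" "special_derivation N g d\<^sub>g"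
    and inner: "approximately_inner N d'" "approximately_inner N d''"
    and eq: "\<And>a. a \<in> BDT_poly N \<Longrightarrow> d\<^sub>f a + d' a = d\<^sub>g a + d'' a"
  shows "f = g"
proof -
  let ?h = "\<lambda>x. f x - g x"
  have h: "?h \<in> C_circle" by (rule C_circle_intros(5)[OF f g])
  define t where "t = (1 / real N) *\<^sub>R toeplitz_fun N ?h"
  have t: "U' o\<^sub>L t o\<^sub>L U = t"
    using toeplitz_fun_shift_invariant[OF h, of N] by (simp add: t_def blinfun_compose_bilinear)
  have ex: "\<exists>s. (\<lambda>n. (s n o\<^sub>L U) - (U o\<^sub>L s n)) \<longlonglongrightarrow> e U" if "approximately_inner N e" for e
    using that[unfolded approximately_inner_def] BDT_poly_intros(1)[of N] by blast
  obtain s where s: "(\<lambda>n. (s n o\<^sub>L U) - (U o\<^sub>L s n)) \<longlonglongrightarrow> d' U"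
    using ex[OF inner(1)] by blast
  obtain s' where s': "(\<lambda>n. (s' n o\<^sub>L U) - (U o\<^sub>L s' n)) \<longlonglongrightarrow> d'' U"
    using ex[OF inner(2)] by blast
  from tendsto_diff[OF s s']
  have "(\<lambda>n. ((s n - s' n) o\<^sub>L U) - (U o\<^sub>L (s n - s' n))) \<longlonglongrightarrow> d' U - d'' U"
    by (simp add: blinfun_compose_bilinear algebra_simps)
  moreover have "d' U - d'' U = U o\<^sub>L (0 - t)"
  proof -
    have "d' U - d'' U = d\<^sub>g U - d\<^sub>f U"
      using eq[OF BDT_poly_intros(1)] by (simp add: algebra_simps)
    also have "\<dots> = U o\<^sub>L (0 - t)"
      using special unfolding special_derivation_iff
      by (simp add: t_def toeplitz_fun_diff[OF f g] blinfun_compose_bilinear scaleR_diff_right)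
    finally show ?thesis .
  qed
  ultimately have lim: "(\<lambda>n. ((s n - s' n) o\<^sub>L U) - (U o\<^sub>L (s n - s' n))) \<longlonglongrightarrow> (U o\<^sub>L (0 - t))"
    by simp
  have "norm t \<le> 0"
  proof (rule field_le_epsilon)
    fix e :: real assume "e > 0"
    then obtain n where "norm ((((s n - s' n) o\<^sub>L U) - (U o\<^sub>L (s n - s' n))) - (U o\<^sub>L (0 - t))) < e"
      using LIMSEQ_D[OF lim] by blast
    from shift_invariant_norm_le[OF t less_imp_le[OF this]]
    show "norm t \<le> 0 + e" by simp
  qed
  then have "t = 0" by simp
  then have "toeplitz_fun N ?h = 0" using N by (simp add: t_def)
  then have "f x = g x" for x
    using le_norm_toeplitz_fun[OF N h, of x] by simp
  then show ?thesis by blast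
qed

theorem theorem4p8:
  fixes N :: nat
    and d :: "(nat ell2 \<Rightarrow>\<^sub>L nat ell2) \<Rightarrow> (nat ell2 \<Rightarrow>\<^sub>L nat ell2)"
  assumes "N > 0"
    and "derivation_in N d"
  shows "\<exists>!f. f \<in> C_circle \<and>
    (\<exists>d\<^sub>f d'. special_derivation N f d\<^sub>f \<and>
      (\<forall>\<delta>. special_derivation N f \<delta> \<longrightarrow> (\<forall>a\<in>BDT_poly N. \<delta> a = d\<^sub>f a)) \<and>
      approximately_inner N d' \<and>
      (\<forall>a\<in>BDT_poly N. d a = d\<^sub>f a + d' a))"
proof (rule ex_ex1I)
  obtain f d\<^sub>f where f: "f \<in> C_circle" "special_derivation N f d\<^sub>f" "approximately_inner N (\<lambda>a. d a - d\<^sub>f a)"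
    using decomposition_exists[OF assms] .
  show "\<exists>f. f \<in> C_circle \<and>
    (\<exists>d\<^sub>f d'. special_derivation N f d\<^sub>f \<and>
      (\<forall>\<delta>. special_derivation N f \<delta> \<longrightarrow> (\<forall>a\<in>BDT_poly N. \<delta> a = d\<^sub>f a)) \<and>
      approximately_inner N d' \<and> (\<forall>a\<in>BDT_poly N. d a = d\<^sub>f a + d' a))"
  proof (intro exI conjI allI impI ballI)
    show "d a = d\<^sub>f a + (\<lambda>a. d a - d\<^sub>f a) a" for a by simp
  qed (use f special_derivation_unique in blast)+
next
  fix f g
  assume "f \<in> C_circle \<and>
    (\<exists>d\<^sub>f d'. special_derivation N f d\<^sub>f \<and>
      (\<forall>\<delta>. special_derivation N f \<delta> \<longrightarrow> (\<forall>a\<in>BDT_poly N. \<delta> a = d\<^sub>f a)) \<and>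
      approximately_inner N d' \<and> (\<forall>a\<in>BDT_poly N. d a = d\<^sub>f a + d' a))"
    and "g \<in> C_circle \<and>
    (\<exists>d\<^sub>f d'. special_derivation N g d\<^sub>f \<and>
      (\<forall>\<delta>. special_derivation N g \<delta> \<longrightarrow> (\<forall>a\<in>BDT_poly N. \<delta> a = d\<^sub>f a)) \<and>
      approximately_inner N d' \<and> (\<forall>a\<in>BDT_poly N. d a = d\<^sub>f a + d' a))"
  then obtain d\<^sub>f d' d\<^sub>g d'' where "f \<in> C_circle" "g \<in> C_circle"
    "special_derivation N f d\<^sub>f" "special_derivation N g d\<^sub>g" "approximately_inner N d'" "approximately_inner N d''"
    "\<forall>a\<in>BDT_poly N. d a = d\<^sub>f a + d' a" "\<forall>a\<in>BDT_poly N. d a = d\<^sub>g a + d'' a"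
    by blast
  then show "f = g" by (intro decomposition_unique[OF assms(1), of f g d\<^sub>f d\<^sub>g d' d'']) auto
qed

end
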